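(* Let $(R,\mathfrak{m},k)$ be an $F$-finite, $F$-pure, Gorenstein Noetherian local ring of dimension $d$ and of prime characteristic $p>0$. The following are equivalent: (i) $a_1(R)=[k^{1/p}:k]$. (ii) There exists $e\in\mathbb{N}$ such that $a_e(R)=[k^{1/p^e}:k]$. (iii) For all $e\in\mathbb{N}$, $a_e(R)=[k^{1/p^e}:k]$. (iv) $I_1(R)=\mathfrak{m}$. (v) There exists $e\in\mathbb{N}$ such that $I_e(R)=\mathfrak{m}$. (vi) For all $e\in\mathbb{N}$, $I_e(R)=\mathfrak{m}$. (vii) The splitting prime ideal $\mathcal{P}(R)$ of $R$ equals $\mathfrak{m}$.
   Context: $\mathbb{N}=\{1,2,3,\dots\}$. $F^e_*R$ is $R$ viewed as an $R$-module by restriction of scalars along the $e$-th iterate of Frobenius, with elements written $F^e_*r$; $R$ is $F$-finite if $F^e_*R$ is a finitely generated $R$-module, and $F$-pure if $R\to F^e_*R$, $1\mapsto F^e_*1$, splits for some (equivalently every) $e\ge1$. The $e$-th Frobenius splitting number $a_e(R)$ is defined by $F^e_*R\cong R^{\oplus a_e(R)}\oplus M_e$ where $M_e$ has no free direct $R$-summand. The $e$-th splitting ideal is $I_e(R)=\{x\in R\mid \text{the } R\text{-linear map } R\to F^e_*R,\ 1\mapsto F^e_*x,\text{ does not split}\}$ (equivalently $\{x\in R\mid F^e_*x\otimes u=0 \text{ in } F^e_*R\otimes_R E_R(k)\}$, with $u$ a socle generator of the injective hull $E_R(k)$). The splitting prime ideal is $\mathcal{P}(R)=\bigcap_{e\ge1}I_e(R)$.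 *)

theory Defs
  imports
    "HOL-Algebra.Algebraic_Closure_Type"
    "HOL-Library.Extended_Nat"
begin

text \<open>
  Rings are types \<open>'a\<close> of class \<open>comm_ring_1\<close>.  An \<open>R\<close>-module is a scalar multiplication \<open>s\<close> satisfying
  the locale \<open>module\<close>, and a submodule is a set satisfying \<open>module.subspace s\<close>; ideals are the
  submodules of \<open>(*)\<close>.
\<close>

section \<open>Noetherian local rings and Krull dimension\<close>

abbreviation is_ideal :: "'a::comm_ring_1 set \<Rightarrow> bool"
  where "is_ideal \<equiv> module.subspace (*)"

definition noetherian :: "'a::comm_ring_1 itself \<Rightarrow> bool"
  where "noetherian _ \<longleftrightarrow> (\<forall>I::'a set. is_ideal I \<longrightarrow> (\<exists>B. finite B \<and> module.span (*) B = I))"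

definition maximal_ideal :: "'a::comm_ring_1 set \<Rightarrow> bool"
  where "maximal_ideal I \<longleftrightarrow> is_ideal I \<and> I \<noteq> UNIV \<and>
           (\<forall>J. is_ideal J \<and> I \<subseteq> J \<longrightarrow> J = I \<or> J = UNIV)"

definition prime_ideal :: "'a::comm_ring_1 set \<Rightarrow> bool"
  where "prime_ideal I \<longleftrightarrow> is_ideal I \<and> I \<noteq> UNIV \<and> (\<forall>x y. x * y \<in> I \<longrightarrow> x \<in> I \<or> y \<in> I)"

definition local_ring :: "'a::comm_ring_1 set \<Rightarrow> bool"
  where "local_ring m \<longleftrightarrow> maximal_ideal m \<and> (\<forall>n. maximal_ideal n \<longrightarrow> n = m)"

text \<open>The residue field is a field \<open>'k\<close> together with a surjection with kernel \<open>m\<close>.\<close>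

definition residue_field_map :: "'a::comm_ring_1 set \<Rightarrow> ('a \<Rightarrow> 'k::field) \<Rightarrow> bool"
  where "residue_field_map m \<pi> \<longleftrightarrow>
           (\<forall>x y. \<pi> (x + y) = \<pi> x + \<pi> y) \<and> (\<forall>x y. \<pi> (x * y) = \<pi> x * \<pi> y) \<and> \<pi> 1 = 1 \<and>
           surj \<pi> \<and> {x. \<pi> x = 0} = m"

definition krull_dim :: "'a::comm_ring_1 itself \<Rightarrow> enat"
  where "krull_dim _ = Sup {enat n | n. \<exists>P::nat \<Rightarrow> 'a set.
           (\<forall>i\<le>n. prime_ideal (P i)) \<and> (\<forall>i<n. P i \<subset> P (Suc i))}"

section \<open>Gorenstein rings\<close>

definition linear_map_on ::
    "('a::comm_ring_1 \<Rightarrow> 'b::ab_group_add \<Rightarrow> 'b) \<Rightarrow> ('a \<Rightarrow> 'c::ab_group_add \<Rightarrow> 'c) \<Rightarrow>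
      'b set \<Rightarrow> 'c set \<Rightarrow> ('b \<Rightarrow> 'c) \<Rightarrow> bool"
  where "linear_map_on s t A B f \<longleftrightarrow>
           (\<forall>x\<in>A. f x \<in> B) \<and>
           (\<forall>x\<in>A. \<forall>y\<in>A. f (x + y) = f x + f y) \<and>
           (\<forall>r. \<forall>x\<in>A. f (s r x) = t r (f x))"

text \<open>
  Linear maps into the submodule \<open>E\<close> extend along every inclusion \<open>A \<subseteq> B\<close> of modules.  The test
  modules \<open>B\<close> live on the type \<open>'a\<close> of the ring, with an arbitrary module structure \<open>u\<close>.  As \<open>R\<close> and
  its ideals are among them, Baer's criterion shows that no larger universe of test modules is needed.
\<close>

definition injective_submodule ::
    "('a::comm_ring_1 \<Rightarrow> 'b::ab_group_add \<Rightarrow> 'b) \<Rightarrow> 'b set \<Rightarrow> bool"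
  where "injective_submodule t E \<longleftrightarrow> module.subspace t E \<and>
           (\<forall>(u :: 'a \<Rightarrow> 'a \<Rightarrow> 'a) A B f.
              Modules.module u \<and> module.subspace u A \<and> module.subspace u B \<and> A \<subseteq> B \<and>
              linear_map_on u t A E f \<longrightarrow>
              (\<exists>g. linear_map_on u t B E g \<and> (\<forall>x\<in>A. g x = f x)))"

text \<open>
  The module \<open>s\<close> on \<open>'c\<close> has a finite injective resolution
  \<open>0 \<rightarrow> M \<rightarrow> E 0 \<rightarrow> E 1 \<rightarrow> \<dots> \<rightarrow> E n \<rightarrow> 0\<close> whose terms are submodules of one ambient module on \<open>'b\<close>
  (for instance of the direct sum of the terms, so that a common ambient module is no restriction).
\<close>

definition finite_injective_dimension ::
    "'b::ab_group_add itself \<Rightarrow> ('a::comm_ring_1 \<Rightarrow> 'c::ab_group_add \<Rightarrow> 'c) \<Rightarrow> bool"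
  where "finite_injective_dimension _ s \<longleftrightarrow>
           (\<exists>(t :: 'a \<Rightarrow> 'b \<Rightarrow> 'b) (E :: nat \<Rightarrow> 'b set) (\<epsilon> :: 'c \<Rightarrow> 'b) (\<delta> :: nat \<Rightarrow> 'b \<Rightarrow> 'b) n.
              Modules.module t \<and>
              (\<forall>i. injective_submodule t (E i)) \<and>
              linear_map_on s t UNIV (E 0) \<epsilon> \<and>
              (\<forall>i. linear_map_on t t (E i) (E (Suc i)) (\<delta> i)) \<and>
              inj \<epsilon> \<and>
              range \<epsilon> = {x \<in> E 0. \<delta> 0 x = 0} \<and>
              (\<forall>i. \<delta> i ` E i = {x \<in> E (Suc i). \<delta> (Suc i) x = 0}) \<and>
              (\<forall>i>n. E i = {0}))"

text \<open>
  A Noetherian local ring is Gorenstein if it has finite injective dimension over itself.  The type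
  \<open>'b\<close> only carries the resolution: assuming \<open>gorenstein TYPE('b) TYPE('a)\<close> for an arbitrary
  type \<open>'b\<close> amounts to assuming a finite injective resolution of \<open>R\<close> by any modules whatsoever.
\<close>

definition gorenstein :: "'b::ab_group_add itself \<Rightarrow> 'a::comm_ring_1 itself \<Rightarrow> bool"
  where "gorenstein b _ \<longleftrightarrow> finite_injective_dimension b ((*) :: 'a \<Rightarrow> 'a \<Rightarrow> 'a)"

section \<open>Frobenius push-forwards\<close>

text \<open>
  The module \<open>F\<^sup>e\<^sub>* R\<close> is the additive group of \<open>R\<close> with the scalar multiplication
  \<open>r \<cdot> F\<^sup>e\<^sub>* x = F\<^sup>e\<^sub>* (r\<^sup>q x)\<close>, where \<open>q = p\<^sup>e\<close>; the element \<open>F\<^sup>e\<^sub>* x\<close> is represented by \<open>x\<close>.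
  The definition is meaningful when \<open>CHAR('a)\<close> is prime.
\<close>

definition frob :: "nat \<Rightarrow> 'a::comm_ring_1 \<Rightarrow> 'a \<Rightarrow> 'a"
  where "frob e r x = r ^ (CHAR('a) ^ e) * x"

lemma module_frob:
  assumes "prime CHAR('a::comm_ring_1)"
  shows "Modules.module (frob e :: 'a \<Rightarrow> 'a \<Rightarrow> 'a)"
  by unfold_locales
    (simp_all add: frob_def algebra_simps power_mult_distrib freshmans_dream' assms)

definition F_finite :: "'a::comm_ring_1 itself \<Rightarrow> bool"
  where "F_finite _ \<longleftrightarrow>
           (\<exists>e\<ge>1. \<exists>B::'a set. finite B \<and> module.span (frob e) B = UNIV)"

definition splits ::
    "('a::comm_ring_1 \<Rightarrow> 'b::ab_group_add \<Rightarrow> 'b) \<Rightarrow> ('a \<Rightarrow> 'c::ab_group_add \<Rightarrow> 'c) \<Rightarrow>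
      ('b \<Rightarrow> 'c) \<Rightarrow> bool"
  where "splits s t f \<longleftrightarrow> (\<exists>g. module_hom t s g \<and> g \<circ> f = id)"

text \<open>The linear map \<open>\<lambda>r. frob e r x\<close> is the map \<open>R \<rightarrow> F\<^sup>e\<^sub>* R\<close> sending \<open>1\<close> to \<open>F\<^sup>e\<^sub>* x\<close>.\<close>

definition F_pure :: "'a::comm_ring_1 itself \<Rightarrow> bool"
  where "F_pure _ \<longleftrightarrow> (\<exists>e\<ge>1. splits (*) (frob e) (\<lambda>r::'a. frob e r 1))"

definition splitting_ideal :: "nat \<Rightarrow> 'a::comm_ring_1 set"
  where "splitting_ideal e = {x. \<not> splits (*) (frob e) (\<lambda>r. frob e r x)}"

definition splitting_prime :: "'a::comm_ring_1 set"
  where "splitting_prime = (\<Inter>e\<in>{1..}. splitting_ideal e)"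

section \<open>Frobenius splitting numbers\<close>

definition free_of_rank ::
    "('a::comm_ring_1 \<Rightarrow> 'b::ab_group_add \<Rightarrow> 'b) \<Rightarrow> 'b set \<Rightarrow> nat \<Rightarrow> bool"
  where "free_of_rank s N n \<longleftrightarrow>
           (\<exists>B. finite B \<and> card B = n \<and> \<not> module.dependent s B \<and> module.span s B = N)"

definition direct_sum_decomp ::
    "('a::comm_ring_1 \<Rightarrow> 'b::ab_group_add \<Rightarrow> 'b) \<Rightarrow> 'b set \<Rightarrow> 'b set \<Rightarrow> 'b set \<Rightarrow> bool"
  where "direct_sum_decomp s M N N' \<longleftrightarrow>
           module.subspace s N \<and> module.subspace s N' \<and>
           N \<inter> N' = {0} \<and> M = {x + y | x y. x \<in> N \<and> y \<in> N'}"

definition has_free_summand ::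
    "('a::comm_ring_1 \<Rightarrow> 'b::ab_group_add \<Rightarrow> 'b) \<Rightarrow> 'b set \<Rightarrow> bool"
  where "has_free_summand s M \<longleftrightarrow> (\<exists>N N'. direct_sum_decomp s M N N' \<and> free_of_rank s N 1)"

text \<open>
  The number \<open>a\<^sub>e(R)\<close>.  It exists and is unique when \<open>R\<close> is an \<open>F\<close>-finite Noetherian local ring.
\<close>

definition splitting_number :: "'a::comm_ring_1 itself \<Rightarrow> nat \<Rightarrow> nat"
  where "splitting_number _ e = (THE a. \<exists>N M :: 'a set.
           direct_sum_decomp (frob e) UNIV N M \<and> free_of_rank (frob e) N a \<and>
           \<not> has_free_summand (frob e) M)"

section \<open>The degree of \<open>k\<^sup>1\<^sup>/\<^sup>q\<close> over \<open>k\<close>\<close>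

text \<open>
  \<open>k\<^sup>1\<^sup>/\<^sup>q\<close> consists of the \<open>q\<close>-th roots of elements of \<open>k\<close> in an algebraic closure.
  Note that \<open>dim\<close> is \<open>0\<close> in infinite dimension, which is excluded if \<open>k\<close> is the residue field of
  an \<open>F\<close>-finite ring.
\<close>

definition root_field :: "nat \<Rightarrow> 'k::field alg_closure set"
  where "root_field q = {z. z ^ q \<in> range to_ac}"

definition root_degree :: "'k::field itself \<Rightarrow> nat \<Rightarrow> nat"
  where "root_degree _ q =
           vector_space.dim (\<lambda>(c::'k) z. to_ac c * z) (root_field q :: 'k alg_closure set)"

end

theory Submission
  imports Defs "HOL-Library.Function_Algebras"
begin

text \<open>
  An element \<open>x\<close> lies in \<open>I\<^sub>e(R)\<close> iff every linear map \<open>F\<^sup>e\<^sub>* R \<rightarrow> R\<close> sends \<open>x\<close> into \<open>m\<close>. Hence \<open>a\<^sub>e(R)\<close> is the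
  dimension of \<open>F\<^sup>e\<^sub>* R / I\<^sub>e(R)\<close> over \<open>k\<close>, and comparing with the quotient \<open>F\<^sup>e\<^sub>* k\<close> shows that
  \<open>a\<^sub>e(R) = [k\<^sup>1\<^sup>/\<^sup>q : k]\<close> iff \<open>I\<^sub>e(R) = m\<close>. If \<open>I\<^sub>1(R) \<noteq> m\<close>, iterating a splitting of some \<open>F\<^sub>* x\<close> with
  \<open>x \<in> m\<close> gives \<open>I\<^sub>e(R) \<noteq> m\<close> for all \<open>e\<close>.

  The Gorenstein hypothesis is needed for \<open>I\<^sub>1(R) = m \<Longrightarrow> I\<^sub>e(R) = m\<close>. Let \<open>J\<close> be generated by a maximal regular
  sequence and let \<open>u\<close> represent a nonzero socle element of \<open>R / J\<close>. Change of rings turns the finite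
  injective resolution of \<open>R\<close> into one of \<open>R / J\<close>, and by an argument of Bass (descending induction on
  the degree of \<open>Ext\<close>, Noetherian induction and Nakayama) \<open>R / J\<close> is self-injective. As the sequence is also
  regular on \<open>F\<^sub>* R\<close>, maps \<open>F\<^sub>* R \<rightarrow> R / J\<close> lift to \<open>R\<close>, so an element outside \<open>J F\<^sub>* R\<close> is sent outside \<open>J\<close> by
  some \<open>F\<^sub>* R \<rightarrow> R\<close>. This forces \<open>m u\<^sup>q \<subseteq> J\<^sup>[\<^sup>q\<^sup>]\<close> for all \<open>q = p\<^sup>e\<close>, and then a map with \<open>\<phi>(a) = 1\<close>, \<open>a \<in> m\<close>, would give
  \<open>u = \<phi>(u\<^sup>q a) \<in> J\<close>.
\<close>

section \<open>Noetherian local rings\<close>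

text \<open>The ideals vary while the types are fixed, so no quotient ring or module is formed. A
  module over \<open>R / I\<close> is an \<open>R\<close>-module killed by \<open>I\<close>; a
  homomorphism into \<open>R / I\<close> is a map into \<open>R\<close> that is linear up to
  \<open>I\<close>, or a linear map into \<open>range \<epsilon>\<close>; Ext is read off from
  cocycles and coboundaries of a given complex. Hence injectivity appears as the relative criterion
  \<open>baer t I\<close>.

  Self-injectivity of \<open>R / J\<close> only yields maps \<open>F_* R -> R / J\<close>. Lifting
  them to \<open>R\<close> needs \<open>Ext^1(F_* R, R / I) = 0\<close> for each ideal
  \<open>I\<close> generated by an initial segment of the sequence. For \<open>I = J\<close> this
  combines self-injectivity with \<open>Tor_1(F_* R, R / J) = 0\<close>, where regularity on
  \<open>F_* R\<close> enters; Nakayama's lemma then removes the elements of the sequence one at a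
  time. As \<open>x\<close> acts on \<open>F_* R\<close> by \<open>x^p\<close>, regularity on
  \<open>F_* R\<close> means regularity of the \<open>p\<close>-th powers on \<open>R\<close>.

  Separating maps are needed for all the Frobenius powers of \<open>J\<close>, because the socle
  statement passes from \<open>q\<close> to \<open>p q\<close> by one use of
  \<open>I_1(R) = m\<close>.\<close>

interpretation R: Modules.module "(*) :: 'a::comm_ring_1 \<Rightarrow> 'a \<Rightarrow> 'a"
  by unfold_locales (simp_all add: algebra_simps)

declare R.scale_scale [simp del] \<comment> \<open>the reverse of \<open>mult.assoc\<close>\<close>

lemma is_idealI:
  assumes "(0::'a::comm_ring_1) \<in> I" "\<And>x y. x \<in> I \<Longrightarrow> y \<in> I \<Longrightarrow> x + y \<in> I"
    "\<And>r x. x \<in> I \<Longrightarrow> r * x \<in> I"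
  shows "is_ideal I"
  using assms by (auto simp: R.subspace_def)

lemma is_ideal_mult_left: "is_ideal I \<Longrightarrow> x \<in> I \<Longrightarrow> r * x \<in> I"
  by (rule R.subspace_scale)

lemma is_ideal_mult_right: "is_ideal I \<Longrightarrow> x \<in> I \<Longrightarrow> x * r \<in> I" for x :: "'a::comm_ring_1"
  using R.subspace_scale[of I x r] by (simp add: mult.commute)

lemma is_ideal_UNIV_iff: "is_ideal I \<Longrightarrow> I = UNIV \<longleftrightarrow> (1::'a::comm_ring_1) \<in> I"
  using R.subspace_scale[of I 1] by auto

text \<open>The union of a chain of ideals is finitely generated, hence equal to a member that
  contains the generators, so Zorn's lemma applies.\<close>

lemma noetherian_maximal_element:
  assumes noeth: "noetherian TYPE('a::comm_ring_1)"
    and "S \<noteq> {}" and ideals: "\<And>I. I \<in> S \<Longrightarrow> is_ideal (I::'a set)"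
  obtains M where "M \<in> S" "\<And>I. I \<in> S \<Longrightarrow> M \<subseteq> I \<Longrightarrow> I = M"
proof -
  have "\<Union>C \<in> S" if C: "C \<noteq> {}" "subset.chain S C" for C
  proof -
    have CS: "C \<subseteq> S" and chain: "\<And>A B. A \<in> C \<Longrightarrow> B \<in> C \<Longrightarrow> A \<subseteq> B \<or> B \<subseteq> A"
      using C(2) by (auto simp: subset.chain_def)
    have "is_ideal (\<Union>C)"
    proof (rule is_idealI)
      show "0 \<in> \<Union>C" using C(1) CS ideals R.subspace_0 by (metis UnionI ex_in_conv subset_iff)
    next
      fix x y assume "x \<in> \<Union>C" "y \<in> \<Union>C"
      then obtain A B where "A \<in> C" "x \<in> A" "B \<in> C" "y \<in> B" by auto
      then obtain D where "D \<in> C" "x \<in> D" "y \<in> D" using chain by blast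
      then show "x + y \<in> \<Union>C" using CS ideals R.subspace_add by blast
    next
      fix r x assume "x \<in> \<Union>C"
      then show "r * x \<in> \<Union>C" using CS ideals R.subspace_scale by blast
    qed
    then obtain B where B: "finite B" "R.span B = \<Union>C"
      using noeth by (auto simp: noetherian_def)
    have "\<exists>A\<in>C. B' \<subseteq> A" if "finite B'" "B' \<subseteq> \<Union>C" for B'
      using that
    proof (induction B' rule: finite_induct)
      case empty then show ?case using C(1) by auto
    next
      case (insert b B')
      then obtain A A' where "A \<in> C" "B' \<subseteq> A" "A' \<in> C" "b \<in> A'" by auto
      then show ?case using chain[of A A'] by blast
    qed
    from this[OF B(1)] B(2) R.span_superset[of B] obtain A where A: "A \<in> C" "B \<subseteq> A" by auto
    then have "\<Union>C \<subseteq> A" using B(2) R.span_minimal[of B A] CS ideals by blast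
    with A have "\<Union>C = A" by blast
    then show ?thesis using A CS by auto
  qed
  from subset_Zorn_nonempty[OF \<open>S \<noteq> {}\<close> this] that show ?thesis by blast
qed

text \<open>For maximizing an ideal attached to other data: the annihilator of an element, the span
  of a finite set, the ideal of a regular sequence.\<close>

corollary noetherian_maximal_index:
  assumes "noetherian TYPE('a::comm_ring_1)" "P a" "\<And>a. is_ideal (f a :: 'a set)"
  obtains b where "P b" "\<And>c. P c \<Longrightarrow> f b \<subseteq> f c \<Longrightarrow> f c = f b"
proof -
  have "f ` Collect P \<noteq> {}" using assms(2) by auto
  then obtain M where M: "M \<in> f ` Collect P" and max: "\<And>I. I \<in> f ` Collect P \<Longrightarrow> M \<subseteq> I \<Longrightarrow> I = M"
    using noetherian_maximal_element[OF assms(1), of "f ` Collect P"] assms(3) by (metis imageE)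
  then obtain b where b: "P b" "M = f b" by auto
  show ?thesis by (rule that[OF b(1)]) (use max b(2) in auto)
qed

lemma noetherian_induct:
  assumes noeth: "noetherian TYPE('a::comm_ring_1)"
    and "is_ideal (I::'a set)"
    and step: "\<And>I. is_ideal I \<Longrightarrow> (\<And>J. is_ideal J \<Longrightarrow> I \<subset> J \<Longrightarrow> P J) \<Longrightarrow> P I"
  shows "P I"
proof (rule ccontr)
  assume "\<not> P I"
  define S where "S = {I. is_ideal I \<and> \<not> P I}"
  have "S \<noteq> {}" "\<And>I. I \<in> S \<Longrightarrow> is_ideal I" using \<open>\<not> P I\<close> assms(2) by (auto simp: S_def)
  then obtain M where M: "M \<in> S" "\<And>J. J \<in> S \<Longrightarrow> M \<subseteq> J \<Longrightarrow> J = M"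
    using noetherian_maximal_element[OF noeth] by metis
  have "P M"
  proof (rule step)
    show "is_ideal M" using M(1) by (simp add: S_def)
    fix J assume "is_ideal J" "M \<subset> J"
    then show "P J" using M(2)[of J] by (auto simp: S_def)
  qed
  then show False using M(1) by (simp add: S_def)
qed

locale noetherian_local =
  fixes m :: "'a::comm_ring_1 set"
  assumes noetherian: "noetherian TYPE('a)" and local: "local_ring m"
begin

lemma is_ideal_m: "is_ideal m"
  using local by (auto simp: local_ring_def maximal_ideal_def)

lemma one_notin_m: "1 \<notin> m"
  using local is_ideal_UNIV_iff[OF is_ideal_m] by (auto simp: local_ring_def maximal_ideal_def)

lemma proper_ideal_subset_m:
  assumes "is_ideal I" "1 \<notin> I"
  shows "I \<subseteq> m"
proof -
  obtain M where M: "is_ideal M \<and> I \<subseteq> M \<and> 1 \<notin> M"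
    and max: "\<And>J. is_ideal J \<and> I \<subseteq> J \<and> 1 \<notin> J \<Longrightarrow> M \<subseteq> J \<Longrightarrow> J = M"
  proof -
    define S where "S = {J. is_ideal J \<and> I \<subseteq> J \<and> 1 \<notin> J}"
    have "S \<noteq> {}" "\<And>I. I \<in> S \<Longrightarrow> is_ideal I" using assms by (auto simp: S_def)
    then obtain M where "M \<in> S" "\<And>J. J \<in> S \<Longrightarrow> M \<subseteq> J \<Longrightarrow> J = M"
      using noetherian_maximal_element[OF noetherian] by metis
    then show ?thesis using that[of M] by (simp add: S_def)
  qed
  have "maximal_ideal M"
    unfolding maximal_ideal_def
  proof (intro conjI allI impI)
    show "M \<noteq> UNIV" using M by auto
    fix J assume "is_ideal J \<and> M \<subseteq> J"
    then show "J = M \<or> J = UNIV" using M max[of J] is_ideal_UNIV_iff[of J] by blast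
  qed (use M in simp)
  then have "M = m" using local by (auto simp: local_ring_def)
  then show ?thesis using M by auto
qed

lemma unit_if_notin_m:
  assumes "x \<notin> m"
  obtains y where "y * x = 1"
proof -
  have "is_ideal (R.span {x})" by simp
  moreover have "\<not> R.span {x} \<subseteq> m" using R.span_base[of x "{x}"] assms by auto
  ultimately have "1 \<in> R.span {x}" using proper_ideal_subset_m by blast
  then show ?thesis using that by (auto simp: R.span_singleton)
qed

lemma colon_subset_m:
  assumes "is_ideal I" "u \<notin> I" "r * u \<in> I"
  shows "r \<in> m"
proof (rule ccontr)
  assume "r \<notin> m"
  then obtain y where "y * r = 1" using unit_if_notin_m by blast
  moreover have "y * (r * u) \<in> I" using assms is_ideal_mult_left by blast
  ultimately show False using assms(2) by (simp add: mult.assoc[symmetric])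
qed

end

section \<open>Prime avoidance\<close>

lemma ex_in_all_not_in_prime:
  assumes "finite Q" "prime_ideal (P::'a::comm_ring_1 set)"
    and "\<And>A. A \<in> Q \<Longrightarrow> is_ideal A" "\<And>A. A \<in> Q \<Longrightarrow> \<not> A \<subseteq> P"
  shows "\<exists>w. (\<forall>A\<in>Q. w \<in> A) \<and> w \<notin> P"
  using assms(1,3,4)
proof (induction Q rule: finite_induct)
  case empty
  then show ?case using assms(2) by (auto simp: prime_ideal_def)
next
  case (insert A Q)
  then obtain w where w: "\<forall>A\<in>Q. w \<in> A" "w \<notin> P" by auto
  obtain a where a: "a \<in> A" "a \<notin> P" using insert.prems by blast
  have "w * a \<notin> P" using w a assms(2) by (auto simp: prime_ideal_def)
  moreover have "w * a \<in> A" using a insert.prems(1) is_ideal_mult_left by blast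
  moreover have "w * a \<in> B" if "B \<in> Q" for B
    using that w insert.prems(1)[of B] is_ideal_mult_right by blast
  ultimately show ?case by blast
qed

text \<open>If \<open>x\<close> avoids all primes but \<open>P\<close>, adding an element of
  \<open>I\<close> and of the other primes that lies outside \<open>P\<close> repairs this. Such an
  element exists because the primes are pairwise incomparable, as maximal annihilators are.\<close>

lemma prime_avoidance:
  assumes "finite Q" and prime: "\<And>P. P \<in> Q \<Longrightarrow> prime_ideal (P::'a::comm_ring_1 set)"
    and anti: "\<And>P P'. P \<in> Q \<Longrightarrow> P' \<in> Q \<Longrightarrow> P \<subseteq> P' \<Longrightarrow> P = P'"
    and "is_ideal I" "\<And>P. P \<in> Q \<Longrightarrow> \<not> I \<subseteq> P"
  shows "\<exists>x\<in>I. \<forall>P\<in>Q. x \<notin> P"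
  using assms(1,2,3,5)
proof (induction Q rule: finite_induct)
  case empty
  then show ?case using R.subspace_0[OF \<open>is_ideal I\<close>] by auto
next
  case (insert P Q)
  have id: "is_ideal A" if "A \<in> insert P Q" for A
    using insert.prems(1)[OF that] by (simp add: prime_ideal_def)
  have "\<exists>x\<in>I. \<forall>P\<in>Q. x \<notin> P"
    by (rule insert.IH) (use insert.prems in auto)
  then obtain x where x: "x \<in> I" "\<forall>P\<in>Q. x \<notin> P" by auto
  show ?case
  proof (cases "x \<in> P")
    case False then show ?thesis using x by auto
  next
    case True
    have "\<exists>w. (\<forall>A\<in>insert I Q. w \<in> A) \<and> w \<notin> P"
    proof (rule ex_in_all_not_in_prime)
      fix A assume A: "A \<in> insert I Q"
      show "\<not> A \<subseteq> P"
        using A insert.prems(2)[of A P] insert.prems(3)[of P] insert.hyps(2) by auto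
      show "is_ideal A" using A id \<open>is_ideal I\<close> by auto
    qed (use insert in auto)
    then obtain w where w: "w \<in> I" "\<forall>A\<in>Q. w \<in> A" "w \<notin> P" by auto
    have "x + w \<in> I" using x w \<open>is_ideal I\<close> R.subspace_add by blast
    moreover have "x + w \<notin> P"
      using True w(3) R.subspace_diff[OF id, of P "x + w" x] by auto
    moreover have "x + w \<notin> A" if "A \<in> Q" for A
      using that x w R.subspace_diff[OF id, of A "x + w" w] by auto
    ultimately show ?thesis by auto
  qed
qed

lemma is_ideal_colon:
  assumes "is_ideal I" shows "is_ideal {r::'a::comm_ring_1. r * a \<in> I}"
  by (rule is_idealI)
    (use assms R.subspace_0 R.subspace_add R.subspace_scale in \<open>auto simp: distrib_right mult.assoc\<close>)

text \<open>The maximal annihilators of nonzero elements of \<open>R / I\<close> are primes whose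
  union contains all zero divisors. Without a socle none of them contains \<open>m\<close>, so prime
  avoidance applies once they are known to be finitely many.\<close>

lemma (in noetherian_local) ex_regular_element:
  assumes I: "is_ideal I" "I \<noteq> UNIV" and no_socle: "\<And>u. (\<And>a. a \<in> m \<Longrightarrow> a * u \<in> I) \<Longrightarrow> u \<in> I"
  shows "\<exists>x\<in>m. \<forall>z. x * z \<in> I \<longrightarrow> z \<in> I"
proof -
  define ann where "ann a = {r. r * a \<in> I}" for a
  define Ass where "Ass = {a. a \<notin> I \<and> (\<forall>b. b \<notin> I \<longrightarrow> ann a \<subseteq> ann b \<longrightarrow> ann b = ann a)}"
  have id: "is_ideal (ann a)" for a unfolding ann_def by (rule is_ideal_colon[OF I(1)])
  have mono: "ann a \<subseteq> ann (c * a)" for a c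
  proof
    fix x assume "x \<in> ann a"
    then have "c * (x * a) \<in> I" using I(1) is_ideal_mult_left by (auto simp: ann_def)
    then show "x \<in> ann (c * a)" by (simp only: ann_def mem_Collect_eq mult.left_commute[of x c a])
  qed
  have ex: "\<exists>a\<in>Ass. ann b \<subseteq> ann a" if b: "b \<notin> I" for b
  proof -
    obtain a where a: "a \<notin> I \<and> ann b \<subseteq> ann a"
      "\<And>c. c \<notin> I \<and> ann b \<subseteq> ann c \<Longrightarrow> ann a \<subseteq> ann c \<Longrightarrow> ann c = ann a"
      by (rule noetherian_maximal_index[OF noetherian, where P = "\<lambda>a. a \<notin> I \<and> ann b \<subseteq> ann a" and f = ann])
        (use b id in auto)
    then have "a \<in> Ass" unfolding Ass_def by (simp, meson order_trans)
    then show ?thesis using a(1) by blast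
  qed
  have prime: "prime_ideal (ann a)" if a: "a \<in> Ass" for a
    unfolding prime_ideal_def
  proof (intro conjI allI impI)
    show "is_ideal (ann a)" by (rule id)
    show "ann a \<noteq> UNIV" using a unfolding Ass_def ann_def
      using UNIV_I mult_1 by (metis (mono_tags, lifting) mem_Collect_eq)
    fix x y assume xy: "x * y \<in> ann a"
    show "x \<in> ann a \<or> y \<in> ann a"
    proof (rule ccontr)
      assume "\<not> ?thesis"
      then have "y * a \<notin> I" "x \<notin> ann a" by (auto simp: ann_def)
      then have "ann (y * a) = ann a" using a mono[of a y] unfolding Ass_def by auto
      moreover have "x \<in> ann (y * a)" using xy by (auto simp: ann_def mult.assoc)
      ultimately show False using \<open>x \<notin> ann a\<close> by auto
    qed
  qed
  \<comment> \<open>With \<open>I + (F)\<close> maximal for finite \<open>F\<close>, each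
    \<open>a\<close> in \<open>Ass\<close> lies in it. If \<open>ann a\<close> were new, some
    \<open>w\<close> outside this prime would kill all of \<open>F\<close> modulo \<open>I\<close>,
    hence also \<open>a\<close>, a contradiction.\<close>
  obtain F where F: "finite F \<and> F \<subseteq> Ass" and max: "\<And>F'. finite F' \<and> F' \<subseteq> Ass \<Longrightarrow>
      R.span (I \<union> F) \<subseteq> R.span (I \<union> F') \<Longrightarrow> R.span (I \<union> F') = R.span (I \<union> F)"
    by (rule noetherian_maximal_index[OF noetherian, where P = "\<lambda>F. finite F \<and> F \<subseteq> Ass"
        and f = "\<lambda>F. R.span (I \<union> F)", of "{}"]) auto
  have "ann a \<in> ann ` F" if a: "a \<in> Ass" for a
  proof (rule ccontr)
    assume notin: "ann a \<notin> ann ` F"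
    have "R.span (I \<union> insert a F) = R.span (I \<union> F)"
      by (rule max) (use F a R.span_mono[of "I \<union> F" "I \<union> insert a F"] in auto)
    then have aM: "a \<in> R.span (I \<union> F)" using R.span_base[of a "I \<union> insert a F"] by auto
    have "\<exists>w. (\<forall>A\<in>ann ` F. w \<in> A) \<and> w \<notin> ann a"
    proof (rule ex_in_all_not_in_prime)
      fix A assume "A \<in> ann ` F"
      then obtain b where b: "b \<in> F" "A = ann b" by auto
      show "is_ideal A" using b id by simp
      show "\<not> A \<subseteq> ann a"
      proof
        assume "A \<subseteq> ann a"
        then have "ann a = ann b" using b F a unfolding Ass_def by blast
        then show False using notin b by auto
      qed
    qed (use F prime a in auto)
    then obtain w where w: "\<And>b. b \<in> F \<Longrightarrow> w * b \<in> I" "w \<notin> ann a" by (auto simp: ann_def)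
    have "w \<in> {r. r * a \<in> I}"
    proof -
      have "I \<union> F \<subseteq> {z. z * w \<in> I}" using w I(1) is_ideal_mult_right by (auto simp: mult.commute)
      then have "R.span (I \<union> F) \<subseteq> {z. z * w \<in> I}" by (rule R.span_minimal) (rule is_ideal_colon[OF I(1)])
      then show ?thesis using aM by (auto simp: mult.commute)
    qed
    then show False using w(2) by (simp add: ann_def)
  qed
  then have Asseq: "ann ` Ass = ann ` F" using F by auto
  have "\<exists>x\<in>m. \<forall>P\<in>ann ` Ass. x \<notin> P"
  proof (rule prime_avoidance)
    show "finite (ann ` Ass)" using F by (simp add: Asseq)
    show "is_ideal m" by (rule is_ideal_m)
    fix P assume P: "P \<in> ann ` Ass"
    then show "prime_ideal P" using prime by auto
    show "\<not> m \<subseteq> P" using P no_socle by (auto simp: Ass_def ann_def)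
    fix P' assume P': "P' \<in> ann ` Ass" "P \<subseteq> P'"
    then show "P = P'" using P unfolding Ass_def by auto
  qed
  then obtain x where x: "x \<in> m" "\<And>a. a \<in> Ass \<Longrightarrow> x \<notin> ann a" by auto
  have "z \<in> I" if "x * z \<in> I" for z
    using ex[of z] x(2) that by (auto simp: ann_def)
  then show ?thesis using x(1) by auto
qed

section \<open>Regular sequences\<close>

text \<open>
  \<open>add_mult s L x\<close> is \<open>L + xM\<close>; thus \<open>regular_seq s L xs\<close> says that \<open>xs\<close> is a (weakly) regular
  sequence on \<open>M / L\<close>.
\<close>

definition add_mult :: "('a::comm_ring_1 \<Rightarrow> 'c::ab_group_add \<Rightarrow> 'c) \<Rightarrow> 'c set \<Rightarrow> 'a \<Rightarrow> 'c set"
  where "add_mult s L x = {l + s x v | l v. l \<in> L}"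

fun add_mults :: "('a::comm_ring_1 \<Rightarrow> 'c::ab_group_add \<Rightarrow> 'c) \<Rightarrow> 'c set \<Rightarrow> 'a list \<Rightarrow> 'c set"
  where "add_mults s L [] = L"
  | "add_mults s L (x # xs) = add_mults s (add_mult s L x) xs"

fun regular_seq :: "('a::comm_ring_1 \<Rightarrow> 'c::ab_group_add \<Rightarrow> 'c) \<Rightarrow> 'c set \<Rightarrow> 'a list \<Rightarrow> bool"
  where "regular_seq s L [] \<longleftrightarrow> True"
  | "regular_seq s L (x # xs) \<longleftrightarrow>
       (\<forall>v. s x v \<in> L \<longrightarrow> v \<in> L) \<and> regular_seq s (add_mult s L x) xs"

lemma (in Modules.module) subspace_add_mult:
  assumes "subspace L" shows "subspace (add_mult scale L x)"
  unfolding subspace_def add_mult_def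
proof (intro conjI ballI allI)
  show "0 \<in> {l + scale x v | l v. l \<in> L}"
    using subspace_0[OF assms] by (auto intro!: exI[of _ 0])
next
  fix a b assume "a \<in> {l + scale x v | l v. l \<in> L}" "b \<in> {l + scale x v | l v. l \<in> L}"
  then obtain l v l' v' where *: "a = l + scale x v" "b = l' + scale x v'" "l \<in> L" "l' \<in> L" by auto
  then have "a + b = (l + l') + scale x (v + v')" by (simp add: scale_right_distrib)
  then show "a + b \<in> {l + scale x v | l v. l \<in> L}" using * subspace_add[OF assms] by blast
next
  fix c a assume "a \<in> {l + scale x v | l v. l \<in> L}"
  then obtain l v where *: "a = l + scale x v" "l \<in> L" by auto
  then have "scale c a = scale c l + scale x (scale c v)"
    by (simp add: scale_right_distrib mult.commute)
  then show "scale c a \<in> {l + scale x v | l v. l \<in> L}" using * subspace_scale[OF assms] by blast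
qed

lemma (in Modules.module) add_mult_superset: "L \<subseteq> add_mult scale L x"
proof
  fix l assume "l \<in> L"
  moreover have "l = l + scale x 0" by simp
  ultimately show "l \<in> add_mult scale L x" unfolding add_mult_def by blast
qed

lemma (in Modules.module) add_mult_memI: "subspace L \<Longrightarrow> scale x v \<in> add_mult scale L x"
  unfolding add_mult_def using subspace_0 by force

lemma (in Modules.module) subspace_add_mults:
  "subspace L \<Longrightarrow> subspace (add_mults scale L xs)"
  by (induction xs arbitrary: L) (auto intro: subspace_add_mult)

lemma (in Modules.module) add_mults_superset: "L \<subseteq> add_mults scale L xs"
  by (induction xs arbitrary: L) (use add_mult_superset in fastforce)+

lemma add_mult_commute:
  fixes s :: "'a::comm_ring_1 \<Rightarrow> 'c::ab_group_add \<Rightarrow> 'c"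
  shows "add_mult s (add_mult s L x) y = add_mult s (add_mult s L y) x"
proof -
  have "add_mult s (add_mult s L x) y \<subseteq> add_mult s (add_mult s L y) x" for x y
  proof
    fix z assume "z \<in> add_mult s (add_mult s L x) y"
    then obtain l v w where "l \<in> L" "z = (l + s x v) + s y w" by (auto simp: add_mult_def)
    then have "z = (l + s y w) + s x v" "l + s y w \<in> add_mult s L y"
      by (auto simp: add_mult_def algebra_simps)
    then show "z \<in> add_mult s (add_mult s L y) x" unfolding add_mult_def[of s "add_mult s L y"] by blast
  qed
  then show ?thesis by blast
qed

lemma add_mults_snoc: "add_mults s L (xs @ [x]) = add_mult s (add_mults s L xs) x"
  by (induction xs arbitrary: L) auto

lemma regular_seq_snoc:
  "regular_seq s L (xs @ [x]) \<longleftrightarrow>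
     regular_seq s L xs \<and> (\<forall>v. s x v \<in> add_mults s L xs \<longrightarrow> v \<in> add_mults s L xs)"
  by (induction xs arbitrary: L) auto

text \<open>Choose the sequence so that its ideal is maximal. Without a socle element a further
  regular \<open>x\<close> could be appended without enlarging the ideal; then \<open>x\<close> lies
  in it, and by regularity so does 1.\<close>

lemma (in noetherian_local) ex_maximal_regular_seq:
  obtains xs u where "set xs \<subseteq> m" "regular_seq (*) {0} xs"
    "u \<notin> add_mults (*) {0} xs" "\<And>a. a \<in> m \<Longrightarrow> a * u \<in> add_mults (*) {0} xs"
proof -
  let ?J = "\<lambda>xs. add_mults (*) {0::'a} xs"
  have id: "is_ideal (?J xs)" for xs by (rule R.subspace_add_mults) simp
  obtain xs where xs: "set xs \<subseteq> m \<and> regular_seq (*) {0} xs" and max: "\<And>ys. set ys \<subseteq> m \<and>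
      regular_seq (*) {0} ys \<Longrightarrow> ?J xs \<subseteq> ?J ys \<Longrightarrow> ?J ys = ?J xs"
    by (rule noetherian_maximal_index[OF noetherian, where f = ?J and
        P = "\<lambda>xs. set xs \<subseteq> m \<and> regular_seq (*) {0} xs", of "[]"]) (auto simp: id)
  have sub: "?J ys \<subseteq> m" if "set ys \<subseteq> m" for ys
  proof -
    have "add_mults (*) L ys \<subseteq> m" if "L \<subseteq> m" "set ys \<subseteq> m" for L
      using that
    proof (induction ys arbitrary: L)
      case (Cons y ys)
      have "add_mult (*) L y \<subseteq> m"
        using Cons.prems is_ideal_mult_right[OF is_ideal_m] R.subspace_add[OF is_ideal_m]
        by (auto simp: add_mult_def)
      then show ?case using Cons by simp
    qed simp
    then show ?thesis using that R.subspace_0[OF is_ideal_m] by blast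
  qed
  have "\<exists>u. (\<forall>a\<in>m. a * u \<in> ?J xs) \<and> u \<notin> ?J xs"
  proof (rule ccontr)
    assume "\<not> ?thesis"
    then have *: "\<And>u. (\<And>a. a \<in> m \<Longrightarrow> a * u \<in> ?J xs) \<Longrightarrow> u \<in> ?J xs" by blast
    have "?J xs \<noteq> UNIV" using sub[OF xs[THEN conjunct1]] one_notin_m by auto
    then obtain x where x: "x \<in> m" "\<forall>z. x * z \<in> ?J xs \<longrightarrow> z \<in> ?J xs"
      using ex_regular_element[OF id _ *] by auto
    have "?J (xs @ [x]) = ?J xs"
    proof (rule max)
      show "?J xs \<subseteq> ?J (xs @ [x])" unfolding add_mults_snoc by (rule R.add_mult_superset)
    qed (use x xs in \<open>auto simp: regular_seq_snoc\<close>)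
    then have "x * 1 \<in> ?J xs" unfolding add_mults_snoc using R.add_mult_memI[OF id, of x 1 xs] by simp
    then have "1 \<in> ?J xs" using x(2) by blast
    then show False using sub[OF xs[THEN conjunct1]] one_notin_m by auto
  qed
  then obtain u where "u \<notin> ?J xs" "\<And>a. a \<in> m \<Longrightarrow> a * u \<in> ?J xs" by blast
  with xs show ?thesis using that by blast
qed

section \<open>Permutations and powers of regular sequences\<close>

lemma regular_swap:
  fixes x y :: "'a::comm_ring_1"
  assumes I: "is_ideal I" and x: "\<And>z. x * z \<in> I \<Longrightarrow> z \<in> I"
    and y: "\<And>z. y * z \<in> add_mult (*) I x \<Longrightarrow> z \<in> add_mult (*) I x"
    and xz: "x * z \<in> add_mult (*) I y"
  shows "z \<in> add_mult (*) I y"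
proof -
  obtain i c where ic: "i \<in> I" "x * z = i + y * c" using xz by (auto simp: add_mult_def)
  then have "y * c = - i + x * z" by simp
  \<comment> \<open>Regularity of \<open>y\<close> modulo \<open>x\<close> makes \<open>c\<close> a
    multiple of \<open>x\<close> up to \<open>I\<close>, after which \<open>x\<close> can be
    cancelled from the whole equation.\<close>
  then have "c \<in> add_mult (*) I x" using y R.subspace_neg[OF I] ic(1) unfolding add_mult_def by blast
  then obtain i' c' where c: "i' \<in> I" "c = i' + x * c'" by (auto simp: add_mult_def)
  have "x * (z - y * c') = i + y * i'"
    using ic(2) unfolding c(2) by (simp add: right_diff_distrib distrib_left mult.left_commute)
  also have "\<dots> \<in> I" by (intro R.subspace_add[OF I] is_ideal_mult_left[OF I] ic(1) c(1))
  finally have "z - y * c' \<in> I" by (rule x)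
  moreover have "z = (z - y * c') + y * c'" by simp
  ultimately show ?thesis unfolding add_mult_def by blast
qed

text \<open>\<open>regular_swap\<close> carries \<open>x\<close> past the entries of
  \<open>ys\<close> one by one.\<close>

lemma regular_seq_head_regular:
  assumes "is_ideal (I::'a::comm_ring_1 set)" "regular_seq (*) I (x # ys)" "x * z \<in> add_mults (*) I ys"
  shows "z \<in> add_mults (*) I ys"
  using assms
proof (induction ys arbitrary: I)
  case (Cons y ys)
  have I': "is_ideal (add_mult (*) I y)" using Cons.prems(1) by (rule R.subspace_add_mult)
  have "regular_seq (*) (add_mult (*) I y) (x # ys)"
    using Cons.prems(2) regular_swap[OF Cons.prems(1), of x y]
    by (auto simp: add_mult_commute[of "(*)" I])
  from Cons.IH[OF I' this] show ?case using Cons.prems(3) by simp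
qed auto

lemma add_mults_memE:
  assumes "is_ideal (I::'a::comm_ring_1 set)" "z \<in> add_mults (*) (add_mult (*) I x) ys"
  obtains w c where "w \<in> add_mults (*) I ys" "z = w + x * c"
  using assms
proof (induction ys arbitrary: I thesis)
  case Nil then show ?case by (auto simp: add_mult_def)
next
  case (Cons y ys)
  show ?case
    by (rule Cons.IH[of "add_mult (*) I y"])
      (use Cons.prems R.subspace_add_mult in \<open>auto simp: add_mult_commute[of "(*)" I]\<close>)
qed

lemma add_mults_mono: "L \<subseteq> L' \<Longrightarrow> add_mults s L ys \<subseteq> add_mults s L' ys"
proof (induction ys arbitrary: L L')
  case (Cons y ys)
  have "add_mult s L y \<subseteq> add_mult s L' y" using Cons.prems by (auto simp: add_mult_def)
  then show ?case using Cons.IH by simp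
qed simp

lemma add_mults_mult:
  assumes "z \<in> add_mults (*) (add_mult (*) I (x^a)) ys" "is_ideal (I::'a::comm_ring_1 set)"
  shows "x * z \<in> add_mults (*) (add_mult (*) I (x^(Suc a))) ys"
proof -
  obtain w c where wc: "w \<in> add_mults (*) I ys" "z = w + x^a * c" using add_mults_memE[OF assms(2,1)] .
  let ?K = "add_mults (*) (add_mult (*) I (x^Suc a)) ys"
  have I': "is_ideal (add_mult (*) I (x^Suc a))" using assms(2) by (rule R.subspace_add_mult)
  have K: "is_ideal ?K" using I' by (rule R.subspace_add_mults)
  have "w \<in> ?K" using wc(1) add_mults_mono[OF R.add_mult_superset] by blast
  moreover have "x^Suc a * c \<in> ?K"
    using R.add_mult_memI[OF assms(2)] R.add_mults_superset by blast
  ultimately have "x * w + x^Suc a * c \<in> ?K"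
    using R.subspace_add[OF K] is_ideal_mult_left[OF K] by blast
  moreover have "x * z = x * w + x^Suc a * c"
    unfolding wc(2) by (simp only: distrib_left power_Suc mult.assoc)
  ultimately show ?thesis by (simp only:)
qed

text \<open>
  The inductive step uses \<open>0 \<rightarrow> R/(I + x\<^sup>a) \<rightarrow> R/(I + x\<^sup>a\<^sup>+\<^sup>1) \<rightarrow> R/(I + x) \<rightarrow> 0\<close>, the first map being
  multiplication by \<open>x\<close>.
\<close>

lemma regular_seq_power_step:
  assumes I: "is_ideal (I::'a::comm_ring_1 set)"
    and x: "regular_seq (*) I (x # ys)" and xa: "regular_seq (*) (add_mult (*) I (x^a)) ys"
  shows "regular_seq (*) (add_mult (*) I (x^Suc a)) ys"
  using x xa
proof (induction ys rule: rev_induct)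
  case (snoc y ys)
  have ys: "regular_seq (*) I (x # ys)" using snoc.prems by (auto simp: regular_seq_snoc)
  let ?J = "\<lambda>a. add_mults (*) (add_mult (*) I (x^a)) ys"
  have K: "is_ideal (add_mults (*) I ys)" using I by (rule R.subspace_add_mults)
  have "z \<in> ?J (Suc a)" if z: "y * z \<in> ?J (Suc a)" for z
  proof -
    have "add_mult (*) I (x ^ Suc a) \<subseteq> add_mult (*) I (x ^ 1)"
      by (force simp: add_mult_def mult.assoc)
    then have "?J (Suc a) \<subseteq> ?J 1" by (rule add_mults_mono)
    then have "z \<in> ?J 1" using z snoc.prems(1) by (auto simp: regular_seq_snoc)
    then obtain w c where wc: "w \<in> add_mults (*) I ys" "z = w + x * c" using add_mults_memE[OF I, of z x] by auto
    obtain w' c' where wc': "w' \<in> add_mults (*) I ys" "y * z = w' + x^Suc a * c'"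
      using add_mults_memE[OF I z] .
    \<comment> \<open>Comparing the two expressions for \<open>y * z\<close> leaves a multiple of
      \<open>x\<close>. As \<open>x\<close> is regular modulo \<open>I\<close> and
      \<open>ys\<close>, it cancels, and \<open>y * c\<close> lies in the ideal for exponent
      \<open>a\<close>, where \<open>y\<close> is regular by assumption.\<close>
    have "x * (y * c - x^a * c') = w' - y * w" using wc(2) wc'(2) by (simp add: algebra_simps)
    moreover have "w' - y * w \<in> add_mults (*) I ys"
      using wc(1) wc'(1) R.subspace_diff[OF K] is_ideal_mult_left[OF K] by auto
    ultimately have "y * c - x^a * c' \<in> add_mults (*) I ys"
      using regular_seq_head_regular[OF I ys] by auto
    moreover have "y * c = (y * c - x^a * c') + x^a * c'" by simp
    moreover have J: "is_ideal (?J a)" "is_ideal (?J (Suc a))"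
      using I by (auto intro: R.subspace_add_mults R.subspace_add_mult)
    moreover have sub: "add_mults (*) I ys \<subseteq> ?J a" "add_mults (*) I ys \<subseteq> ?J (Suc a)"
      by (rule add_mults_mono[OF R.add_mult_superset])+
    moreover have "x^a * c' \<in> ?J a" using R.add_mult_memI[OF I] R.add_mults_superset by blast
    ultimately have "y * c \<in> ?J a" by (metis R.subspace_add subsetD)
    then have "c \<in> ?J a" using snoc.prems(2) by (auto simp: regular_seq_snoc)
    then have "x * c \<in> ?J (Suc a)" using add_mults_mult[OF _ I] by blast
    then show ?thesis using wc J(2) sub(2) R.subspace_add by blast
  qed
  moreover have "regular_seq (*) (add_mult (*) I (x ^ Suc a)) ys"
    by (rule snoc.IH[OF ys]) (use snoc.prems in \<open>simp add: regular_seq_snoc\<close>)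
  ultimately show ?case unfolding regular_seq_snoc by blast
next
  case Nil
  show ?case by (rule regular_seq.simps(1)[THEN iffD2, OF TrueI])
qed

lemma regular_power:
  assumes "\<And>z. (x::'a::comm_ring_1) * z \<in> I \<Longrightarrow> z \<in> I" and "x^a * z \<in> I"
  shows "z \<in> I"
  using assms(2)
proof (induction a)
  case (Suc a)
  then have "x * (x^a * z) \<in> I" by (simp add: mult.assoc)
  then have "x^a * z \<in> I" by (rule assms(1))
  then show ?case by (rule Suc.IH)
next
  case 0
  then show ?case by simp
qed

lemma regular_seq_powers:
  assumes "is_ideal (I::'a::comm_ring_1 set)" "regular_seq (*) I xs" "0 < n"
  shows "regular_seq (*) I (map (\<lambda>x. x^n) xs)"
  using assms(1,2)
proof (induction xs arbitrary: I)
  case (Cons x xs)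
  have "regular_seq (*) (add_mult (*) I (x^Suc a)) xs" for a
  proof (induction a)
    case 0 then show ?case using Cons.prems(2) by simp
  next
    case (Suc a) show ?case by (rule regular_seq_power_step[OF Cons.prems Suc.IH])
  qed
  then have "regular_seq (*) (add_mult (*) I (x^n)) xs" using assms(3) gr0_conv_Suc by auto
  then have "regular_seq (*) (add_mult (*) I (x^n)) (map (\<lambda>x. x^n) xs)"
    using Cons.IH R.subspace_add_mult[OF Cons.prems(1)] by blast
  moreover have "z \<in> I" if "x^n * z \<in> I" for z
  proof (rule regular_power[OF _ that])
    fix z assume "x * z \<in> I"
    then show "z \<in> I" using Cons.prems(2) by auto
  qed
  ultimately show ?case by simp
qed simp

section \<open>Tuples\<close>

text \<open>Finite support in one function type makes all the modules \<open>R^n\<close> submodules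
  of a single module, so the rank can vary in inductions.\<close>

definition tuples :: "nat \<Rightarrow> (nat \<Rightarrow> 'b::zero) set"
  where "tuples n = {f. \<forall>j\<ge>n. f j = 0}"

definition scale_fun :: "('a \<Rightarrow> 'b \<Rightarrow> 'b) \<Rightarrow> 'a \<Rightarrow> (nat \<Rightarrow> 'b) \<Rightarrow> nat \<Rightarrow> 'b"
  where "scale_fun t r f = (\<lambda>j. t r (f j))"

lemma scale_fun_apply [simp]: "scale_fun t r f j = t r (f j)"
  by (simp add: scale_fun_def)

definition unit_tuple :: "nat \<Rightarrow> nat \<Rightarrow> 'a::zero_neq_one"
  where "unit_tuple i = (\<lambda>j. if j = i then 1 else 0)"

text \<open>For fixed \<open>e\<close> this is the linear map from \<open>R^n\<close> sending the
  unit tuples to the entries of \<open>e\<close>; for fixed \<open>r\<close> it applies one relation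
  to a tuple of module elements.\<close>

definition dot :: "('a \<Rightarrow> 'b \<Rightarrow> 'b::comm_monoid_add) \<Rightarrow> nat \<Rightarrow> (nat \<Rightarrow> 'a) \<Rightarrow> (nat \<Rightarrow> 'b) \<Rightarrow> 'b"
  where "dot t n r e = (\<Sum>j<n. t (r j) (e j))"

lemma module_scale_fun: "Modules.module t \<Longrightarrow> Modules.module (scale_fun t)"
  for t :: "'a::comm_ring_1 \<Rightarrow> 'b::ab_group_add \<Rightarrow> 'b"
  by (simp add: Modules.module_def fun_eq_iff)

interpretation F: Modules.module "scale_fun ((*) :: 'a::comm_ring_1 \<Rightarrow> 'a \<Rightarrow> 'a)"
  by (rule module_scale_fun[OF R.module_axioms])

lemma sum_fun_apply: "(\<Sum>l\<in>A. f l) j = (\<Sum>l\<in>A. f l j)" for f :: "'l \<Rightarrow> nat \<Rightarrow> 'b::comm_monoid_add"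
  by (induction A rule: infinite_finite_induct) auto

lemma sum_scale_fun: "(\<lambda>j. \<Sum>l<k. a l * v l j) = (\<Sum>l<k. scale_fun (*) (a l) (v l))"
  for k :: nat and a :: "nat \<Rightarrow> 'a::comm_ring_1"
  by (simp add: fun_eq_iff sum_fun_apply)

lemma subspace_tuples: "F.subspace (tuples n)"
  by (simp add: F.subspace_def tuples_def)

lemmas tuples_0 = F.subspace_0[OF subspace_tuples] and tuples_add = F.subspace_add[OF subspace_tuples]
  and tuples_scale = F.subspace_scale[OF subspace_tuples] and tuples_diff = F.subspace_diff[OF subspace_tuples]

context Modules.module
begin

lemma dot_add_left: "dot scale n (r + r') e = dot scale n r e + dot scale n r' e"
  by (simp add: dot_def scale_left_distrib sum.distrib)

lemma dot_scale_left: "dot scale n (scale_fun (*) c r) e = scale c (dot scale n r e)"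
  by (simp add: dot_def scale_sum_right)

lemma dot_zero_left: "dot scale n 0 e = 0"
  by (simp add: dot_def)

lemma dot_diff_left: "dot scale n (r - r') e = dot scale n r e - dot scale n r' e"
  by (simp add: dot_def scale_left_diff_distrib sum_subtractf)

lemma dot_add_right: "dot scale n r (e + e') = dot scale n r e + dot scale n r e'"
  by (simp add: dot_def scale_right_distrib sum.distrib)

lemma dot_diff_right: "dot scale n r (e - e') = dot scale n r e - dot scale n r e'"
  by (simp add: dot_def scale_right_diff_distrib sum_subtractf)

lemma dot_scale_right: "dot scale n r (scale_fun scale c e) = scale c (dot scale n r e)"
  by (simp add: dot_def scale_sum_right scale_left_commute[of _ c] mult.commute)

lemma dot_in_subspace: "subspace A \<Longrightarrow> (\<And>j. j < n \<Longrightarrow> e j \<in> A) \<Longrightarrow> dot scale n r e \<in> A"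
  unfolding dot_def by (rule subspace_sum) (auto intro: subspace_scale)

lemma dot_sum_left: "dot scale n (\<lambda>j. \<Sum>l<k. a l * v l j) e = (\<Sum>l<k. scale (a l) (dot scale n (v l) e))"
proof -
  have "dot scale n (\<lambda>j. \<Sum>l<k. a l * v l j) e = (\<Sum>j<n. \<Sum>l<k. scale (a l) (scale (v l j) (e j)))"
    by (simp add: dot_def scale_sum_left)
  also have "\<dots> = (\<Sum>l<k. \<Sum>j<n. scale (a l) (scale (v l j) (e j)))" by (rule sum.swap)
  finally show ?thesis by (simp add: dot_def scale_sum_right)
qed

lemma dot_unit_tuple: "i < n \<Longrightarrow> dot scale n (unit_tuple i) e = e i"
  unfolding dot_def unit_tuple_def
  by (subst sum.mono_neutral_right[where S = "{i}"]) auto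

lemma finite_span_tuple:
  assumes "finite W"
  shows "\<exists>(k::nat) w. (\<forall>l<k. w l \<in> W) \<and> (\<forall>x\<in>span W. \<exists>a. x = (\<Sum>l<k. scale (a l) (w l)))"
proof -
  obtain h where h: "bij_betw h {0..<card W} W" using ex_bij_betw_nat_finite[OF assms] by blast
  show ?thesis
  proof (intro exI[of _ "card W"] exI[of _ h] conjI ballI allI impI)
    show "h l \<in> W" if "l < card W" for l using h that by (auto simp: bij_betw_def)
    fix x assume "x \<in> span W"
    then obtain u where u: "x = (\<Sum>v\<in>W. scale (u v) v)" using span_finite[OF assms] by auto
    also have "\<dots> = (\<Sum>l\<in>{0..<card W}. scale (u (h l)) (h l))"
      by (rule sum.reindex_bij_betw[OF h, symmetric])
    finally show "\<exists>a. x = (\<Sum>l<card W. scale (a l) (h l))"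
      by (intro exI[of _ "\<lambda>l. u (h l)"]) (simp add: lessThan_atLeast0)
  qed
qed

end

section \<open>Linear maps and Baer's criterion\<close>

lemma linear_map_onD:
  assumes "linear_map_on s t A B f"
  shows "x \<in> A \<Longrightarrow> f x \<in> B" "x \<in> A \<Longrightarrow> y \<in> A \<Longrightarrow> f (x + y) = f x + f y"
    "x \<in> A \<Longrightarrow> f (s r x) = t r (f x)"
  using assms by (auto simp: linear_map_on_def)

lemma linear_map_on_subset:
  "linear_map_on s t A B f \<Longrightarrow> A' \<subseteq> A \<Longrightarrow> B \<subseteq> B' \<Longrightarrow> linear_map_on s t A' B' f"
  unfolding linear_map_on_def by blast

lemma linear_map_on_0:
  fixes s :: "'a::comm_ring_1 \<Rightarrow> 'c::ab_group_add \<Rightarrow> 'c" and t :: "'a \<Rightarrow> 'b::ab_group_add \<Rightarrow> 'b"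
  assumes "Modules.module s" "Modules.module t" "module.subspace s A" "linear_map_on s t A B f"
  shows "f 0 = 0"
proof -
  interpret s: Modules.module s by fact
  interpret t: Modules.module t by fact
  show ?thesis
    using linear_map_onD(3)[OF assms(4) s.subspace_0[OF assms(3)], of 0] by simp
qed

lemma linear_map_on_diff:
  fixes s :: "'a::comm_ring_1 \<Rightarrow> 'c::ab_group_add \<Rightarrow> 'c" and t :: "'a \<Rightarrow> 'b::ab_group_add \<Rightarrow> 'b"
  assumes "Modules.module s" "Modules.module t" "module.subspace s A" "linear_map_on s t A B f"
    and "x \<in> A" "y \<in> A"
  shows "f (x - y) = f x - f y"
proof -
  interpret s: Modules.module s by fact
  interpret t: Modules.module t by fact
  have "f (x - y) = f (x + s (-1) y)" by simp
  also have "\<dots> = f x + f (s (-1) y)"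
    using assms(5,6) s.subspace_scale[OF assms(3)] by (intro linear_map_onD(2)[OF assms(4)])
  also have "f (s (-1) y) = t (-1) (f y)" using assms(6) by (rule linear_map_onD(3)[OF assms(4)])
  finally show ?thesis by simp
qed

lemma linear_map_on_dot:
  fixes s :: "'a::comm_ring_1 \<Rightarrow> 'c::ab_group_add \<Rightarrow> 'c" and t :: "'a \<Rightarrow> 'b::ab_group_add \<Rightarrow> 'b"
  assumes ms: "Modules.module s" and mt: "Modules.module t" and A: "module.subspace s A"
    and f: "linear_map_on s t A B f" and "\<And>l. l < k \<Longrightarrow> v l \<in> A"
  shows "f (dot s k a v) = dot t k a (\<lambda>l. f (v l))"
  using assms(5)
proof (induction k)
  case 0
  show ?case using linear_map_on_0[OF ms mt A f] by (simp add: dot_def)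
next
  case (Suc k)
  interpret s: Modules.module s by fact
  have "dot s k a v \<in> A" by (rule s.dot_in_subspace[OF A]) (use Suc.prems in simp)
  then show ?case
    using Suc s.subspace_scale[OF A] linear_map_onD(2,3)[OF f] by (simp add: dot_def)
qed

lemma linear_map_on_tuples:
  fixes t :: "'a::comm_ring_1 \<Rightarrow> 'b::ab_group_add \<Rightarrow> 'b"
  assumes mt: "Modules.module t" and H: "linear_map_on (scale_fun (*)) t (tuples n) B H"
    and v: "v \<in> tuples n"
  shows "H v = dot t n v (\<lambda>j. H (unit_tuple j))"
proof -
  have "v = dot (scale_fun (*)) n v unit_tuple"
    using v by (auto simp: fun_eq_iff dot_def sum_fun_apply unit_tuple_def tuples_def if_distrib cong: if_cong)
  then show ?thesis
    using linear_map_on_dot[OF F.module_axioms mt subspace_tuples H, of n unit_tuple v]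
    by (simp add: tuples_def unit_tuple_def)
qed

lemma subspace_linear_image:
  fixes s :: "'a::comm_ring_1 \<Rightarrow> 'c::ab_group_add \<Rightarrow> 'c" and t :: "'a \<Rightarrow> 'b::ab_group_add \<Rightarrow> 'b"
  assumes ms: "Modules.module s" and mt: "Modules.module t" and A: "module.subspace s A"
    and f: "linear_map_on s t A B f"
  shows "module.subspace t (f ` A)"
proof -
  interpret s: Modules.module s by fact
  interpret t: Modules.module t by fact
  show ?thesis
  proof (rule t.subspaceI)
    show "0 \<in> f ` A"
      using linear_map_on_0[OF ms mt A f] s.subspace_0[OF A] by (intro image_eqI[of _ _ 0]) simp_all
    fix x assume "x \<in> f ` A"
    then obtain a where a: "x = f a" "a \<in> A" by blast
    then have "t c x = f (s c a)" for c by (simp add: linear_map_onD(3)[OF f])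
    then show "t c x \<in> f ` A" for c using a(2) s.subspace_scale[OF A] by simp
    fix y assume "y \<in> f ` A"
    then obtain b where b: "y = f b" "b \<in> A" by blast
    then have "x + y = f (a + b)" using a by (simp add: linear_map_onD(2)[OF f])
    then show "x + y \<in> f ` A" using a(2) b(2) s.subspace_add[OF A] by simp
  qed
qed

text \<open>
  \<open>baer t I E\<close> is Baer's criterion for the injectivity of \<open>E\<close> as a module over \<open>R / I\<close>, expressed by
  linear maps on ideals of \<open>R\<close> that contain \<open>I\<close> and on which the map vanishes.
\<close>

definition baer :: "('a::comm_ring_1 \<Rightarrow> 'b::ab_group_add \<Rightarrow> 'b) \<Rightarrow> 'a set \<Rightarrow> 'b set \<Rightarrow> bool"
  where "baer t I E \<longleftrightarrow>
    (\<forall>A h. is_ideal A \<and> I \<subseteq> A \<and> linear_map_on (*) t A E h \<and> (\<forall>x\<in>I. h x = 0) \<longrightarrow>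
       (\<exists>e\<in>E. \<forall>a\<in>A. h a = t a e))"

text \<open>Baer's argument relative to \<open>I\<close>: by \<open>kill\<close>, the ideal of all
  multipliers taking a vector into the domain contains \<open>I\<close>, and the map on it vanishes
  on \<open>I\<close>, as \<open>baer t I E\<close> demands.\<close>

lemma baer_extend:
  fixes s :: "'a::comm_ring_1 \<Rightarrow> 'c::ab_group_add \<Rightarrow> 'c" and t :: "'a \<Rightarrow> 'b::ab_group_add \<Rightarrow> 'b"
  assumes ms: "Modules.module s" and mt: "Modules.module t"
    and N: "module.subspace s N" and S: "module.subspace s S" and "N \<subseteq> S"
    and E: "module.subspace t E" and baer: "baer t I E"
    and kill: "\<And>a v. a \<in> I \<Longrightarrow> v \<in> S \<Longrightarrow> s a v \<in> N \<and> f (s a v) = 0"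
    and f: "linear_map_on s t N E f"
  obtains g where "linear_map_on s t S E g" "\<And>x. x \<in> N \<Longrightarrow> g x = f x"
proof -
  interpret s: Modules.module s by fact
  interpret t: Modules.module t by fact
  \<comment> \<open>Partial linear maps are represented by their graphs, so that Zorn's lemma can
    use unions; the last clause says that the graph is single-valued.\<close>
  define Ok where "Ok G \<longleftrightarrow> (\<forall>x\<in>N. (x, f x) \<in> G) \<and> G \<subseteq> S \<times> E \<and>
    (\<forall>x y x' y'. (x, y) \<in> G \<longrightarrow> (x', y') \<in> G \<longrightarrow> (x + x', y + y') \<in> G) \<and>
    (\<forall>r x y. (x, y) \<in> G \<longrightarrow> (s r x, t r y) \<in> G) \<and> (\<forall>y. (0, y) \<in> G \<longrightarrow> y = 0)" for G
  have f0: "f 0 = 0" by (rule linear_map_on_0[OF ms mt N f])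
  have "Ok {(x, f x) | x. x \<in> N}"
    unfolding Ok_def using f0 linear_map_onD[OF f] s.subspace_add[OF N] s.subspace_scale[OF N] \<open>N \<subseteq> S\<close>
    by auto
  then have ne: "Collect Ok \<noteq> {}" by blast
  have union: "\<Union>C \<in> Collect Ok" if C: "C \<noteq> {}" "subset.chain (Collect Ok) C" for C
  proof -
    have OkC: "\<And>G. G \<in> C \<Longrightarrow> Ok G" and chain: "\<And>A B. A \<in> C \<Longrightarrow> B \<in> C \<Longrightarrow> A \<subseteq> B \<or> B \<subseteq> A"
      using C(2) by (auto simp: subset.chain_def)
    have "Ok (\<Union>C)"
      unfolding Ok_def
    proof (intro conjI allI impI ballI)
      fix x assume "x \<in> N"
      then show "(x, f x) \<in> \<Union>C" using C(1) OkC by (auto simp: Ok_def)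
    next
      show "\<Union>C \<subseteq> S \<times> E" using OkC unfolding Ok_def by blast
    next
      fix x y x' y' assume "(x, y) \<in> \<Union>C" "(x', y') \<in> \<Union>C"
      then obtain A B where "A \<in> C" "(x, y) \<in> A" "B \<in> C" "(x', y') \<in> B" by auto
      then obtain D where D: "D \<in> C" "(x, y) \<in> D" "(x', y') \<in> D" using chain by blast
      then have "(x + x', y + y') \<in> D" using OkC[of D] unfolding Ok_def by blast
      then show "(x + x', y + y') \<in> \<Union>C" using D by blast
    next
      fix r x y assume "(x, y) \<in> \<Union>C"
      then show "(s r x, t r y) \<in> \<Union>C" using OkC unfolding Ok_def by blast
    next
      fix y assume "(0, y) \<in> \<Union>C"
      then show "y = 0" using OkC unfolding Ok_def by blast
    qed
    then show ?thesis by simp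
  qed
  obtain M where OkM: "Ok M" and max: "\<And>G. Ok G \<Longrightarrow> M \<subseteq> G \<Longrightarrow> G = M"
    using subset_Zorn_nonempty[OF ne union] by (metis mem_Collect_eq)
  have MN: "\<And>x. x \<in> N \<Longrightarrow> (x, f x) \<in> M" and MSE: "\<And>x y. (x, y) \<in> M \<Longrightarrow> x \<in> S \<and> y \<in> E"
    and Madd: "\<And>x y x' y'. (x, y) \<in> M \<Longrightarrow> (x', y') \<in> M \<Longrightarrow> (x + x', y + y') \<in> M"
    and Mscale: "\<And>r x y. (x, y) \<in> M \<Longrightarrow> (s r x, t r y) \<in> M" and M0: "\<And>y. (0, y) \<in> M \<Longrightarrow> y = 0"
    using OkM unfolding Ok_def by blast+
  have Mdiff: "(x - x', y - y') \<in> M" if "(x, y) \<in> M" "(x', y') \<in> M" for x y x' y'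
    using Madd[OF that(1) Mscale[OF that(2), of "-1"]] by simp
  have Muniq: "y = y'" if "(x, y) \<in> M" "(x, y') \<in> M" for x y y'
    using M0[of "y - y'"] Mdiff[OF that] by simp
  have total: "\<exists>y. (v, y) \<in> M" if v: "v \<in> S" for v
  proof -
    \<comment> \<open>\<open>M\<close> already prescribes \<open>h\<close> on the multiples of
      \<open>v\<close> by elements of \<open>A\<close>. The element \<open>e\<close> that Baer's
      criterion gives for \<open>h\<close> is a consistent value at \<open>v\<close>.\<close>
    define A where "A = {r. \<exists>y. (s r v, y) \<in> M}"
    define h where "h r = (THE y. (s r v, y) \<in> M)" for r
    have h: "h r = y" if "(s r v, y) \<in> M" for r y
      unfolding h_def using that Muniq by blast
    have hM: "(s r v, h r) \<in> M" if "r \<in> A" for r using that h by (auto simp: A_def)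
    have idA: "is_ideal A"
    proof (rule is_idealI)
      have "(s 0 v, 0) \<in> M" using MN[OF s.subspace_0[OF N]] f0 by simp
      then show "0 \<in> A" unfolding A_def by blast
    next
      fix r r' assume "r \<in> A" "r' \<in> A"
      then have "(s (r + r') v, h r + h r') \<in> M" using Madd[OF hM hM] by (simp add: s.scale_left_distrib)
      then show "r + r' \<in> A" unfolding A_def by blast
    next
      fix c r assume "r \<in> A"
      then have "(s (c * r) v, t c (h r)) \<in> M" using Mscale[OF hM, of r c] by simp
      then show "c * r \<in> A" unfolding A_def by blast
    qed
    have Ih: "a \<in> A \<and> h a = 0" if "a \<in> I" for a
    proof -
      have "(s a v, 0) \<in> M" using MN[of "s a v"] kill[OF that v] by auto
      then show ?thesis using h unfolding A_def by blast
    qed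
    have "linear_map_on (*) t A E h"
      unfolding linear_map_on_def
    proof (intro conjI ballI allI)
      fix r assume "r \<in> A" then show "h r \<in> E" using hM MSE by blast
    next
      fix r r' assume "r \<in> A" "r' \<in> A"
      then show "h (r + r') = h r + h r'"
        using Madd[OF hM hM] by (intro h) (simp add: s.scale_left_distrib)
    next
      fix c r assume "r \<in> A"
      then show "h (c * r) = t c (h r)" using Mscale[OF hM, of r c] by (intro h) simp
    qed
    then obtain e where e: "e \<in> E" "\<And>a. a \<in> A \<Longrightarrow> h a = t a e"
      using baer[unfolded baer_def, rule_format, of A h] idA Ih by blast
    define M' where "M' = {(x + s r v, y + t r e) | x y r. (x, y) \<in> M}"
    have M'I: "(x + s r v, y + t r e) \<in> M'" if "(x, y) \<in> M" for x y r
      using that unfolding M'_def by blast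
    have sub: "M \<subseteq> M'"
    proof (rule subrelI)
      fix x y assume "(x, y) \<in> M"
      then show "(x, y) \<in> M'" using M'I[of x y 0] by simp
    qed
    have "Ok M'"
      unfolding Ok_def
    proof (intro conjI allI impI ballI)
      fix x assume "x \<in> N" then show "(x, f x) \<in> M'" using MN sub by blast
    next
      show "M' \<subseteq> S \<times> E"
        unfolding M'_def using MSE s.subspace_add[OF S] s.subspace_scale[OF S] v
          t.subspace_add[OF E] t.subspace_scale[OF E] e(1) by blast
    next
      fix x y x' y' assume "(x, y) \<in> M'" "(x', y') \<in> M'"
      then obtain a b r a' b' r' where *: "(a, b) \<in> M" "x = a + s r v" "y = b + t r e"
        "(a', b') \<in> M" "x' = a' + s r' v" "y' = b' + t r' e" unfolding M'_def by blast
      then show "(x + x', y + y') \<in> M'"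
        using M'I[OF Madd[OF *(1,4)], of "r + r'"]
        by (simp add: s.scale_left_distrib t.scale_left_distrib algebra_simps)
    next
      fix r x y assume "(x, y) \<in> M'"
      then obtain a b c where *: "(a, b) \<in> M" "x = a + s c v" "y = b + t c e" unfolding M'_def by blast
      then show "(s r x, t r y) \<in> M'"
        using M'I[OF Mscale[OF *(1), of r], of "r * c"]
        by (simp add: s.scale_right_distrib t.scale_right_distrib)
    next
      fix y assume "(0, y) \<in> M'"
      then obtain a b r where *: "(a, b) \<in> M" "0 = a + s r v" "y = b + t r e" unfolding M'_def by blast
      then have "a = s (-r) v" by (simp add: eq_neg_iff_add_eq_0)
      then have "(s (-r) v, b) \<in> M" using *(1) by simp
      then have "h (-r) = b" "-r \<in> A" using h unfolding A_def by blast+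
      then have "b = - t r e" using e(2)[of "-r"] by simp
      then show "y = 0" using *(3) by simp
    qed
    then have "M' = M" using max sub by blast
    moreover have "(v, e) \<in> M'" using M'I[of 0 0 1] MN[OF s.subspace_0[OF N]] f0 by simp
    ultimately show ?thesis by blast
  qed
  define g where "g x = (THE y. (x, y) \<in> M)" for x
  have g: "g x = y" if "(x, y) \<in> M" for x y unfolding g_def using that Muniq by blast
  have gM: "(x, g x) \<in> M" if "x \<in> S" for x using total[OF that] g by blast
  show ?thesis
  proof (rule that)
    show "linear_map_on s t S E g"
      unfolding linear_map_on_def
    proof (intro conjI ballI allI)
      fix x assume x: "x \<in> S"
      show "g x \<in> E" using MSE[OF gM[OF x]] by simp
      show "g (s r x) = t r (g x)" for r by (rule g[OF Mscale[OF gM[OF x]]])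
      fix y assume y: "y \<in> S"
      show "g (x + y) = g x + g y" by (rule g[OF Madd[OF gM[OF x] gM[OF y]]])
    qed
    show "g x = f x" if "x \<in> N" for x using g MN[OF that] by blast
  qed
qed

text \<open>By \<open>rel\<close> the prescribed values are consistent on the submodule generated by
  \<open>L\<close> and the \<open>v l\<close>, so \<open>baer_extend\<close> takes over from
  there.\<close>

lemma baer_extend_family:
  fixes s :: "'a::comm_ring_1 \<Rightarrow> 'c::ab_group_add \<Rightarrow> 'c" and t :: "'a \<Rightarrow> 'b::ab_group_add \<Rightarrow> 'b"
  assumes ms: "Modules.module s" and mt: "Modules.module t" and S: "module.subspace s S"
    and L: "module.subspace s L" "L \<subseteq> S" and E: "module.subspace t E" and baer: "baer t I E"
    and IL: "\<And>a v. a \<in> I \<Longrightarrow> v \<in> S \<Longrightarrow> s a v \<in> L"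
    and v: "\<And>l. l < k \<Longrightarrow> v l \<in> S" and h: "\<And>l. l < k \<Longrightarrow> h l \<in> E"
    and rel: "\<And>a. dot s k a v \<in> L \<Longrightarrow> dot t k a h = 0"
  obtains g where "linear_map_on s t S E g" "\<And>l. l < k \<Longrightarrow> g (v l) = h l" "\<And>z. z \<in> L \<Longrightarrow> g z = 0"
proof -
  interpret s: Modules.module s by fact
  interpret t: Modules.module t by fact
  have well: "dot t k a h = dot t k a' h" if "z - dot s k a v \<in> L" "z - dot s k a' v \<in> L" for z a a'
    using s.subspace_diff[OF L(1) that(2,1)] rel[of "a - a'"] by (simp add: s.dot_diff_left t.dot_diff_left)
  define N where "N = {z \<in> S. \<exists>a. z - dot s k a v \<in> L}"
  define f where "f z = dot t k (SOME a. z - dot s k a v \<in> L) h" for z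
  have f: "f z = dot t k a h" if "z - dot s k a v \<in> L" for z a
    unfolding f_def by (rule well[OF _ that]) (rule someI[where x = a], rule that)
  have add: "(z + z') - dot s k (a + a') v \<in> L" if "z - dot s k a v \<in> L" "z' - dot s k a' v \<in> L" for z z' a a'
    using s.subspace_add[OF L(1) that] by (simp add: s.dot_add_left algebra_simps)
  have mult: "s c z - dot s k (scale_fun (*) c a) v \<in> L" if "z - dot s k a v \<in> L" for c z a
    using s.subspace_scale[OF L(1) that, of c] by (simp add: s.dot_scale_left s.scale_right_diff_distrib)
  have f_L: "z \<in> N \<and> f z = 0" if "z \<in> L" for z
  proof -
    have z: "z - dot s k 0 v \<in> L" using that by (simp add: s.dot_zero_left)
    show ?thesis using f[OF z] z that L(2) unfolding N_def by (auto simp: t.dot_zero_left)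
  qed
  have N: "s.subspace N"
  proof (rule s.subspaceI)
    show "0 \<in> N" using f_L s.subspace_0[OF L(1)] by blast
    show "z + z' \<in> N" if "z \<in> N" "z' \<in> N" for z z'
      using that add s.subspace_add[OF S] unfolding N_def by blast
    show "s c z \<in> N" if "z \<in> N" for c z using that mult s.subspace_scale[OF S] unfolding N_def by blast
  qed
  have lin: "linear_map_on s t N E f"
    unfolding linear_map_on_def
  proof (intro conjI ballI allI)
    fix z assume "z \<in> N"
    then obtain a where a: "z - dot s k a v \<in> L" unfolding N_def by blast
    show "f z \<in> E" using f[OF a] h by (simp add: t.dot_in_subspace[OF E])
    show "f (s c z) = t c (f z)" for c using f[OF mult[OF a, of c]] f[OF a] by (simp add: t.dot_scale_left)
    fix z' assume "z' \<in> N"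
    then obtain a' where a': "z' - dot s k a' v \<in> L" unfolding N_def by blast
    show "f (z + z') = f z + f z'" using f[OF add[OF a a']] f[OF a] f[OF a'] by (simp add: t.dot_add_left)
  qed
  have "N \<subseteq> S" by (auto simp: N_def)
  then obtain g where g: "linear_map_on s t S E g" "\<And>z. z \<in> N \<Longrightarrow> g z = f z"
    using baer_extend[OF ms mt N S _ E baer _ lin] f_L IL by blast
  have "g (v l) = h l" if l: "l < k" for l
  proof -
    have z: "v l - dot s k (unit_tuple l) v \<in> L" using s.subspace_0[OF L(1)] by (simp add: s.dot_unit_tuple[OF l])
    then have "v l \<in> N" using v[OF l] unfolding N_def by blast
    then show ?thesis using g(2) f[OF z] by (simp add: t.dot_unit_tuple[OF l])
  qed
  then show ?thesis using that g f_L by simp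
qed

corollary baer_extend_cyclic:
  fixes s :: "'a::comm_ring_1 \<Rightarrow> 'c::ab_group_add \<Rightarrow> 'c" and t :: "'a \<Rightarrow> 'b::ab_group_add \<Rightarrow> 'b"
  assumes ms: "Modules.module s" and mt: "Modules.module t" and L: "module.subspace s L"
    and E: "module.subspace t E" and baer: "baer t I E"
    and IL: "\<And>a v. a \<in> I \<Longrightarrow> s a v \<in> L" and e: "e \<in> E" and kill: "\<And>r. s r y \<in> L \<Longrightarrow> t r e = 0"
  obtains g where "linear_map_on s t UNIV E g" "g y = e" "\<And>l. l \<in> L \<Longrightarrow> g l = 0"
proof -
  have S: "module.subspace s UNIV" using ms by (rule module.subspace_UNIV)
  have rel: "dot t 1 a (\<lambda>_. e) = 0" if "dot s 1 a (\<lambda>_. y) \<in> L" for a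
    using that kill[of "a 0"] by (simp add: dot_def)
  obtain g where "linear_map_on s t UNIV E g" "\<And>l::nat. l < 1 \<Longrightarrow> g y = e" "\<And>l. l \<in> L \<Longrightarrow> g l = 0"
    using baer_extend_family[OF ms mt S L subset_UNIV E baer IL UNIV_I e rel] by blast
  then show ?thesis using that[of g] by blast
qed

section \<open>Finite injective resolutions of \<open>R / I\<close>\<close>

text \<open>An injective resolution of \<open>R / I\<close> over the ring \<open>R / I\<close>: the
  terms are killed by \<open>I\<close>, and their injectivity is Baer's criterion for that ring. The
  maps \<open>\<delta> i\<close> matter only on \<open>E i\<close>.\<close>

locale resolution = Modules.module t
  for t :: "'a::comm_ring_1 \<Rightarrow> 'b::ab_group_add \<Rightarrow> 'b" +
  fixes I :: "'a set" and E :: "nat \<Rightarrow> 'b set" and \<epsilon> :: "'a \<Rightarrow> 'b" and \<delta> :: "nat \<Rightarrow> 'b \<Rightarrow> 'b" and n :: nat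
  assumes ideal: "is_ideal I"
    and E: "subspace (E i)"
    and kill: "a \<in> I \<Longrightarrow> e \<in> E i \<Longrightarrow> t a e = 0"
    and baer: "baer t I (E i)"
    and eps: "linear_map_on (*) t UNIV (E 0) \<epsilon>"
    and delta: "linear_map_on t t (E i) (E (Suc i)) (\<delta> i)"
    and ker_eps: "\<epsilon> r = 0 \<longleftrightarrow> r \<in> I"
    and range_eps: "range \<epsilon> = {x \<in> E 0. \<delta> 0 x = 0}"
    and image_delta: "\<delta> i ` E i = {x \<in> E (Suc i). \<delta> (Suc i) x = 0}"
    and E_trivial: "i > n \<Longrightarrow> E i = {0}"
begin

lemma module_t: "Modules.module t" by (rule module_axioms)

lemmas E_add = subspace_add[OF E] and E_scale = subspace_scale[OF E] and E_diff = subspace_diff[OF E]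
  and E_0 = subspace_0[OF E]

lemmas delta_in = linear_map_onD(1)[OF delta] and delta_add = linear_map_onD(2)[OF delta]
  and delta_scale = linear_map_onD(3)[OF delta]
  and delta_0 = linear_map_on_0[OF module_t module_t E delta]
  and delta_diff = linear_map_on_diff[OF module_t module_t E delta]

lemma eps_in: "\<epsilon> r \<in> E 0" and eps_add: "\<epsilon> (r + r') = \<epsilon> r + \<epsilon> r'" and eps_mult: "\<epsilon> (c * r) = t c (\<epsilon> r)"
  using linear_map_onD[OF eps] by auto

lemma eps_diff: "\<epsilon> (r - r') = \<epsilon> r - \<epsilon> r'"
  by (rule linear_map_on_diff[OF R.module_axioms module_t R.subspace_UNIV eps]) auto

lemma eps_0: "\<epsilon> 0 = 0"
  using eps_diff[of 0 0] by simp

lemma eps_eq_iff: "\<epsilon> r = \<epsilon> r' \<longleftrightarrow> r - r' \<in> I"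
  using ker_eps[of "r - r'"] by (simp add: eps_diff)

lemma delta_eps: "\<delta> 0 (\<epsilon> r) = 0"
  using range_eps by auto

lemma delta_delta: "e \<in> E i \<Longrightarrow> \<delta> (Suc i) (\<delta> i e) = 0"
  using image_delta[of i] by auto

lemma exact_0: "e \<in> E 0 \<Longrightarrow> \<delta> 0 e = 0 \<Longrightarrow> \<exists>r. e = \<epsilon> r"
  using range_eps by auto

lemma exact: "e \<in> E (Suc i) \<Longrightarrow> \<delta> (Suc i) e = 0 \<Longrightarrow> \<exists>g\<in>E i. \<delta> i g = e"
  using image_delta[of i] by (metis (mono_tags, lifting) imageE mem_Collect_eq)

text \<open>Multiplication by \<open>a\<close> embeds \<open>R / (B : a)\<close> into
  \<open>R / B\<close>. The map with \<open>1 -> e\<close> on the former extends to the latter by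
  injectivity, and \<open>e'\<close> is the image of 1.\<close>

lemma ex_division:
  assumes B: "is_ideal B" "I \<subseteq> B" and e: "e \<in> E i" and kill_e: "\<And>r. r * a \<in> B \<Longrightarrow> t r e = 0"
  obtains e' where "e' \<in> E i" "\<And>b. b \<in> B \<Longrightarrow> t b e' = 0" "t a e' = e"
proof -
  have "c * v \<in> B" if "c \<in> I" for c v using is_ideal_mult_right[OF B(1)] B(2) that by blast
  then obtain g where g: "linear_map_on (*) t UNIV (E i) g" "g a = e" "\<And>b. b \<in> B \<Longrightarrow> g b = 0"
    using baer_extend_cyclic[OF R.module_axioms module_t B(1) E baer _ e kill_e] by blast
  have "t b (g 1) = g b" for b using linear_map_onD(3)[OF g(1), of 1 b] by simp
  then show ?thesis using that[of "g 1"] linear_map_onD(1)[OF g(1), of 1] g(2,3) by simp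
qed

lemma range_eps_subspace: "subspace (range \<epsilon>)"
  by (rule subspace_linear_image[OF R.module_axioms module_t R.subspace_UNIV eps])

lemma subspace_annihilated: "subspace {e \<in> E i. \<forall>b\<in>P. t b e = 0}"
proof (rule subspaceI)
  fix c x assume "x \<in> {e \<in> E i. \<forall>b\<in>P. t b e = 0}"
  then show "t c x \<in> {e \<in> E i. \<forall>b\<in>P. t b e = 0}"
    using scale_left_commute[of _ c x] by (simp add: E_scale del: scale_scale)
qed (simp_all add: E_0 E_add scale_right_distrib)

end

lemma baer_image:
  fixes t :: "'a::comm_ring_1 \<Rightarrow> 'b::ab_group_add \<Rightarrow> 'b"
  assumes mt: "Modules.module t" and V: "module.subspace t V" and baer: "baer t I V"
    and d: "linear_map_on t t V Y d" and inj: "\<And>e. e \<in> V \<Longrightarrow> d e = 0 \<Longrightarrow> e = 0"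
  shows "baer t I (d ` V)"
  unfolding baer_def
proof (intro allI impI, elim conjE)
  interpret t: Modules.module t by fact
  fix A h assume A: "is_ideal A" "I \<subseteq> A" "linear_map_on (*) t A (d ` V) h" "\<forall>x\<in>I. h x = 0"
  have d_inj: "inj_on d V"
  proof (rule inj_onI)
    fix x y assume "x \<in> V" "y \<in> V" "d x = d y"
    then show "x = y" using inj[of "x - y"] t.subspace_diff[OF V] linear_map_on_diff[OF mt mt V d] by simp
  qed
  define k where "k a = inv_into V d (h a)" for a
  have k: "k a \<in> V" "d (k a) = h a" if "a \<in> A" for a
    unfolding k_def using linear_map_onD(1)[OF A(3) that] by (auto simp: inv_into_into f_inv_into_f)
  have kI: "k a = e" if "e \<in> V" "d e = h a" "a \<in> A" for a e
    using inj_onD[OF d_inj, of "k a" e] k[OF that(3)] that by simp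
  have "linear_map_on (*) t A V k"
    unfolding linear_map_on_def
  proof (intro conjI ballI allI)
    fix a assume a: "a \<in> A"
    show "k a \<in> V" using k a by simp
    show "k (c * a) = t c (k a)" for c
      using k[OF a] a A(1) linear_map_onD(3)[OF A(3) a] linear_map_onD(3)[OF d k(1)[OF a]]
      by (intro kI) (auto intro: t.subspace_scale[OF V] is_ideal_mult_left)
    fix b assume b: "b \<in> A"
    show "k (a + b) = k a + k b"
      using k[OF a] k[OF b] a b A(1) linear_map_onD(2)[OF A(3) a b] linear_map_onD(2)[OF d k(1)[OF a] k(1)[OF b]]
      by (intro kI) (auto intro: t.subspace_add[OF V] R.subspace_add)
  qed
  moreover have "k x = 0" if "x \<in> I" for x
    using that A(2,4) t.subspace_0[OF V] linear_map_on_0[OF mt mt V d] by (intro kI) auto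
  ultimately obtain e where e: "e \<in> V" "\<And>a. a \<in> A \<Longrightarrow> k a = t a e"
    using baer A(1,2) unfolding baer_def by blast
  have "h a = t a (d e)" if "a \<in> A" for a
    using k(2)[OF that] e linear_map_onD(3)[OF d e(1)] that by simp
  then show "\<exists>e\<in>d ` V. \<forall>a\<in>A. h a = t a e" using e(1) by blast
qed

text \<open>
  Change of rings: if \<open>x\<close> is regular on \<open>R / I\<close> then \<open>Hom(R / x, E)\<close> is, up to the split subcomplex
  \<open>\<delta>\<^sub>0 : E\<^sub>0[x] \<rightarrow> \<delta>\<^sub>0(E\<^sub>0[x])\<close>, an injective resolution of \<open>R / (I + x)\<close> shifted by one.
\<close>

lemma (in resolution) resolution_add_mult:
  assumes reg: "\<And>z. x * z \<in> I \<Longrightarrow> z \<in> I"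
  obtains E' \<epsilon>' \<delta>' where "resolution t (add_mult (*) I x) E' \<epsilon>' \<delta>' n"
proof -
  define V where "V i = {e \<in> E i. t x e = 0}" for i
  let ?I = "add_mult (*) I x"
  have I': "is_ideal ?I" using ideal by (rule R.subspace_add_mult)
  have x_in: "x \<in> ?I" using R.add_mult_memI[OF ideal, of x 1] by simp
  have I_sub: "I \<subseteq> ?I" by (rule R.add_mult_superset)
  have V_sub: "V i \<subseteq> E i" for i by (auto simp: V_def)
  have V: "subspace (V i)" for i
    using subspace_annihilated[of i "{x}"] by (simp add: V_def)
  have kill_V: "t a e = 0" if a: "a \<in> ?I" and e: "e \<in> V i" for a e i
  proof -
    obtain l v where "l \<in> I" "a = l + x * v" using a by (auto simp: add_mult_def)
    then show ?thesis using e kill[of l e i] scale_scale[of v x e]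
      by (simp add: V_def scale_left_distrib mult.commute)
  qed
  have baer_V: "baer t ?I (V i)" for i
    unfolding baer_def
  proof (intro allI impI, elim conjE)
    fix A h assume A: "is_ideal A" "?I \<subseteq> A" "linear_map_on (*) t A (V i) h" "\<forall>x\<in>?I. h x = 0"
    have "linear_map_on (*) t A (E i) h" using linear_map_on_subset[OF A(3) order_refl V_sub] .
    moreover have "I \<subseteq> A" using A(2) I_sub by blast
    ultimately obtain e where e: "e \<in> E i" "\<And>a. a \<in> A \<Longrightarrow> h a = t a e"
      using baer[of i] A(1,4) I_sub unfolding baer_def by blast
    have "t x e = 0" using e(2)[of x] x_in A(2,4) by auto
    then show "\<exists>e\<in>V i. \<forall>a\<in>A. h a = t a e" using e by (auto simp: V_def)
  qed
  have delta_V: "linear_map_on t t (V i) (V (Suc i)) (\<delta> i)" for i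
    unfolding linear_map_on_def V_def using delta_in delta_add delta_scale delta_0
    by auto (metis)
  \<comment> \<open>Since \<open>x\<close> is regular on \<open>R / I\<close>, every injective
    \<open>R / I\<close>-module is divisible by \<open>x\<close>.\<close>
  have divide: "\<exists>e'\<in>E i. t x e' = e" if e: "e \<in> E i" for e i
  proof -
    have "t r e = 0" if "r * x \<in> I" for r
      using kill[OF reg e, of r] that by (simp add: mult.commute)
    then obtain e' where "e' \<in> E i" "t x e' = e" using ex_division[OF ideal order_refl e] by blast
    then show ?thesis by blast
  qed
  define D where "D = \<delta> 0 ` V 0"
  have D_sub: "D \<subseteq> V 1" unfolding D_def using linear_map_onD(1)[OF delta_V[of 0]] by auto
  have inj0: "e = 0" if e: "e \<in> V 0" "\<delta> 0 e = 0" for e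
  proof -
    obtain r where r: "e = \<epsilon> r" using exact_0[of e] e V_sub by auto
    then have "\<epsilon> (x * r) = 0" using e(1) by (simp add: eps_mult V_def)
    then have "r \<in> I" using reg ker_eps by blast
    then show ?thesis using r ker_eps by simp
  qed
  have baer_D: "baer t ?I D"
    unfolding D_def by (rule baer_image[OF module_t V baer_V delta_V inj0])
  have D: "subspace D"
    unfolding D_def by (rule subspace_linear_image[OF module_t module_t V delta_V])
  \<comment> \<open>\<open>D\<close> is isomorphic to \<open>V 0\<close> and thus injective, so its
    inclusion into \<open>V 1\<close> has a retraction. The kernel \<open>C\<close> of the
    retraction becomes the new term in degree 0.\<close>
  obtain \<rho> where rho: "linear_map_on t t (V 1) D \<rho>" and rho_D: "\<And>d. d \<in> D \<Longrightarrow> \<rho> d = d"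
  proof (rule baer_extend[OF module_t module_t D V D_sub D baer_D, of id])
    show "linear_map_on t t D D id" by (auto simp: linear_map_on_def)
    show "t a v \<in> D \<and> id (t a v) = 0" if "a \<in> ?I" "v \<in> V 1" for a v
      using kill_V[OF that] subspace_0[OF D] by simp
  qed auto
  note rho_in = linear_map_onD(1)[OF rho] and rho_add = linear_map_onD(2)[OF rho]
    and rho_scale = linear_map_onD(3)[OF rho] and rho_diff = linear_map_on_diff[OF module_t module_t V rho]
  have V1E: "e \<in> E 1" if "e \<in> V 1" for e using that V_sub[of 1] by blast
  have rhoE: "\<rho> e \<in> E 1" if "e \<in> V 1" for e using rho_in[OF that] D_sub V1E by blast
  define C where "C = {c \<in> V 1. \<rho> c = 0}"
  have C_sub: "C \<subseteq> V 1" by (auto simp: C_def)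
  have proj: "e - \<rho> e \<in> C" if "e \<in> V 1" for e
    using that rho_in[OF that] rho_D[OF rho_in[OF that]] D_sub subspace_diff[OF V] rho_diff[OF that, of "\<rho> e"]
    by (auto simp: C_def)
  have delta_D: "\<delta> 1 d = 0" if "d \<in> D" for d
    using that delta_delta[of _ 0] V_sub by (auto simp: D_def)
  have C: "subspace C"
    unfolding subspace_def C_def
    using subspace_0[OF V] subspace_add[OF V] subspace_scale[OF V] rho_add rho_scale
      linear_map_on_0[OF module_t module_t V rho] by auto
  have baer_C: "baer t ?I C"
    unfolding baer_def
  proof (intro allI impI, elim conjE)
    fix A h assume A: "is_ideal A" "?I \<subseteq> A" "linear_map_on (*) t A C h" "\<forall>x\<in>?I. h x = 0"
    have "linear_map_on (*) t A (V 1) h" using linear_map_on_subset[OF A(3) order_refl C_sub] .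
    then obtain e where e: "e \<in> V 1" "\<And>a. a \<in> A \<Longrightarrow> h a = t a e"
      using baer_V[of 1] A unfolding baer_def by blast
    have "h a = t a (e - \<rho> e)" if "a \<in> A" for a
    proof -
      have "\<rho> (h a) = 0" using linear_map_onD(1)[OF A(3) that] by (simp add: C_def)
      then have "t a (\<rho> e) = 0" using e(2)[OF that] rho_scale[OF e(1)] by simp
      then show ?thesis using e(2)[OF that] by (simp add: scale_right_diff_distrib)
    qed
    then show "\<exists>e\<in>C. \<forall>a\<in>A. h a = t a e" using proj[OF e(1)] by blast
  qed
  \<comment> \<open>The connecting homomorphism: divide \<open>\<epsilon> r\<close> by
    \<open>x\<close>, then apply \<open>\<delta> 0\<close>. The quotient is unique up to
    \<open>V 0\<close>, and its image \<open>D\<close> is removed by subtracting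
    \<open>\<rho>\<close>.\<close>
  define lft where "lft r = (SOME g. g \<in> E 0 \<and> t x g = \<epsilon> r)" for r
  have lft: "lft r \<in> E 0" "t x (lft r) = \<epsilon> r" for r
    using someI_ex[of "\<lambda>g. g \<in> E 0 \<and> t x g = \<epsilon> r"] divide[OF eps_in[of r]] unfolding lft_def by blast+
  have delta_lft: "\<delta> 0 g \<in> V 1" if "g \<in> E 0" "t x g = \<epsilon> r" for g r
    using that delta_in[of g 0] delta_scale[of g 0 x] delta_eps by (simp add: V_def)
  define \<epsilon>' where "\<epsilon>' r = \<delta> 0 (lft r) - \<rho> (\<delta> 0 (lft r))" for r
  have eps': "\<epsilon>' r = \<delta> 0 g - \<rho> (\<delta> 0 g)" if g: "g \<in> E 0" "t x g = \<epsilon> r" for g r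
  proof -
    have "lft r - g \<in> V 0" using lft[of r] g E_diff by (simp add: V_def scale_right_diff_distrib)
    then have "\<delta> 0 (lft r - g) \<in> D" by (simp add: D_def)
    then have "\<rho> (\<delta> 0 (lft r) - \<delta> 0 g) = \<delta> 0 (lft r) - \<delta> 0 g"
      using rho_D delta_diff lft(1) g(1) by simp
    then show ?thesis
      using rho_diff[OF delta_lft[OF lft] delta_lft[OF g]] by (simp add: \<epsilon>'_def algebra_simps)
  qed
  define E' where "E' i = (if i = 0 then C else V (Suc i))" for i
  define \<delta>' where "\<delta>' i = \<delta> (Suc i)" for i
  have "resolution t ?I E' \<epsilon>' \<delta>' n"
  proof (unfold_locales, goal_cases)
    case 1 show ?case by (rule I')
  next
    case (2 i) show ?case using C V by (simp add: E'_def)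
  next
    case (3 a e i) then show ?case using kill_V C_sub by (auto simp: E'_def split: if_splits)
  next
    case (4 i) show ?case using baer_C baer_V by (simp add: E'_def)
  next
    case 5
    show ?case
      unfolding linear_map_on_def
    proof (intro conjI ballI allI)
      fix r show "\<epsilon>' r \<in> E' 0" using proj[OF delta_lft[OF lft]] by (simp add: \<epsilon>'_def E'_def)
    next
      fix r r' :: 'a
      have "\<epsilon>' (r + r') = \<delta> 0 (lft r + lft r') - \<rho> (\<delta> 0 (lft r + lft r'))"
        by (rule eps') (use lft E_add in \<open>auto simp: scale_right_distrib eps_add\<close>)
      then show "\<epsilon>' (r + r') = \<epsilon>' r + \<epsilon>' r'"
        using delta_add[OF lft(1) lft(1)] rho_add[OF delta_lft[OF lft] delta_lft[OF lft]]
        by (simp add: \<epsilon>'_def)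
    next
      fix c r :: 'a
      have "\<epsilon>' (c * r) = \<delta> 0 (t c (lft r)) - \<rho> (\<delta> 0 (t c (lft r)))"
        by (rule eps') (use lft E_scale in \<open>simp_all add: eps_mult scale_left_commute[of x c] del: scale_scale\<close>)
      then show "\<epsilon>' (c * r) = t c (\<epsilon>' r)"
        using delta_scale[OF lft(1)] rho_scale[OF delta_lft[OF lft]]
        by (simp add: \<epsilon>'_def scale_right_diff_distrib)
    qed
  next
    case (6 i)
    show ?case
    proof (cases i)
      case 0
      then show ?thesis
        using linear_map_on_subset[OF delta_V[of 1] C_sub order_refl] by (simp add: E'_def \<delta>'_def numeral_2_eq_2)
    next
      case (Suc j)
      then show ?thesis using delta_V[of "Suc i"] by (simp add: E'_def \<delta>'_def)
    qed
  next
    case (7 r)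
    show ?case
    proof
      assume "\<epsilon>' r = 0"
      then have "\<delta> 0 (lft r) \<in> D" using rho_in[OF delta_lft[OF lft]] by (metis \<epsilon>'_def eq_iff_diff_eq_0)
      then obtain g where g: "g \<in> V 0" "\<delta> 0 (lft r) = \<delta> 0 g" by (auto simp: D_def)
      have gE: "g \<in> E 0" using g(1) V_sub by blast
      have "\<delta> 0 (lft r - g) = 0" using delta_diff[OF lft(1) gE] g(2) by simp
      then obtain r' where "lft r - g = \<epsilon> r'" using exact_0[OF E_diff[OF lft(1) gE]] by blast
      then have "\<epsilon> r = \<epsilon> (x * r')"
        using lft(2)[of r] g(1) by (simp add: V_def eps_mult scale_right_diff_distrib flip: \<open>lft r - g = \<epsilon> r'\<close>)
      then have "r - x * r' \<in> I" using eps_eq_iff by blast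
      moreover have "r = (r - x * r') + x * r'" by simp
      ultimately show "r \<in> ?I" unfolding add_mult_def by blast
    next
      assume "r \<in> ?I"
      then obtain l v where lv: "l \<in> I" "r = l + x * v" by (auto simp: add_mult_def)
      then have "\<epsilon> r = t x (\<epsilon> v)" using ker_eps[of l] by (simp add: eps_add eps_mult)
      then have "\<epsilon>' r = \<delta> 0 (\<epsilon> v) - \<rho> (\<delta> 0 (\<epsilon> v))" using eps'[of "\<epsilon> v" r] eps_in by simp
      then show "\<epsilon>' r = 0" using delta_eps[of v] linear_map_on_0[OF module_t module_t V rho] by simp
    qed
  next
    case 8
    show ?case
    proof (intro equalityI subsetI)
      fix c assume "c \<in> range \<epsilon>'"
      then obtain r where r: "c = \<epsilon>' r" by auto
      have "\<delta> 1 c = \<delta> 1 (\<delta> 0 (lft r)) - \<delta> 1 (\<rho> (\<delta> 0 (lft r)))"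
        unfolding r \<epsilon>'_def
        by (rule delta_diff[OF V1E[OF delta_lft[OF lft]] rhoE[OF delta_lft[OF lft]]])
      then show "c \<in> {c \<in> E' 0. \<delta>' 0 c = 0}"
        using delta_delta[OF lft(1)] delta_D[OF rho_in[OF delta_lft[OF lft]]] proj[OF delta_lft[OF lft]]
        by (simp add: E'_def \<delta>'_def r \<epsilon>'_def)
    next
      fix c assume "c \<in> {c \<in> E' 0. \<delta>' 0 c = 0}"
      then have c: "c \<in> C" "c \<in> V 1" "c \<in> E 1" "\<delta> 1 c = 0" "\<rho> c = 0" "t x c = 0"
        using C_sub V_sub[of 1] by (auto simp: E'_def \<delta>'_def C_def V_def)
      then obtain g where g: "g \<in> E 0" "\<delta> 0 g = c" using exact[of c 0] by auto
      then have "\<delta> 0 (t x g) = 0" using c by (simp add: delta_scale)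
      then obtain r where "t x g = \<epsilon> r" using exact_0[OF E_scale[OF g(1)]] by blast
      then have "\<epsilon>' r = c" using eps'[OF g(1)] g(2) c(5) by simp
      then show "c \<in> range \<epsilon>'" by blast
    qed
  next
    case (9 i)
    \<comment> \<open>A preimage \<open>g\<close> of \<open>e\<close> need not be killed by
      \<open>x\<close>, but \<open>t x g\<close> is a cocycle, hence some
      \<open>\<delta> i h\<close>. Dividing \<open>h\<close> by \<open>x\<close> gives the
      correction to \<open>g\<close>.\<close>
    have key: "\<exists>g\<in>V (Suc i). \<delta> (Suc i) g = e" if e: "e \<in> V (Suc (Suc i))" "\<delta> (Suc (Suc i)) e = 0" for e
    proof -
      have eE: "e \<in> E (Suc (Suc i))" "t x e = 0" using e V_sub by (auto simp: V_def)
      obtain g where g: "g \<in> E (Suc i)" "\<delta> (Suc i) g = e" using exact[OF eE(1) e(2)] by auto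
      then have "\<delta> (Suc i) (t x g) = 0" using eE(2) by (simp add: delta_scale)
      then obtain h where h: "h \<in> E i" "\<delta> i h = t x g" using exact[OF E_scale[OF g(1)]] by auto
      obtain h' where h': "h' \<in> E i" "t x h' = h" using divide[OF h(1)] by auto
      have "g - \<delta> i h' \<in> V (Suc i)"
        using g(1) h(2) h' delta_in[OF h'(1)] E_diff delta_scale[OF h'(1), of x]
        by (simp add: V_def scale_right_diff_distrib)
      moreover have "\<delta> (Suc i) (g - \<delta> i h') = e"
        using delta_diff[OF g(1) delta_in[OF h'(1)]] delta_delta[OF h'(1)] g(2) by simp
      ultimately show ?thesis by blast
    qed
    have key': "\<exists>g\<in>E' i. \<delta>' i g = e" if e: "e \<in> V (Suc (Suc i))" "\<delta> (Suc (Suc i)) e = 0" for e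
    proof -
      obtain g where g: "g \<in> V (Suc i)" "\<delta> (Suc i) g = e" using key[OF e] by blast
      show ?thesis
      proof (cases i)
        case 0
        have g1: "g \<in> V 1" using g(1) 0 by simp
        have "\<delta> 1 (g - \<rho> g) = \<delta> 1 g - \<delta> 1 (\<rho> g)"
          by (rule delta_diff[OF V1E[OF g1] rhoE[OF g1]])
        then have "\<delta> 1 (g - \<rho> g) = e" using delta_D[OF rho_in[OF g1]] g(2) 0 by simp
        then show ?thesis using proj[OF g1] 0 by (auto simp: E'_def \<delta>'_def)
      next
        case Suc
        then show ?thesis using g by (auto simp: E'_def \<delta>'_def)
      qed
    qed
    have "E' i \<subseteq> V (Suc i)" using C_sub by (auto simp: E'_def)
    then have sub1: "\<delta>' i ` E' i \<subseteq> {e \<in> V (Suc (Suc i)). \<delta> (Suc (Suc i)) e = 0}"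
    proof safe
      fix e assume "e \<in> E' i"
      then have e: "e \<in> V (Suc i)" using \<open>E' i \<subseteq> V (Suc i)\<close> by blast
      show "\<delta>' i e \<in> V (Suc (Suc i))" using linear_map_onD(1)[OF delta_V e] by (simp add: \<delta>'_def)
      show "\<delta> (Suc (Suc i)) (\<delta>' i e) = 0" using delta_delta e V_sub[of "Suc i"] by (auto simp: \<delta>'_def)
    qed
    have sub2: "{e \<in> V (Suc (Suc i)). \<delta> (Suc (Suc i)) e = 0} \<subseteq> \<delta>' i ` E' i" using key' by blast
    have "E' (Suc i) = V (Suc (Suc i))" "\<delta>' (Suc i) = \<delta> (Suc (Suc i))"
      by (simp_all add: E'_def \<delta>'_def)
    then show ?case using equalityI[OF sub1 sub2] by (simp only:)
  next
    case (10 i)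
    have "V (Suc i) = {0}"
    proof (rule equalityI)
      show "V (Suc i) \<subseteq> {0}" using V_sub[of "Suc i"] E_trivial[of "Suc i"] 10 by simp
      show "{0} \<subseteq> V (Suc i)" using subspace_0[OF V] by simp
    qed
    then show ?case using 10 by (simp add: E'_def)
  qed
  then show ?thesis by (rule that)
qed

lemma resolution_add_mults:
  assumes "resolution t I E \<epsilon> \<delta> n" "regular_seq (*) I xs"
  shows "\<exists>E' \<epsilon>' \<delta>'. resolution t (add_mults (*) I xs) E' \<epsilon>' \<delta>' n"
  using assms
proof (induction xs arbitrary: I E \<epsilon> \<delta>)
  case Nil then show ?case by auto
next
  case (Cons x xs)
  interpret resolution t I E \<epsilon> \<delta> n by fact
  obtain E' \<epsilon>' \<delta>' where "resolution t (add_mult (*) I x) E' \<epsilon>' \<delta>' n"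
    using resolution_add_mult[of x] Cons.prems(2) by auto
  then show ?case using Cons.IH Cons.prems(2) by simp
qed

lemma gorenstein_resolution:
  assumes "gorenstein TYPE('b::ab_group_add) TYPE('a::comm_ring_1)"
  obtains t :: "'a::comm_ring_1 \<Rightarrow> 'b::ab_group_add \<Rightarrow> 'b" and E \<epsilon> \<delta> n where "resolution t {0} E \<epsilon> \<delta> n"
proof -
  obtain t :: "'a \<Rightarrow> 'b \<Rightarrow> 'b" and E \<epsilon> \<delta> n where res: "Modules.module t \<and>
      (\<forall>i. injective_submodule t (E i)) \<and> linear_map_on (*) t UNIV (E 0) \<epsilon> \<and>
      (\<forall>i. linear_map_on t t (E i) (E (Suc i)) (\<delta> i)) \<and> inj \<epsilon> \<and>
      range \<epsilon> = {x \<in> E 0. \<delta> 0 x = 0} \<and>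
      (\<forall>i. \<delta> i ` E i = {x \<in> E (Suc i). \<delta> (Suc i) x = 0}) \<and> (\<forall>i>n. E i = {0})"
    using assms unfolding gorenstein_def finite_injective_dimension_def by (elim exE) (rule that)
  then have t: "Modules.module t" and inj: "injective_submodule t (E i)"
    and eps: "linear_map_on (*) t UNIV (E 0) \<epsilon>"
    and delta: "linear_map_on t t (E i) (E (Suc i)) (\<delta> i)" and inje: "inj \<epsilon>"
    and r: "range \<epsilon> = {x \<in> E 0. \<delta> 0 x = 0}"
    and d: "\<delta> i ` E i = {x \<in> E (Suc i). \<delta> (Suc i) x = 0}" and n: "i > n \<Longrightarrow> E i = {0}" for i
    by simp_all
  interpret t: Modules.module t by fact
  have sub: "t.subspace (E i)" for i using inj[of i] by (simp add: injective_submodule_def)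
  have "baer t {0} (E i)" for i
    unfolding baer_def
  proof (intro allI impI, elim conjE)
    fix A h assume A: "is_ideal A" "linear_map_on (*) t A (E i) h"
    then obtain g where g: "linear_map_on (*) t UNIV (E i) g" "\<And>x. x \<in> A \<Longrightarrow> g x = h x"
      using inj[of i] R.module_axioms R.subspace_UNIV unfolding injective_submodule_def by blast
    have "h a = t a (g 1)" if "a \<in> A" for a
      using g(2)[OF that] linear_map_onD(3)[OF g(1), of 1 a] by simp
    then show "\<exists>e\<in>E i. \<forall>a\<in>A. h a = t a e" using linear_map_onD(1)[OF g(1), of 1] by blast
  qed
  moreover have "\<epsilon> x = 0 \<longleftrightarrow> x \<in> {0}" for x
    using linear_map_on_0[OF R.module_axioms t R.subspace_UNIV eps] injD[OF inje, of x 0] by auto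
  ultimately have "resolution t {0} E \<epsilon> \<delta> n"
    using sub eps delta r d n R.subspace_single_0
    by (intro resolution.intro resolution_axioms.intro t) (assumption | simp)+
  then show ?thesis by (rule that)
qed

section \<open>Nakayama's lemma\<close>

text \<open>Projecting to the last coordinate gives an ideal as image and a kernel with one
  coordinate less.\<close>

lemma noetherian_tuples:
  assumes noeth: "noetherian TYPE('a::comm_ring_1)" and "F.subspace U" "U \<subseteq> (tuples n :: (nat \<Rightarrow> 'a) set)"
  shows "\<exists>W. finite W \<and> W \<subseteq> U \<and> U \<subseteq> F.span W"
  using assms(2,3)
proof (induction n arbitrary: U)
  case 0
  then have "U \<subseteq> {0}" by (auto simp: tuples_def fun_eq_iff)
  then have "U \<subseteq> F.span {}" unfolding F.span_empty .
  then show ?case by blast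
next
  case (Suc n)
  note U = Suc.prems(1)
  let ?A = "(\<lambda>c. c n) ` U"
  have image: "is_ideal ((\<lambda>c. c n) ` U)" if "F.subspace U" for U :: "(nat \<Rightarrow> 'a) set"
    by (rule subspace_linear_image[OF F.module_axioms R.module_axioms that, where B = UNIV])
      (simp add: linear_map_on_def)
  from image[OF U] obtain B where B: "finite B" "R.span B = ?A" using noeth by (auto simp: noetherian_def)
  then have "\<forall>b\<in>B. \<exists>c\<in>U. c n = b" using R.span_superset[of B] by auto
  then obtain g where g: "\<And>b. b \<in> B \<Longrightarrow> g b \<in> U \<and> g b n = b" by metis
  let ?U = "{c \<in> U. c n = 0}"
  have "F.subspace ?U"
    by (rule F.subspaceI)
      (use F.subspace_0[OF U] F.subspace_add[OF U] F.subspace_scale[OF U] in auto)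
  moreover have "?U \<subseteq> tuples n"
  proof
    fix c assume c: "c \<in> ?U"
    then have "c j = 0" if "j \<ge> Suc n" for j using Suc.prems(2) that by (auto simp: tuples_def)
    then have "c j = 0" if "j \<ge> n" for j using that c by (cases "j = n") auto
    then show "c \<in> tuples n" by (simp add: tuples_def)
  qed
  ultimately have "\<exists>W. finite W \<and> W \<subseteq> ?U \<and> ?U \<subseteq> F.span W" by (rule Suc.IH)
  then obtain W where W: "finite W" "W \<subseteq> ?U" "?U \<subseteq> F.span W" by (elim exE conjE)
  have "U \<subseteq> F.span (g ` B \<union> W)"
  proof
    fix c assume c: "c \<in> U"
    have "R.span B \<subseteq> (\<lambda>d. d n) ` F.span (g ` B)"
    proof (rule R.span_minimal)
      show "B \<subseteq> (\<lambda>d. d n) ` F.span (g ` B)"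
      proof
        fix b assume b: "b \<in> B"
        show "b \<in> (\<lambda>d. d n) ` F.span (g ` B)"
          by (rule image_eqI[OF _ F.span_base[OF imageI[OF b, of g]]]) (use g[OF b] in simp)
      qed
      show "is_ideal ((\<lambda>d. d n) ` F.span (g ` B))" by (rule image[OF F.subspace_span])
    qed
    moreover have "c n \<in> R.span B" unfolding B(2) using c by (rule imageI)
    ultimately have "c n \<in> (\<lambda>d. d n) ` F.span (g ` B)" by (rule subsetD)
    then obtain d where d: "d \<in> F.span (g ` B)" "d n = c n" by (elim imageE) (rule that, simp_all)
    have "F.span (g ` B) \<subseteq> U" by (intro F.span_minimal U) (use g in blast)
    then have "c - d \<in> ?U" using c d F.subspace_diff[OF U] by auto
    then have "c - d \<in> F.span (g ` B \<union> W)" using W(3) F.span_mono[of W "g ` B \<union> W"] by blast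
    moreover have "d \<in> F.span (g ` B \<union> W)" using d(1) F.span_mono[of "g ` B" "g ` B \<union> W"] by blast
    ultimately have "(c - d) + d \<in> F.span (g ` B \<union> W)" by (rule F.span_add)
    then show "c \<in> F.span (g ` B \<union> W)" by simp
  qed
  moreover have "finite (g ` B \<union> W)" "g ` B \<union> W \<subseteq> U" using B(1) W g by auto
  ultimately show ?case by blast
qed

corollary noetherian_tuples_combination:
  assumes "noetherian TYPE('a::comm_ring_1)" "F.subspace U" "U \<subseteq> (tuples n :: (nat \<Rightarrow> 'a) set)"
  shows "\<exists>(k::nat) w. (\<forall>l<k. w l \<in> U) \<and> (\<forall>c\<in>U. \<exists>a\<in>tuples k. c = (\<lambda>j. \<Sum>l<k. a l * w l j))"
proof -
  obtain W where W: "finite W" "W \<subseteq> U" "U \<subseteq> F.span W" using noetherian_tuples[OF assms] by blast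
  obtain k :: nat and w where kw: "\<forall>l<k. w l \<in> W"
    "\<forall>x\<in>F.span W. \<exists>a. x = (\<Sum>l<k. scale_fun (*) (a l) (w l))"
    using F.finite_span_tuple[OF W(1)] by (elim exE conjE)
  show ?thesis
  proof (intro exI[of _ k] exI[of _ w] conjI ballI allI impI)
    show "w l \<in> U" if "l < k" for l using kw(1) that W(2) by blast
    fix c assume "c \<in> U"
    then obtain a where a: "c = (\<Sum>l<k. scale_fun (*) (a l) (w l))" using kw(2) W(3) by blast
    show "\<exists>a\<in>tuples k. c = (\<lambda>j. \<Sum>l<k. a l * w l j)"
      by (rule bexI[of _ "\<lambda>l. if l < k then a l else 0"])
        (auto simp: a fun_eq_iff sum_fun_apply tuples_def intro!: sum.cong)
  qed
qed

lemma (in noetherian_local) nakayama: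
  fixes s :: "'a \<Rightarrow> 'c::ab_group_add \<Rightarrow> 'c"
  assumes ms: "Modules.module s" and "finite S" and B: "module.subspace s B" and "S \<subseteq> W"
    and "W \<subseteq> module.span s (S \<union> B)" and x: "x \<in> m"
    and W: "\<And>w. w \<in> W \<Longrightarrow> \<exists>w'\<in>W. \<exists>b\<in>B. w = s x w' + b"
  shows "W \<subseteq> B"
proof -
  interpret s: Modules.module s by fact
  from assms(2,4,5) show ?thesis
  proof (induction S rule: finite_induct)
    case empty
    then show ?case using B s.span_eq_iff[of B] by (metis Un_empty_left)
  next
    case (insert z S)
    obtain w b where w: "w \<in> W" "b \<in> B" "z = s x w + b" using W[of z] insert.prems(1) by auto
    have "w \<in> s.span (insert z (S \<union> B))" using w(1) insert.prems(2) by auto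
    then obtain k where k: "w - s k z \<in> s.span (S \<union> B)" unfolding s.span_breakdown_eq by blast
    have "z = s x (w - s k z) + s x (s k z) + b" by (subst w(3)) (simp add: s.scale_right_diff_distrib)
    then have "s (1 - x * k) z = s x (w - s k z) + b"
      by (simp add: s.scale_left_diff_distrib algebra_simps)
    also have "\<dots> \<in> s.span (S \<union> B)" by (intro s.span_add s.span_scale k s.span_base) (use w(2) in auto)
    finally have z1: "s (1 - x * k) z \<in> s.span (S \<union> B)" .
    have "1 - x * k \<notin> m"
    proof
      assume "1 - x * k \<in> m"
      then have "(1 - x * k) + x * k \<in> m"
        using x is_ideal_m is_ideal_mult_right R.subspace_add by blast
      then show False using one_notin_m by simp
    qed
    then obtain y where "y * (1 - x * k) = 1" using unit_if_notin_m by blast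
    then have "z = s y (s (1 - x * k) z)" by (metis s.scale_one s.scale_scale)
    also have "\<dots> \<in> s.span (S \<union> B)" by (rule s.span_scale[OF z1])
    finally have "insert z (S \<union> B) \<subseteq> s.span (S \<union> B)" using s.span_superset[of "S \<union> B"] by auto
    then have "s.span (insert z S \<union> B) \<subseteq> s.span (S \<union> B)" by (intro s.span_minimal) auto
    then show ?case using insert by blast
  qed
qed

section \<open>Finite generation of the cohomology\<close>

text \<open>
  For \<open>K \<subseteq> R\<^sup>s\<close> the tuples \<open>e\<close> in \<open>E\<^sub>i\<^sup>s\<close> with \<open>dot t s r e = 0\<close> for all \<open>r\<close> in \<open>K\<close> are the
  homomorphisms \<open>R\<^sup>s / K \<rightarrow> E\<^sub>i\<close>, so \<open>cocycle\<close> modulo \<open>coboundary\<close> is \<open>Ext\<^sup>i(R\<^sup>s / K, R / I)\<close> over \<open>R / I\<close>.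
\<close>

locale noetherian_resolution = resolution t I E \<epsilon> \<delta> n + noetherian_local m
  for t :: "'a::comm_ring_1 \<Rightarrow> 'b::ab_group_add \<Rightarrow> 'b" and I E \<epsilon> \<delta> n and m :: "'a set"
begin

definition cocycle :: "nat \<Rightarrow> nat \<Rightarrow> (nat \<Rightarrow> 'a) set \<Rightarrow> (nat \<Rightarrow> 'b) \<Rightarrow> bool"
  where "cocycle i s K e \<longleftrightarrow> (\<forall>j<s. e j \<in> E i \<and> \<delta> i (e j) = 0) \<and> (\<forall>r\<in>K. dot t s r e = 0)"

definition coboundary :: "nat \<Rightarrow> nat \<Rightarrow> (nat \<Rightarrow> 'a) set \<Rightarrow> (nat \<Rightarrow> 'b) \<Rightarrow> bool"
  where "coboundary i s K e \<longleftrightarrow> (case i of 0 \<Rightarrow> \<forall>j<s. e j = 0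
    | Suc i' \<Rightarrow> \<exists>g. (\<forall>j<s. g j \<in> E i' \<and> \<delta> i' (g j) = e j) \<and> (\<forall>r\<in>K. dot t s r g = 0))"

definition fg_cohomology :: "nat \<Rightarrow> nat \<Rightarrow> (nat \<Rightarrow> 'a) set \<Rightarrow> bool"
  where "fg_cohomology i s K \<longleftrightarrow> (\<exists>(k::nat) z. (\<forall>l<k. cocycle i s K (z l)) \<and>
    (\<forall>e. cocycle i s K e \<longrightarrow> (\<exists>c. coboundary i s K (\<lambda>j. e j - (\<Sum>l<k. t (c l) (z l j))))))"

lemma cocycle_add: "cocycle i s K e \<Longrightarrow> cocycle i s K e' \<Longrightarrow> cocycle i s K (e + e')"
  by (simp add: cocycle_def dot_add_right E_add delta_add)

lemma cocycle_scale: "cocycle i s K e \<Longrightarrow> cocycle i s K (scale_fun t c e)"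
  by (simp add: cocycle_def dot_scale_right E_scale delta_scale)

lemma coboundary_add:
  assumes "coboundary i s K e" "coboundary i s K e'" shows "coboundary i s K (e + e')"
proof (cases i)
  case 0 then show ?thesis using assms by (simp add: coboundary_def)
next
  case (Suc i')
  obtain g where g: "\<forall>j<s. g j \<in> E i' \<and> \<delta> i' (g j) = e j" "\<forall>r\<in>K. dot t s r g = 0"
    using assms(1) Suc by (auto simp: coboundary_def)
  obtain g' where g': "\<forall>j<s. g' j \<in> E i' \<and> \<delta> i' (g' j) = e' j" "\<forall>r\<in>K. dot t s r g' = 0"
    using assms(2) Suc by (auto simp: coboundary_def)
  show ?thesis
    unfolding coboundary_def Suc nat.case
    by (rule exI[of _ "g + g'"]) (use g g' in \<open>simp add: E_add delta_add dot_add_right\<close>)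
qed

lemma coboundary_scale:
  assumes "coboundary i s K e" shows "coboundary i s K (scale_fun t c e)"
proof (cases i)
  case 0 then show ?thesis using assms by (simp add: coboundary_def)
next
  case (Suc i')
  obtain g where g: "\<forall>j<s. g j \<in> E i' \<and> \<delta> i' (g j) = e j" "\<forall>r\<in>K. dot t s r g = 0"
    using assms(1) Suc by (auto simp: coboundary_def)
  show ?thesis
    unfolding coboundary_def Suc nat.case
    by (rule exI[of _ "scale_fun t c g"]) (use g in \<open>simp add: E_scale delta_scale dot_scale_right\<close>)
qed

text \<open>
  If cocycles modulo coboundaries embed into a subquotient of \<open>R\<^sup>k\<close>, then they are finitely
  generated; the embedding is given as a linear relation \<open>\<rho>\<close>.
\<close>

lemma fg_cohomologyI:
  assumes cocycle: "\<And>e c. \<rho> e c \<Longrightarrow> cocycle i s K e"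
    and add: "\<And>e c e' c'. \<rho> e c \<Longrightarrow> \<rho> e' c' \<Longrightarrow> \<rho> (e + e') (c + c')"
    and scale: "\<And>r e c. \<rho> e c \<Longrightarrow> \<rho> (scale_fun t r e) (scale_fun (*) r c)"
    and total: "\<And>e. cocycle i s K e \<Longrightarrow> \<exists>c\<in>tuples k. \<rho> e c"
    and zero: "\<And>e. \<rho> e 0 \<Longrightarrow> coboundary i s K e"
  shows "fg_cohomology i s K"
proof -
  define U where "U = {c \<in> tuples k. \<exists>e. \<rho> e c}"
  have "cocycle i s K 0" by (simp add: cocycle_def E_0 delta_0 dot_def)
  then obtain c where "\<rho> 0 c" using total by blast
  from scale[OF this, of 0] have rho0: "\<rho> 0 0" by (simp add: scale_fun_def zero_fun_def)
  have U_sub: "U \<subseteq> tuples k" by (auto simp: U_def)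
  have subU: "F.subspace U"
  proof (rule F.subspaceI)
    show "0 \<in> U" using rho0 tuples_0 unfolding U_def by blast
    show "c + c' \<in> U" if "c \<in> U" "c' \<in> U" for c c'
      using that add tuples_add unfolding U_def by blast
    show "scale_fun (*) r c \<in> U" if "c \<in> U" for r c
      using that scale tuples_scale unfolding U_def by blast
  qed
  obtain b w where w: "\<forall>l<b. w l \<in> U"
    and gen: "\<forall>c\<in>U. \<exists>a\<in>tuples b. c = (\<lambda>j. \<Sum>l<b. a l * w l j)"
    using noetherian_tuples_combination[OF noetherian subU U_sub] by (elim exE conjE)
  have "\<forall>l\<in>{..<b}. \<exists>e. \<rho> e (w l)" using w unfolding U_def by blast
  then obtain z where z: "\<And>l. l < b \<Longrightarrow> \<rho> (z l) (w l)" by (metis lessThan_iff)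
  have "\<exists>a. coboundary i s K (\<lambda>j. e j - (\<Sum>l<b. t (a l) (z l j)))" if e: "cocycle i s K e" for e
  proof -
    obtain c where c: "c \<in> tuples k" "\<rho> e c" using total[OF e] by blast
    then obtain a where a: "c = (\<lambda>j. \<Sum>l<b. a l * w l j)" using gen unfolding U_def by blast
    \<comment> \<open>Subtracting the generators one at a time keeps the pair in the relation
      \<open>\<rho>\<close>; at the end its second component is 0.\<close>
    have "b' \<le> b \<Longrightarrow> \<rho> (\<lambda>j. e j - (\<Sum>l<b'. t (a l) (z l j))) (\<lambda>j. c j - (\<Sum>l<b'. a l * w l j))" for b'
    proof (induction b')
      case 0 then show ?case using c(2) by simp
    next
      case (Suc b')
      then have "\<rho> ((\<lambda>j. e j - (\<Sum>l<b'. t (a l) (z l j))) + scale_fun t (- a b') (z b'))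
          ((\<lambda>j. c j - (\<Sum>l<b'. a l * w l j)) + scale_fun (*) (- a b') (w b'))"
        by (intro add scale z) auto
      then show ?case by (simp add: plus_fun_def scale_fun_def algebra_simps)
    qed
    from this[of b] have "\<rho> (\<lambda>j. e j - (\<Sum>l<b. t (a l) (z l j))) 0" by (simp add: a zero_fun_def)
    then show ?thesis using zero by blast
  qed
  then show ?thesis using z cocycle unfolding fg_cohomology_def by blast
qed

text \<open>By exactness a cocycle of degree 0 has its entries in the image of
  \<open>\<epsilon>\<close>, so representatives in \<open>R\<close> embed it into \<open>R^s\<close>
  up to \<open>I\<close>.\<close>

lemma fg_cohomology_0: "fg_cohomology 0 s K"
proof (rule fg_cohomologyI[where k = s and \<rho> = "\<lambda>e c. cocycle 0 s K e \<and> (\<forall>j<s. e j = \<epsilon> (c j))"])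
  fix e assume e: "cocycle 0 s K e"
  then have "\<forall>j\<in>{..<s}. \<exists>r. e j = \<epsilon> r" using exact_0 by (auto simp: cocycle_def)
  then obtain c where c: "\<And>j. j < s \<Longrightarrow> e j = \<epsilon> (c j)" by (metis lessThan_iff)
  show "\<exists>c\<in>tuples s. cocycle 0 s K e \<and> (\<forall>j<s. e j = \<epsilon> (c j))"
    by (rule bexI[of _ "\<lambda>j. if j < s then c j else 0"]) (use e c in \<open>auto simp: tuples_def\<close>)
qed (auto simp: cocycle_add cocycle_scale eps_add eps_mult coboundary_def eps_0)

text \<open>
  Dimension shifting along \<open>0 \<rightarrow> R\<^sup>b / K' \<rightarrow> R\<^sup>s \<rightarrow> R\<^sup>s / K \<rightarrow> 0\<close> (over \<open>R / I\<close>): a cocycle \<open>e\<close> lifts to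
  \<open>g\<close> with \<open>\<delta> g = e\<close>, and \<open>g\<close> restricted to generators \<open>v\<close> of \<open>K\<close> is a cocycle of lower degree.
\<close>

lemma fg_cohomology_step:
  assumes IH: "\<And>s K. F.subspace K \<Longrightarrow> K \<subseteq> tuples s \<Longrightarrow> fg_cohomology i s K"
    and K: "F.subspace K" "K \<subseteq> tuples s"
  shows "fg_cohomology (Suc i) s K"
proof -
  obtain b v where v': "\<forall>l<b. v l \<in> K"
    and gen': "\<forall>r\<in>K. \<exists>a\<in>tuples b. r = (\<lambda>j. \<Sum>l<b. a l * v l j)"
    using noetherian_tuples_combination[OF noetherian K] by (elim exE conjE)
  note v = v'[rule_format] and gen = gen'[rule_format]
  define comb where "comb a = (\<lambda>j. \<Sum>l<b. a l * v l j)" for a :: "nat \<Rightarrow> 'a"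
  have comb_add: "comb (a + a') = comb a + comb a'" for a a'
    by (simp add: comb_def fun_eq_iff distrib_right sum.distrib)
  have comb_scale: "comb (scale_fun (*) c a) = scale_fun (*) c (comb a)" for c a
    by (simp add: comb_def fun_eq_iff sum_distrib_left mult.assoc)
  have dot_comb: "dot t s (comb a) e = (\<Sum>l<b. t (a l) (dot t s (v l) e))" for a e
    unfolding comb_def by (rule dot_sum_left)
  \<comment> \<open>The relations between the generators \<open>v\<close> of \<open>K\<close> count
    modulo \<open>I\<close>, because the dimension shift takes place over
    \<open>R / I\<close>.\<close>
  define K' where "K' = {a \<in> tuples b. \<forall>j. comb a j \<in> I}"
  have "fg_cohomology i b K'"
  proof (rule IH)
    show "F.subspace K'"
      unfolding F.subspace_def K'_def
      using tuples_0 tuples_add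
        tuples_scale R.subspace_add[OF ideal] is_ideal_mult_left[OF ideal]
        R.subspace_0[OF ideal] by (auto simp: comb_add comb_scale) (simp add: comb_def)
    show "K' \<subseteq> tuples b" by (auto simp: K'_def)
  qed
  then obtain k :: nat and z where z: "\<And>l. l < k \<Longrightarrow> cocycle i b K' (z l)" and
    zgen: "\<And>e. cocycle i b K' e \<Longrightarrow> \<exists>c. coboundary i b K' (\<lambda>j. e j - (\<Sum>l<k. t (c l) (z l j)))"
    unfolding fg_cohomology_def by blast
  \<comment> \<open>\<open>c\<close> records the class of the restricted lift \<open>g\<close> in
    terms of the generators \<open>z\<close> in degree \<open>i\<close>.\<close>
  define \<rho> where "\<rho> e c \<longleftrightarrow> cocycle (Suc i) s K e \<and>
      (\<exists>g. (\<forall>j<s. g j \<in> E i \<and> \<delta> i (g j) = e j) \<and>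
        coboundary i b K' (\<lambda>l. dot t s (v l) g - (\<Sum>q<k. t (c q) (z q l))))" for e c
  show ?thesis
  proof (rule fg_cohomologyI[where \<rho> = \<rho> and k = k])
    show "cocycle (Suc i) s K e" if "\<rho> e c" for e c using that by (simp add: \<rho>_def)
  next
    fix e c e' c' assume "\<rho> e c" "\<rho> e' c'"
    then obtain g g' where g: "\<forall>j<s. g j \<in> E i \<and> \<delta> i (g j) = e j"
      "coboundary i b K' (\<lambda>l. dot t s (v l) g - (\<Sum>q<k. t (c q) (z q l)))"
      "cocycle (Suc i) s K e" "cocycle (Suc i) s K e'"
      and g': "\<forall>j<s. g' j \<in> E i \<and> \<delta> i (g' j) = e' j"
      "coboundary i b K' (\<lambda>l. dot t s (v l) g' - (\<Sum>q<k. t (c' q) (z q l)))"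
      unfolding \<rho>_def by blast
    have "coboundary i b K' (\<lambda>l. dot t s (v l) (g + g') - (\<Sum>q<k. t ((c + c') q) (z q l)))"
      using coboundary_add[OF g(2) g'(2)]
      by (simp add: plus_fun_def[of "\<lambda>l. dot t s (v l) g - _ l" for g] dot_add_right
          scale_left_distrib sum.distrib algebra_simps)
    moreover have "\<forall>j<s. (g + g') j \<in> E i \<and> \<delta> i ((g + g') j) = (e + e') j"
      using g(1) g'(1) by (simp add: E_add delta_add)
    ultimately show "\<rho> (e + e') (c + c')"
      unfolding \<rho>_def using cocycle_add[OF g(3,4)] by blast
  next
    fix r e c assume "\<rho> e c"
    then obtain g where g: "\<forall>j<s. g j \<in> E i \<and> \<delta> i (g j) = e j"
      "coboundary i b K' (\<lambda>l. dot t s (v l) g - (\<Sum>q<k. t (c q) (z q l)))"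
      "cocycle (Suc i) s K e"
      unfolding \<rho>_def by blast
    have "coboundary i b K' (\<lambda>l. dot t s (v l) (scale_fun t r g) - (\<Sum>q<k. t (scale_fun (*) r c q) (z q l)))"
      using coboundary_scale[OF g(2), of r]
      by (simp add: scale_fun_def[of t r "\<lambda>l. dot t s (v l) g - _ l"] dot_scale_right
          scale_right_diff_distrib scale_sum_right)
    moreover have "\<forall>j<s. scale_fun t r g j \<in> E i \<and> \<delta> i (scale_fun t r g j) = scale_fun t r e j"
      using g(1) by (simp add: E_scale delta_scale)
    ultimately show "\<rho> (scale_fun t r e) (scale_fun (*) r c)"
      unfolding \<rho>_def using cocycle_scale[OF g(3)] by blast
  next
    fix e assume e: "cocycle (Suc i) s K e"
    then have "\<forall>j\<in>{..<s}. \<exists>g. g \<in> E i \<and> \<delta> i g = e j" using exact unfolding cocycle_def by (metis lessThan_iff)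
    then obtain g where g: "\<And>j. j < s \<Longrightarrow> g j \<in> E i \<and> \<delta> i (g j) = e j" by (metis lessThan_iff)
    have delta_dot: "\<delta> i (dot t s r g) = dot t s r e" for r
      using linear_map_on_dot[OF module_t module_t E delta, of s g i r] g by (simp add: dot_def)
    have "cocycle i b K' (\<lambda>l. dot t s (v l) g)"
      unfolding cocycle_def
    proof (intro conjI allI impI ballI)
      fix l assume "l < b"
      then show "dot t s (v l) g \<in> E i" "\<delta> i (dot t s (v l) g) = 0"
        using g v e by (auto intro!: dot_in_subspace[OF E] simp: delta_dot cocycle_def)
    next
      fix a assume a: "a \<in> K'"
      have "dot t b a (\<lambda>l. dot t s (v l) g) = dot t s (comb a) g" by (simp add: dot_comb) (simp add: dot_def)
      also have "\<dots> = 0" unfolding dot_def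
      proof (intro sum.neutral ballI)
        fix j assume "j \<in> {..<s}"
        then have "g j \<in> E i" using g by simp
        moreover have "comb a j \<in> I" using a by (simp add: K'_def)
        ultimately show "t (comb a j) (g j) = 0" by (intro kill)
      qed
      finally show "dot t b a (\<lambda>l. dot t s (v l) g) = 0" .
    qed
    then obtain c where c: "coboundary i b K' (\<lambda>l. dot t s (v l) g - (\<Sum>q<k. t (c q) (z q l)))"
      using zgen by blast
    let ?c = "\<lambda>q. if q < k then c q else 0"
    have "(\<Sum>q<k. t (?c q) (z q l)) = (\<Sum>q<k. t (c q) (z q l))" for l by (intro sum.cong) auto
    then have "\<rho> e ?c" unfolding \<rho>_def using e g c by (intro conjI exI[of _ g]) auto
    moreover have "?c \<in> tuples k" by (simp add: tuples_def)
    ultimately show "\<exists>c\<in>tuples k. \<rho> e c" by blast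
  next
    fix e assume "\<rho> e 0"
    then obtain g where g: "\<And>j. j < s \<Longrightarrow> g j \<in> E i \<and> \<delta> i (g j) = e j"
      and cb: "coboundary i b K' (\<lambda>l. dot t s (v l) g)"
      unfolding \<rho>_def by auto
    \<comment> \<open>The restriction of \<open>g\<close> to the \<open>v l\<close> is a coboundary.
      In positive degree it is \<open>\<delta> i' h\<close> with \<open>h\<close> respecting
      \<open>K'\<close>, so \<open>h\<close> extends by injectivity to a map on \<open>R^s\<close>;
      subtracting the differential of that map makes \<open>g\<close> vanish on \<open>K\<close>
      without changing \<open>\<delta> i g\<close>.\<close>
    have "\<exists>g'. (\<forall>j<s. g' j \<in> E i \<and> \<delta> i (g' j) = e j) \<and> (\<forall>l<b. dot t s (v l) g' = 0)"
    proof (cases i)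
      case 0
      then show ?thesis using g cb by (intro exI[of _ g]) (simp add: coboundary_def)
    next
      case (Suc i')
      obtain h where h: "\<And>l. l < b \<Longrightarrow> h l \<in> E i' \<and> \<delta> i' (h l) = dot t s (v l) g"
        and hK': "\<And>a. a \<in> K' \<Longrightarrow> dot t b a h = 0"
        using cb by (auto simp: coboundary_def Suc)
      let ?L = "{r \<in> tuples s. \<forall>j. r j \<in> I}"
      have L: "F.subspace ?L"
        using tuples_0 tuples_add tuples_scale R.subspace_0[OF ideal] R.subspace_add[OF ideal]
          is_ideal_mult_left[OF ideal] by (intro F.subspaceI) auto
      have rel: "dot t b a h = 0" if a: "dot (scale_fun (*)) b a v \<in> ?L" for a
      proof -
        let ?a = "\<lambda>l. if l < b then a l else 0"
        have "comb ?a = dot (scale_fun (*)) b a v" by (simp add: comb_def dot_def fun_eq_iff sum_fun_apply)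
        then have "?a \<in> K'" using a by (simp add: K'_def tuples_def)
        from hK'[OF this] show ?thesis by (simp add: dot_def)
      qed
      have vt: "v l \<in> tuples s" if "l < b" for l using v[OF that] K(2) by blast
      have IL: "scale_fun (*) a r \<in> ?L" if "a \<in> I" "r \<in> tuples s" for a r
        using tuples_scale[OF that(2)] is_ideal_mult_right[OF ideal that(1)] by simp
      obtain H where H: "linear_map_on (scale_fun (*)) t (tuples s) (E i') H" and Hv: "\<And>l. l < b \<Longrightarrow> H (v l) = h l"
        by (rule baer_extend_family[where v = v and h = h and k = b,
              OF F.module_axioms module_t subspace_tuples L _ E baer]) (use IL vt h rel in blast)+
      define u where "u j = H (unit_tuple j)" for j
      have uE: "u j \<in> E i'" if "j < s" for j
        unfolding u_def using that by (intro linear_map_onD(1)[OF H]) (simp add: tuples_def unit_tuple_def)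
      have uv: "dot t s (v l) u = h l" if "l < b" for l
        unfolding u_def using linear_map_on_tuples[OF module_t H vt[OF that]] Hv[OF that] by simp
      have delta_dot: "\<delta> i' (dot t s r u) = dot t s r (\<lambda>j. \<delta> i' (u j))" for r
        by (rule linear_map_on_dot[OF module_t module_t E delta uE])
      show ?thesis
      proof (intro exI[of _ "g - (\<lambda>j. \<delta> i' (u j))"] conjI allI impI)
        fix j assume j: "j < s"
        have d: "\<delta> i' (u j) \<in> E i" using delta_in[OF uE[OF j]] Suc by simp
        show "(g - (\<lambda>j. \<delta> i' (u j))) j \<in> E i" using g[OF j] d E_diff by simp
        show "\<delta> i ((g - (\<lambda>j. \<delta> i' (u j))) j) = e j"
          using g[OF j] d delta_diff delta_delta[OF uE[OF j]] Suc by simp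
      next
        fix l assume l: "l < b"
        show "dot t s (v l) (g - (\<lambda>j. \<delta> i' (u j))) = 0"
          using h[OF l] uv[OF l] delta_dot[of "v l"] by (simp add: dot_diff_right)
      qed
    qed
    then obtain g' where g': "\<And>j. j < s \<Longrightarrow> g' j \<in> E i \<and> \<delta> i (g' j) = e j"
      and vg': "\<And>l. l < b \<Longrightarrow> dot t s (v l) g' = 0" by blast
    have "dot t s r g' = 0" if r: "r \<in> K" for r
    proof -
      obtain a where "r = comb a" using gen[OF r] unfolding comb_def by blast
      then show ?thesis using vg' by (simp add: dot_comb)
    qed
    then show "coboundary (Suc i) s K e" using g' by (auto simp: coboundary_def)
  qed
qed

lemma fg_cohomology:
  assumes "F.subspace K" "K \<subseteq> tuples s" shows "fg_cohomology i s K"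
  using assms
proof (induction i arbitrary: s K)
  case 0 show ?case by (rule fg_cohomology_0)
next
  case (Suc i) show ?case by (rule fg_cohomology_step[OF Suc.IH Suc.prems])
qed

end

section \<open>Self-injectivity in depth zero\<close>

context noetherian_resolution
begin

text \<open>\<open>vanish i A\<close> says that \<open>Ext\<^sup>i\<^sup>+\<^sup>1(R / A, R / I) = 0\<close> over \<open>R / I\<close>.\<close>

definition vanish :: "nat \<Rightarrow> 'a set \<Rightarrow> bool"
  where "vanish i A \<longleftrightarrow> (\<forall>e\<in>E (Suc i). \<delta> (Suc i) e = 0 \<longrightarrow> (\<forall>a\<in>A. t a e = 0) \<longrightarrow>
    (\<exists>g\<in>E i. (\<forall>a\<in>A. t a g = 0) \<and> \<delta> i g = e))"

lemma vanishD:
  assumes "vanish i A" "e \<in> E (Suc i)" "\<delta> (Suc i) e = 0" "\<And>a. a \<in> A \<Longrightarrow> t a e = 0"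
  obtains g where "g \<in> E i" "\<And>a. a \<in> A \<Longrightarrow> t a g = 0" "\<delta> i g = e"
  using assms unfolding vanish_def by blast

lemma kill_add_mult:
  assumes "\<And>b. b \<in> A \<Longrightarrow> t b e = 0" "t a e = 0" "c \<in> add_mult (*) A a"
  shows "t c e = 0"
proof -
  obtain l v where lv: "l \<in> A" "c = l + a * v" using assms(3) by (auto simp: add_mult_def)
  then show ?thesis using assms(1)[OF lv(1)] assms(2) scale_scale[of v a e]
    by (simp add: scale_left_distrib mult.commute)
qed

text \<open>The map \<open>Ext\<^sup>i\<^sup>+\<^sup>1(R / A, -) \<rightarrow> Ext\<^sup>i\<^sup>+\<^sup>1(R / (A : a), -)\<close> is surjective.\<close>

lemma ex_cocycle_division:
  assumes van: "\<And>A. is_ideal A \<Longrightarrow> I \<subseteq> A \<Longrightarrow> vanish (Suc i) A"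
    and A: "is_ideal A" "I \<subseteq> A"
    and e: "e \<in> E (Suc i)" "\<delta> (Suc i) e = 0" "\<And>r. r * a \<in> A \<Longrightarrow> t r e = 0"
  obtains e' where "e' \<in> E (Suc i)" "\<delta> (Suc i) e' = 0" "\<And>b. b \<in> A \<Longrightarrow> t b e' = 0" "t a e' = e"
proof -
  obtain d where d: "d \<in> E (Suc i)" "\<And>b. b \<in> A \<Longrightarrow> t b d = 0" "t a d = e"
    using ex_division[OF A e(1), of a] e(3) by blast
  \<comment> \<open>\<open>d\<close> need not be a cocycle, but \<open>\<delta> (Suc i) d\<close> is
    killed by \<open>A\<close> and \<open>a\<close>. Vanishing in the next degree gives
    \<open>d'\<close> with the same differential that is killed by both, and \<open>d - d'\<close>
    is the cocycle sought.\<close>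
  let ?A = "add_mult (*) A a"
  have "t c (\<delta> (Suc i) d) = 0" if "c \<in> ?A" for c
  proof (rule kill_add_mult[OF _ _ that])
    show "t b (\<delta> (Suc i) d) = 0" if "b \<in> A" for b
      using d(2)[OF that] delta_scale[OF d(1), of b] delta_0 by simp
    show "t a (\<delta> (Suc i) d) = 0" using d(3) e(2) delta_scale[OF d(1), of a] by simp
  qed
  moreover have "vanish (Suc i) ?A"
    by (rule van[OF R.subspace_add_mult[OF A(1)]]) (use A(2) R.add_mult_superset in blast)
  ultimately obtain d' where d': "d' \<in> E (Suc i)" "\<And>b. b \<in> ?A \<Longrightarrow> t b d' = 0"
    "\<delta> (Suc i) d' = \<delta> (Suc i) d"
    using vanishD[of "Suc i" ?A "\<delta> (Suc i) d"] delta_in[OF d(1)] delta_delta[OF d(1)] by blast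
  show ?thesis
  proof (rule that[of "d - d'"])
    show "d - d' \<in> E (Suc i)" using d(1) d'(1) by (rule E_diff)
    show "\<delta> (Suc i) (d - d') = 0" using delta_diff[OF d(1) d'(1)] d'(3) by simp
    show "t b (d - d') = 0" if "b \<in> A" for b
      using d(2)[OF that] d'(2)[of b] R.add_mult_superset[of A a] that
      by (auto simp: scale_right_diff_distrib)
    have "a \<in> ?A" using R.add_mult_memI[OF A(1), of a 1] by simp
    then show "t a (d - d') = e" using d(3) d'(2) by (simp add: scale_right_diff_distrib)
  qed
qed

text \<open>The middle term of the Ext sequence for
  \<open>0 -> R / (A : a) -> R / A -> R / (A + aR) -> 0\<close>, on elements.\<close>

lemma vanish_extension:
  assumes A: "is_ideal A" "I \<subseteq> A"
    and sum: "vanish i (add_mult (*) A a)" and colon: "vanish i {r. r * a \<in> A}"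
  shows "vanish i A"
  unfolding vanish_def
proof (intro ballI impI)
  fix e assume e: "e \<in> E (Suc i)" "\<delta> (Suc i) e = 0" "\<forall>b\<in>A. t b e = 0"
  have "t r (t a e) = 0" if "r \<in> {r. r * a \<in> A}" for r using e(3) that by simp
  moreover have "\<delta> (Suc i) (t a e) = 0" using e by (simp add: delta_scale)
  ultimately obtain g where g: "g \<in> E i" "\<And>r. r \<in> {r. r * a \<in> A} \<Longrightarrow> t r g = 0" "\<delta> i g = t a e"
    using vanishD[OF colon E_scale[OF e(1)]] by blast
  have "t r g = 0" if "r * a \<in> A" for r using g(2) that by simp
  then obtain g' where g': "g' \<in> E i" "\<And>b. b \<in> A \<Longrightarrow> t b g' = 0" "t a g' = g"
    using ex_division[OF A g(1)] by blast
  have dg: "\<delta> i g' \<in> E (Suc i)" by (rule delta_in[OF g'(1)])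
  have "t c (e - \<delta> i g') = 0" if "c \<in> add_mult (*) A a" for c
  proof (rule kill_add_mult[OF _ _ that])
    show "t b (e - \<delta> i g') = 0" if "b \<in> A" for b
      using e(3) that g'(2)[OF that] delta_scale[OF g'(1), of b] delta_0
      by (simp add: scale_right_diff_distrib)
    show "t a (e - \<delta> i g') = 0"
      using g(3) g'(3) delta_scale[OF g'(1), of a] by (simp add: scale_right_diff_distrib)
  qed
  moreover have "\<delta> (Suc i) (e - \<delta> i g') = 0"
    using delta_diff[OF e(1) dg] e(2) delta_delta[OF g'(1)] by simp
  ultimately obtain h where h: "h \<in> E i" "\<And>c. c \<in> add_mult (*) A a \<Longrightarrow> t c h = 0" "\<delta> i h = e - \<delta> i g'"
    using vanishD[OF sum E_diff[OF e(1) dg]] by blast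
  have "t b (g' + h) = 0" if "b \<in> A" for b
    using g'(2)[OF that] h(2)[of b] that R.add_mult_superset[of A a] by (auto simp: scale_right_distrib)
  moreover have "\<delta> i (g' + h) = e" using delta_add[OF g'(1) h(1)] h(3) by simp
  ultimately show "\<exists>g\<in>E i. (\<forall>a\<in>A. t a g = 0) \<and> \<delta> i g = e" using E_add[OF g'(1) h(1)] by blast
qed

text \<open>Multiplication by \<open>u\<close> embeds \<open>R / m\<close> into
  \<open>R / I\<close>, so a class over \<open>R / m\<close> comes from a cocycle \<open>e'\<close>
  over \<open>R / I\<close>. There \<open>e'\<close> is a coboundary \<open>\<delta> i g\<close> by
  exactness, and \<open>t u g\<close> is killed by \<open>m\<close>.\<close>

lemma vanish_socle:
  assumes van: "\<And>A. is_ideal A \<Longrightarrow> I \<subseteq> A \<Longrightarrow> vanish (Suc i) A"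
    and u: "u \<notin> I" "\<And>a. a \<in> m \<Longrightarrow> a * u \<in> I"
  shows "vanish i m"
  unfolding vanish_def
proof (intro ballI impI)
  fix e assume e: "e \<in> E (Suc i)" "\<delta> (Suc i) e = 0" "\<forall>b\<in>m. t b e = 0"
  have "t r e = 0" if "r * u \<in> I" for r
    using colon_subset_m[OF ideal u(1) that] e(3) by blast
  then obtain e' where e': "e' \<in> E (Suc i)" "\<delta> (Suc i) e' = 0" "t u e' = e"
    using ex_cocycle_division[OF van ideal order_refl e(1,2)] by blast
  obtain g where g: "g \<in> E i" "\<delta> i g = e'" using exact[OF e'(1,2)] by blast
  have "t a (t u g) = 0" if "a \<in> m" for a using kill[OF u(2)[OF that] g(1)] by simp
  moreover have "\<delta> i (t u g) = e" using delta_scale[OF g(1)] g(2) e'(3) by simp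
  ultimately show "\<exists>g\<in>E i. (\<forall>a\<in>m. t a g = 0) \<and> \<delta> i g = e" using E_scale[OF g(1)] by blast
qed

text \<open>
  An element \<open>x\<close> of \<open>m\<close> outside the prime \<open>P\<close> acts surjectively on \<open>Ext\<^sup>i\<^sup>+\<^sup>1(R / P, R / I)\<close>, a finitely
  generated module.
\<close>

lemma vanish_prime:
  assumes van: "\<And>A. is_ideal A \<Longrightarrow> I \<subseteq> A \<Longrightarrow> vanish (Suc i) A"
    and P: "prime_ideal P" "I \<subseteq> P" and x: "x \<in> m" "x \<notin> P"
  shows "vanish i P"
proof -
  have idP: "is_ideal P" using P(1) by (simp add: prime_ideal_def)
  define W where "W = {e \<in> E (Suc i). \<delta> (Suc i) e = 0 \<and> (\<forall>b\<in>P. t b e = 0)}"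
  define B where "B = \<delta> i ` {g \<in> E i. \<forall>b\<in>P. t b g = 0}"
  \<comment> \<open>The cyclic module \<open>R / P\<close> is written as \<open>R^1 / K\<close> to
    make \<open>fg_cohomology\<close> applicable.\<close>
  define K where "K = {r \<in> tuples 1. r 0 \<in> P}"
  have dotK: "dot t 1 r e = t (r 0) (e 0)" for r e by (simp add: dot_def)
  have K: "(\<forall>r\<in>K. dot t 1 r e = 0) \<longleftrightarrow> (\<forall>b\<in>P. t b (e 0) = 0)" for e
  proof
    assume *: "\<forall>r\<in>K. dot t 1 r e = 0"
    show "\<forall>b\<in>P. t b (e 0) = 0"
    proof
      fix b assume "b \<in> P"
      then have "(\<lambda>j. if j = 0 then b else 0) \<in> K" by (simp add: K_def tuples_def)
      then show "t b (e 0) = 0" using * dotK by fastforce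
    qed
  qed (auto simp: dotK K_def simp del: One_nat_def)
  have "fg_cohomology (Suc i) 1 K"
  proof (rule fg_cohomology)
    show "F.subspace K"
      using tuples_0 tuples_add
        tuples_scale R.subspace_0[OF idP] R.subspace_add[OF idP]
        is_ideal_mult_left[OF idP]
      by (intro F.subspaceI) (auto simp: K_def)
    show "K \<subseteq> tuples 1" by (auto simp: K_def)
  qed
  then obtain k :: nat and z where z: "\<forall>l<k. cocycle (Suc i) 1 K (z l)" and
    zgen: "\<forall>e. cocycle (Suc i) 1 K e \<longrightarrow> (\<exists>c. coboundary (Suc i) 1 K (\<lambda>j. e j - (\<Sum>l<k. t (c l) (z l j))))"
    unfolding fg_cohomology_def by (elim exE conjE)
  have cocycle: "cocycle (Suc i) 1 K e \<longleftrightarrow> e 0 \<in> W" for e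
    unfolding cocycle_def K by (auto simp: W_def)
  have coboundary: "coboundary (Suc i) 1 K e \<longleftrightarrow> e 0 \<in> B" for e
  proof
    assume "coboundary (Suc i) 1 K e"
    then obtain g where "g 0 \<in> E i" "\<delta> i (g 0) = e 0" "\<forall>b\<in>P. t b (g 0) = 0"
      unfolding coboundary_def K by auto
    then show "e 0 \<in> B" unfolding B_def by (intro image_eqI[of _ _ "g 0"]) simp_all
  next
    assume "e 0 \<in> B"
    then obtain g where "g \<in> E i" "\<forall>b\<in>P. t b g = 0" "\<delta> i g = e 0" by (auto simp: B_def)
    then show "coboundary (Suc i) 1 K e"
      unfolding coboundary_def nat.case K by (intro exI[of _ "\<lambda>_. g"]) simp
  qed
  have zW: "(\<lambda>l. z l 0) ` {..<k} \<subseteq> W" using z by (auto simp: cocycle simp del: One_nat_def)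
  have B: "subspace B"
    unfolding B_def
    by (rule subspace_linear_image[OF module_t module_t subspace_annihilated linear_map_on_subset[OF delta]]) auto
  have "W \<subseteq> span ((\<lambda>l. z l 0) ` {..<k} \<union> B)"
  proof
    fix w assume "w \<in> W"
    then have "cocycle (Suc i) 1 K (\<lambda>_. w)" unfolding cocycle .
    then obtain c where "coboundary (Suc i) 1 K (\<lambda>j. w - (\<Sum>l<k. t (c l) (z l j)))"
      using zgen[rule_format, of "\<lambda>_. w"] by blast
    then have b: "w - (\<Sum>l<k. t (c l) (z l 0)) \<in> B" unfolding coboundary .
    have "(w - (\<Sum>l<k. t (c l) (z l 0))) + (\<Sum>l<k. t (c l) (z l 0)) \<in> span ((\<lambda>l. z l 0) ` {..<k} \<union> B)"
      by (intro span_add span_sum span_scale) (auto intro: span_base b)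
    then show "w \<in> span ((\<lambda>l. z l 0) ` {..<k} \<union> B)" by simp
  qed
  moreover have "\<exists>w'\<in>W. \<exists>b\<in>B. w = t x w' + b" if w: "w \<in> W" for w
  proof -
    have "t r w = 0" if "r * x \<in> P" for r
      using w that P(1) x(2) unfolding prime_ideal_def W_def by blast
    then obtain e' where "e' \<in> E (Suc i)" "\<delta> (Suc i) e' = 0" "\<And>b. b \<in> P \<Longrightarrow> t b e' = 0" "t x e' = w"
      using ex_cocycle_division[OF van idP P(2), where e = w and a = x] w unfolding W_def by blast
    then have "e' \<in> W" "w = t x e' + 0" by (auto simp: W_def)
    then show ?thesis using subspace_0[OF B] by blast
  qed
  ultimately have "W \<subseteq> B" using nakayama[OF module_t _ B zW _ x(1)] by blast
  then show ?thesis unfolding vanish_def W_def B_def by blast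
qed

text \<open>Noetherian induction on \<open>A\<close>. A proper ideal that is not prime reduces to
  the larger ideals \<open>A + aR\<close> and \<open>A : a\<close>; a prime other than
  \<open>m\<close> is left to Nakayama's lemma, and \<open>m\<close> to the socle element.\<close>

lemma vanish_step:
  assumes van: "\<And>A. is_ideal A \<Longrightarrow> I \<subseteq> A \<Longrightarrow> vanish (Suc i) A"
    and u: "u \<notin> I" "\<And>a. a \<in> m \<Longrightarrow> a * u \<in> I" and A: "is_ideal A" "I \<subseteq> A"
  shows "vanish i A"
proof -
  have "I \<subseteq> A \<longrightarrow> vanish i A"
  proof (rule noetherian_induct[OF noetherian A(1)], rule impI)
    fix A assume A: "is_ideal A" "I \<subseteq> A"
      and IH: "\<And>J. is_ideal J \<Longrightarrow> A \<subset> J \<Longrightarrow> I \<subseteq> J \<longrightarrow> vanish i J"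
    consider "1 \<in> A" | "prime_ideal A" "1 \<notin> A" | "\<not> prime_ideal A" "1 \<notin> A" by blast
    then show "vanish i A"
    proof cases
      case 1
      have "\<exists>g\<in>E i. (\<forall>a\<in>A. t a g = 0) \<and> \<delta> i g = e" if "\<forall>a\<in>A. t a e = 0" for e
        using that 1 E_0 delta_0 by (intro bexI[of _ 0]) auto
      then show ?thesis by (simp add: vanish_def)
    next
      case 2
      show ?thesis
      proof (cases "m \<subseteq> A")
        case True
        then have "A = m" using proper_ideal_subset_m[OF A(1) 2(2)] by blast
        then show ?thesis using vanish_socle[OF van u] by simp
      next
        case False
        then obtain x where "x \<in> m" "x \<notin> A" by blast
        then show ?thesis using vanish_prime[OF van 2(1) A(2)] by blast
      qed
    next
      case 3
      then obtain a b where ab: "a * b \<in> A" "a \<notin> A" "b \<notin> A"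
        using A(1) unfolding prime_ideal_def by auto
      show ?thesis
      proof (rule vanish_extension[OF A, of i a])
        have id: "is_ideal (add_mult (*) A a)" by (rule R.subspace_add_mult[OF A(1)])
        have "a \<in> add_mult (*) A a" using R.add_mult_memI[OF A(1), of a 1] by simp
        then show "vanish i (add_mult (*) A a)" using IH[OF id] R.add_mult_superset[of A a] A(2) ab(2) by blast
        have "A \<subseteq> {r. r * a \<in> A}" using is_ideal_mult_right[OF A(1)] by blast
        moreover have "b \<in> {r. r * a \<in> A}" using ab(1) by (simp add: mult.commute)
        ultimately show "vanish i {r. r * a \<in> A}"
          using IH[OF is_ideal_colon[OF A(1)], of a] ab(3) A(2) by blast
      qed
    qed
  qed
  then show ?thesis using A(2) by blast
qed

lemma vanish_all:
  assumes u: "u \<notin> I" "\<And>a. a \<in> m \<Longrightarrow> a * u \<in> I" and A: "is_ideal A" "I \<subseteq> A"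
  shows "vanish i A"
proof -
  have trivial: "vanish i A" if "i \<ge> n" for i A
    unfolding vanish_def using E_trivial[of "Suc i"] that delta_0 E_0
    by (auto intro!: bexI[of _ 0])
  \<comment> \<open>Descending induction on the degree, starting where the resolution has ended. The
    subtraction is truncated, so the step changes nothing once \<open>k \<ge> n\<close>.\<close>
  have step: "\<forall>A. is_ideal A \<longrightarrow> I \<subseteq> A \<longrightarrow> vanish (n - k) A" for k
  proof (induction k)
    case 0 then show ?case using trivial by simp
  next
    case (Suc k)
    show ?case
    proof (cases "k < n")
      case True
      then have "Suc (n - Suc k) = n - k" by simp
      then show ?thesis using vanish_step[OF _ u, of "n - Suc k"] Suc.IH by simp
    next
      case False
      then show ?thesis using Suc.IH by simp
    qed
  qed
  show ?thesis
  proof (cases "i \<le> n")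
    case True
    then have "n - (n - i) = i" by simp
    then show ?thesis using step[of "n - i"] A by simp
  qed (use trivial in simp)
qed

text \<open>A map \<open>h\<close> into \<open>R / I\<close> is multiplication by some
  \<open>e\<close> in \<open>E 0\<close>. The obstruction to moving \<open>e\<close> into
  \<open>R / I\<close> is the class of \<open>\<delta> 0 e\<close> in
  \<open>Ext^1(R / A, R / I)\<close>, which vanishes.\<close>

theorem baer_range_eps:
  assumes u: "u \<notin> I" "\<And>a. a \<in> m \<Longrightarrow> a * u \<in> I"
  shows "baer t I (range \<epsilon>)"
  unfolding baer_def
proof (intro allI impI, elim conjE)
  fix A h assume A: "is_ideal A" "I \<subseteq> A" and h: "linear_map_on (*) t A (range \<epsilon>) h" "\<forall>x\<in>I. h x = 0"
  have "range \<epsilon> \<subseteq> E 0" using eps_in by blast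
  then have "linear_map_on (*) t A (E 0) h" by (rule linear_map_on_subset[OF h(1) order_refl])
  then obtain e where e: "e \<in> E 0" "\<And>a. a \<in> A \<Longrightarrow> h a = t a e"
    using baer[of 0, unfolded baer_def, rule_format, of A h] A h(2) by blast
  have "t a (\<delta> 0 e) = 0" if "a \<in> A" for a
  proof -
    have "\<delta> 0 (h a) = 0" using linear_map_onD(1)[OF h(1) that] delta_eps by auto
    then show ?thesis using e(2)[OF that] delta_scale[OF e(1)] by simp
  qed
  then obtain g where g: "g \<in> E 0" "\<And>a. a \<in> A \<Longrightarrow> t a g = 0" "\<delta> 0 g = \<delta> 0 e"
    using vanishD[OF vanish_all[OF u A, of 0] delta_in[OF e(1)] delta_delta[OF e(1)]] by blast
  then have "\<delta> 0 (e - g) = 0" using delta_diff[OF e(1)] by simp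
  then have "e - g \<in> range \<epsilon>" using exact_0[OF E_diff[OF e(1) g(1)]] by auto
  moreover have "h a = t a (e - g)" if "a \<in> A" for a
    using e(2) g(2) that by (simp add: scale_right_diff_distrib)
  ultimately show "\<exists>e\<in>range \<epsilon>. \<forall>a\<in>A. h a = t a e" by blast
qed

end

section \<open>Lifting homomorphisms along a regular sequence\<close>

definition linear_mod :: "('a::comm_ring_1 \<Rightarrow> 'c::ab_group_add \<Rightarrow> 'c) \<Rightarrow> 'a set \<Rightarrow> 'c set \<Rightarrow> ('c \<Rightarrow> 'a) \<Rightarrow> bool"
  where "linear_mod s Q A h \<longleftrightarrow> (\<forall>x\<in>A. \<forall>y\<in>A. h (x + y) - (h x + h y) \<in> Q) \<and>
    (\<forall>r. \<forall>x\<in>A. h (s r x) - r * h x \<in> Q)"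

lemma linear_modD:
  assumes "linear_mod s Q A h"
  shows "x \<in> A \<Longrightarrow> y \<in> A \<Longrightarrow> h (x + y) - (h x + h y) \<in> Q" "x \<in> A \<Longrightarrow> h (s r x) - r * h x \<in> Q"
  using assms by (auto simp: linear_mod_def)

lemma linear_mod_mono: "linear_mod s Q A h \<Longrightarrow> Q \<subseteq> Q' \<Longrightarrow> linear_mod s Q' A h"
  unfolding linear_mod_def by blast

lemma linear_mod_diff:
  assumes Q: "is_ideal Q" and h: "linear_mod s Q A h" "linear_mod s Q A h'"
  shows "linear_mod s Q A (\<lambda>x. h x - h' x)"
  unfolding linear_mod_def
proof (intro conjI ballI allI)
  fix x assume x: "x \<in> A"
  have "(h (s r x) - r * h x) - (h' (s r x) - r * h' x) \<in> Q" for r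
    using linear_modD(2)[OF h(1) x] linear_modD(2)[OF h(2) x] by (rule R.subspace_diff[OF Q])
  then show "h (s r x) - h' (s r x) - r * (h x - h' x) \<in> Q" for r by (simp add: algebra_simps)
  fix y assume y: "y \<in> A"
  have "(h (x + y) - (h x + h y)) - (h' (x + y) - (h' x + h' y)) \<in> Q"
    using linear_modD(1)[OF h(1) x y] linear_modD(1)[OF h(2) x y] by (rule R.subspace_diff[OF Q])
  then show "h (x + y) - h' (x + y) - (h x - h' x + (h y - h' y)) \<in> Q" by (simp add: algebra_simps)
qed

lemma linear_mod_zero: "is_ideal Q \<Longrightarrow> linear_mod s Q A (\<lambda>_. 0)"
  by (simp add: linear_mod_def R.subspace_0)

lemma linear_mod_mult:
  assumes "is_ideal Q" "linear_mod s Q A h" shows "linear_mod s Q A (\<lambda>k. r * h k)"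
  unfolding linear_mod_def
proof (intro conjI ballI allI)
  fix k assume k: "k \<in> A"
  show "r * h (s a k) - a * (r * h k) \<in> Q" for a
    using is_ideal_mult_left[OF assms(1) linear_modD(2)[OF assms(2) k, of a], of r] by (simp add: algebra_simps)
  fix l assume l: "l \<in> A"
  show "r * h (k + l) - (r * h k + r * h l) \<in> Q"
    using is_ideal_mult_left[OF assms(1) linear_modD(1)[OF assms(2) k l], of r] by (simp add: algebra_simps)
qed

lemma linear_mod_add:
  assumes "is_ideal Q" "linear_mod s Q A h" "linear_mod s Q A h'"
  shows "linear_mod s Q A (\<lambda>k. h k + h' k)"
  using linear_mod_diff[OF assms(1,2) linear_mod_mult[OF assms(1,3), of "- 1"]] by simp

lemma linear_mod_0:
  fixes s :: "'a::comm_ring_1 \<Rightarrow> 'c::ab_group_add \<Rightarrow> 'c"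
  assumes "Modules.module s" "module.subspace s A" and Q: "is_ideal Q" and h: "linear_mod s Q A h"
  shows "h 0 \<in> Q"
proof -
  interpret s: Modules.module s by fact
  have "0 \<in> A" by (rule s.subspace_0) fact
  then show ?thesis using linear_modD(2)[OF h, of 0 0] by simp
qed

lemma linear_mod_sum:
  fixes s :: "'a::comm_ring_1 \<Rightarrow> 'c::ab_group_add \<Rightarrow> 'c" and k :: nat
  assumes "Modules.module s" and A: "module.subspace s A" and Q: "is_ideal Q" and h: "linear_mod s Q A h"
    and v: "\<And>l. l < k \<Longrightarrow> v l \<in> A"
  shows "h (\<Sum>l<k. s (a l) (v l)) - (\<Sum>l<k. a l * h (v l)) \<in> Q"
  using v
proof (induction k)
  case 0
  then show ?case using linear_mod_0[OF assms(1) A Q h] by simp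
next
  case (Suc k)
  interpret s: Modules.module s by fact
  let ?x = "\<Sum>l<k. s (a l) (v l)" and ?y = "\<Sum>l<k. a l * h (v l)"
  have vA: "v k \<in> A" using Suc.prems by simp
  have xA: "?x \<in> A" by (intro s.subspace_sum[OF A] s.subspace_scale[OF A]) (use Suc.prems in simp)
  have "(h (?x + s (a k) (v k)) - (h ?x + h (s (a k) (v k)))) + (h ?x - ?y) + (h (s (a k) (v k)) - a k * h (v k)) \<in> Q"
    using linear_modD(1)[OF h xA s.subspace_scale[OF A vA]] linear_modD(2)[OF h vA] Suc
    by (intro R.subspace_add[OF Q]) auto
  then show ?case by (simp add: algebra_simps)
qed

text \<open>Multiplication by \<open>x\<close> is injective on \<open>R / I\<close>, so the
  quotients are unique modulo \<open>I\<close> and inherit linearity from \<open>g\<close>.\<close>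

lemma linear_mod_divide:
  fixes s :: "'a::comm_ring_1 \<Rightarrow> 'c::ab_group_add \<Rightarrow> 'c"
  assumes "Modules.module s" and A: "module.subspace s A" and I: "is_ideal I"
    and x: "\<And>z. x * z \<in> I \<Longrightarrow> z \<in> I" and g: "linear_mod s I A g"
    and gI: "\<And>k. k \<in> A \<Longrightarrow> g k \<in> add_mult (*) I x"
  obtains h where "linear_mod s I A h" "\<And>k. k \<in> A \<Longrightarrow> g k - x * h k \<in> I"
proof -
  interpret s: Modules.module s by fact
  have "\<exists>z. g k - x * z \<in> I" if k: "k \<in> A" for k
  proof -
    obtain i z where "i \<in> I" "g k = i + x * z" using gI[OF k] by (auto simp: add_mult_def)
    then show ?thesis by (intro exI[of _ z]) simp
  qed
  then obtain h where h: "\<And>k. k \<in> A \<Longrightarrow> g k - x * h k \<in> I" by metis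
  show ?thesis
  proof (rule that[OF _ h])
    show "linear_mod s I A h"
      unfolding linear_mod_def
    proof (intro conjI ballI allI)
      fix k assume k: "k \<in> A"
      fix r
      have "(g (s r k) - r * g k) - (g (s r k) - x * h (s r k)) + r * (g k - x * h k) \<in> I"
        by (rule R.subspace_add[OF I R.subspace_diff[OF I linear_modD(2)[OF g k]
              h[OF s.subspace_scale[OF A k]]] is_ideal_mult_left[OF I h[OF k]]])
      then have "x * (h (s r k) - r * h k) \<in> I" by (simp add: algebra_simps)
      then show "h (s r k) - r * h k \<in> I" by (rule x)
    next
      fix k l assume k: "k \<in> A" and l: "l \<in> A"
      have "(g (k + l) - (g k + g l)) - (g (k + l) - x * h (k + l)) + (g k - x * h k) + (g l - x * h l) \<in> I"
        by (rule R.subspace_add[OF I R.subspace_add[OF I R.subspace_diff[OF I linear_modD(1)[OF g k l]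
              h[OF s.subspace_add[OF A k l]]] h[OF k]] h[OF l]])
      then have "x * (h (k + l) - (h k + h l)) \<in> I" by (simp add: algebra_simps)
      then show "h (k + l) - (h k + h l) \<in> I" by (rule x)
    qed
  qed
qed

lemma linear_mod_dot: "is_ideal Q \<Longrightarrow> linear_mod (scale_fun (*)) Q A (\<lambda>k. dot (*) n k c)"
  by (simp add: linear_mod_def R.dot_add_left R.dot_scale_left R.subspace_0)

lemma linear_mod_generators:
  fixes s :: "'a::comm_ring_1 \<Rightarrow> 'c::ab_group_add \<Rightarrow> 'c" and k :: nat
  assumes "Modules.module s" and A: "module.subspace s A" and Q: "is_ideal Q" and h: "linear_mod s Q A h"
    and v: "\<And>l. l < k \<Longrightarrow> v l \<in> A" "\<And>l. l < k \<Longrightarrow> h (v l) \<in> Q"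
  shows "h (\<Sum>l<k. s (a l) (v l)) \<in> Q"
proof -
  have "(\<Sum>l<k. a l * h (v l)) \<in> Q" using v(2) by (intro R.subspace_sum[OF Q] is_ideal_mult_left[OF Q]) simp
  from R.subspace_add[OF Q linear_mod_sum[where v = v and k = k and a = a, OF assms(1) A Q h v(1)] this] show ?thesis by simp
qed

text \<open>
  A finitely generated module \<open>M = R\<^sup>n / K\<close>. The predicate \<open>extends I\<close> says that \<open>Hom(R\<^sup>n, R/I)\<close> maps onto
  \<open>Hom(K, R/I)\<close>.
\<close>

locale fg_module = noetherian_local m + Modules.module s
  for m :: "'a::comm_ring_1 set" and s :: "'a \<Rightarrow> 'c::ab_group_add \<Rightarrow> 'c" +
  fixes n :: nat and b :: "nat \<Rightarrow> 'c"
  assumes generators: "\<exists>c\<in>tuples n. v = dot s n c b"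
begin

definition relations :: "(nat \<Rightarrow> 'a) set"
  where "relations = {c \<in> tuples n. dot s n c b = 0}"

definition extends :: "'a set \<Rightarrow> bool"
  where "extends I \<longleftrightarrow> (\<forall>h. linear_mod (scale_fun (*)) I relations h \<longrightarrow>
    (\<exists>c. \<forall>k\<in>relations. h k - dot (*) n k c \<in> I))"

lemma module_s: "Modules.module s" by (rule module_axioms)

lemma subspace_relations: "F.subspace relations"
proof (rule F.subspaceI)
  show "0 \<in> relations" using tuples_0 by (simp add: relations_def dot_def)
  show "c + c' \<in> relations" if "c \<in> relations" "c' \<in> relations" for c c'
  proof -
    have "c + c' \<in> tuples n" using that unfolding relations_def by (intro tuples_add) auto
    then show ?thesis using that by (simp add: relations_def dot_add_left)
  qed
  show "scale_fun (*) r c \<in> relations" if "c \<in> relations" for r c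
  proof -
    have "scale_fun (*) r c \<in> tuples n"
      using that unfolding relations_def by (intro tuples_scale) auto
    then show ?thesis using that by (simp add: relations_def dot_scale_left del: scale_fun_apply)
  qed
qed

lemma relations_subset: "relations \<subseteq> tuples n"
  by (auto simp: relations_def)

text \<open>\<open>extends I\<close> means \<open>Ext^1(M, R / I) = 0\<close>, and this Ext is
  \<open>W / B\<close> below. By \<open>extends\<close> modulo \<open>I + xR\<close>, each map on
  the relations is a restriction plus \<open>x\<close> times another map, so Nakayama's lemma
  applies.\<close>

lemma extends_step:
  assumes I: "is_ideal I" and x: "x \<in> m" "\<And>z. x * z \<in> I \<Longrightarrow> z \<in> I"
    and ext: "extends (add_mult (*) I x)"
  shows "extends I"
proof -
  let ?K = relations and ?I = "add_mult (*) I x"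
  note K = subspace_relations
  obtain q :: nat and v where v: "\<forall>l<q. v l \<in> ?K"
    and gen: "\<forall>r\<in>?K. \<exists>a\<in>tuples q. r = (\<lambda>j. \<Sum>l<q. a l * v l j)"
    using noetherian_tuples_combination[OF noetherian K relations_subset] by (elim exE conjE)
  \<comment> \<open>A map on the relations is recorded by its values at the generators
    \<open>v\<close>, which turns sets of maps into submodules of \<open>R^q\<close>.\<close>
  define eval_on where "eval_on H = {d \<in> tuples q. \<exists>h\<in>H. \<forall>l<q. d l - h (v l) \<in> I}" for H
  have eval_onD: "\<exists>h\<in>H. \<forall>l<q. d l - h (v l) \<in> I" "d \<in> tuples q" if "d \<in> eval_on H" for d H
    using that by (auto simp: eval_on_def)
  have eval_onI: "d \<in> eval_on H" if "d \<in> tuples q" "h \<in> H" "\<And>l. l < q \<Longrightarrow> d l - h (v l) \<in> I" for d h H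
    using that unfolding eval_on_def by blast
  have eval_on: "F.subspace (eval_on H)"
    if zero: "(\<lambda>_. 0) \<in> H" and add: "\<And>h h'. h \<in> H \<Longrightarrow> h' \<in> H \<Longrightarrow> (\<lambda>k. h k + h' k) \<in> H"
      and scale: "\<And>r h. h \<in> H \<Longrightarrow> (\<lambda>k. r * h k) \<in> H" for H
  proof (rule F.subspaceI)
    show "0 \<in> eval_on H"
      by (rule eval_onI[OF tuples_0 zero]) (simp add: R.subspace_0[OF I])
    fix d assume d: "d \<in> eval_on H"
    then obtain h where h: "h \<in> H" "\<And>l. l < q \<Longrightarrow> d l - h (v l) \<in> I" using eval_onD by blast
    show "scale_fun (*) r d \<in> eval_on H" for r
      by (rule eval_onI[OF tuples_scale[OF eval_onD(2)[OF d]] scale[OF h(1)]])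
        (use is_ideal_mult_left[OF I h(2), of _ r] in \<open>simp add: algebra_simps\<close>)
    fix d' assume d': "d' \<in> eval_on H"
    then obtain h' where h': "h' \<in> H" "\<And>l. l < q \<Longrightarrow> d' l - h' (v l) \<in> I" using eval_onD by blast
    show "d + d' \<in> eval_on H"
      by (rule eval_onI[OF tuples_add[OF eval_onD(2)[OF d] eval_onD(2)[OF d']] add[OF h(1) h'(1)]])
        (use R.subspace_add[OF I h(2) h'(2)] in \<open>simp add: algebra_simps\<close>)
  qed
  define W where "W = eval_on (Collect (linear_mod (scale_fun (*)) I ?K))"
  define B where "B = eval_on (range (\<lambda>c k. dot (*) n k c))"
  have B: "F.subspace B"
    unfolding B_def
  proof (rule eval_on)
    show "(\<lambda>_. 0::'a) \<in> range (\<lambda>c k. dot (*) n k c)" by (rule range_eqI[of _ _ 0]) (auto simp: dot_def)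
  next
    fix h h' :: "(nat \<Rightarrow> 'a) \<Rightarrow> 'a" assume "h \<in> range (\<lambda>c k. dot (*) n k c)" "h' \<in> range (\<lambda>c k. dot (*) n k c)"
    then obtain c c' where "h = (\<lambda>k. dot (*) n k c)" "h' = (\<lambda>k. dot (*) n k c')" by blast
    then show "(\<lambda>k. h k + h' k) \<in> range (\<lambda>c k. dot (*) n k c)"
      by (intro range_eqI[of _ _ "c + c'"]) (simp add: R.dot_add_right)
  next
    fix r and h :: "(nat \<Rightarrow> 'a) \<Rightarrow> 'a" assume "h \<in> range (\<lambda>c k. dot (*) n k c)"
    then obtain c where "h = (\<lambda>k. dot (*) n k c)" by blast
    then show "(\<lambda>k. r * h k) \<in> range (\<lambda>c k. dot (*) n k c)"
      by (intro range_eqI[of _ _ "scale_fun (*) r c"]) (simp add: R.dot_scale_right del: scale_fun_apply)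
  qed
  have W: "F.subspace W"
    unfolding W_def
    by (rule eval_on) (simp_all add: linear_mod_zero linear_mod_add linear_mod_mult I)
  obtain S where S: "finite S" "S \<subseteq> W" "W \<subseteq> F.span S"
    using noetherian_tuples[OF noetherian W, of q] eval_onD(2) unfolding W_def by blast
  have "W \<subseteq> B"
  proof (rule nakayama[OF F.module_axioms S(1) B S(2) _ x(1)])
    show "W \<subseteq> F.span (S \<union> B)" using S(3) F.span_mono[of S "S \<union> B"] by blast
    fix d assume "d \<in> W"
    then obtain h where d: "d \<in> tuples q" "\<And>l. l < q \<Longrightarrow> d l - h (v l) \<in> I"
      and h: "linear_mod (scale_fun (*)) I ?K h" unfolding W_def using eval_onD by blast
    obtain c where c: "\<forall>k\<in>?K. h k - dot (*) n k c \<in> ?I"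
      using ext linear_mod_mono[OF h R.add_mult_superset] unfolding extends_def by blast
    obtain h' where h': "linear_mod (scale_fun (*)) I ?K h'"
      and xh': "\<And>k. k \<in> ?K \<Longrightarrow> (h k - dot (*) n k c) - x * h' k \<in> I"
      using linear_mod_divide[OF F.module_axioms K I x(2) linear_mod_diff[OF I h linear_mod_dot[OF I, where n = n and c = c]]] c
      by blast
    define w where "w = (\<lambda>l. if l < q then h' (v l) else 0)"
    have "w \<in> tuples q" by (simp add: w_def tuples_def)
    then have "w \<in> W" unfolding W_def
      by (rule eval_onI) (use h' R.subspace_0[OF I] in \<open>auto simp: w_def\<close>)
    moreover have "d - scale_fun (*) x w \<in> B"
    proof -
      have "d - scale_fun (*) x w \<in> tuples q"
        using tuples_diff[OF d(1) tuples_scale[OF \<open>w \<in> tuples q\<close>]] .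
      moreover have "(d - scale_fun (*) x w) l - dot (*) n (v l) c \<in> I" if l: "l < q" for l
      proof -
        have "(d l - h (v l)) + ((h (v l) - dot (*) n (v l) c) - x * h' (v l)) \<in> I"
          using d(2)[OF l] xh' v l by (intro R.subspace_add[OF I]) auto
        then show ?thesis using l by (simp add: w_def algebra_simps)
      qed
      ultimately show ?thesis unfolding B_def by (intro eval_onI[where h = "\<lambda>k. dot (*) n k c"]) auto
    qed
    moreover have "d = scale_fun (*) x w + (d - scale_fun (*) x w)" by simp
    ultimately show "\<exists>w'\<in>W. \<exists>b\<in>B. d = scale_fun (*) x w' + b" by blast
  qed
  show ?thesis
    unfolding extends_def
  proof (intro allI impI)
    fix h assume h: "linear_mod (scale_fun (*)) I ?K h"
    have "(\<lambda>l. if l < q then h (v l) else 0) \<in> W"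
      unfolding W_def by (rule eval_onI[of _ h]) (use h R.subspace_0[OF I] in \<open>auto simp: tuples_def\<close>)
    then have "(\<lambda>l. if l < q then h (v l) else 0) \<in> B" using \<open>W \<subseteq> B\<close> by blast
    then obtain c where "\<forall>l<q. (if l < q then h (v l) else 0) - dot (*) n (v l) c \<in> I"
      unfolding B_def using eval_onD(1) by blast
    then have c: "h (v l) - dot (*) n (v l) c \<in> I" if "l < q" for l using that by (metis (full_types))
    have "h k - dot (*) n k c \<in> I" if "k \<in> ?K" for k
      using linear_mod_generators[OF F.module_axioms K I linear_mod_diff[OF I h linear_mod_dot[OF I]]] v c
        gen[rule_format, OF that] by (auto simp: sum_scale_fun)
    then show "\<exists>c. \<forall>k\<in>?K. h k - dot (*) n k c \<in> I" by blast
  qed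
qed

text \<open>Values \<open>d\<close> on the generators need not respect the relations modulo
  \<open>I\<close>: there they equal \<open>x * h\<close>. By \<open>extends I\<close> the map
  \<open>h\<close> is given by a tuple \<open>c\<close>, and the values \<open>d - x c\<close> do
  respect them.\<close>

lemma lift_step:
  assumes I: "is_ideal I" and x: "\<And>z. x * z \<in> I \<Longrightarrow> z \<in> I"
    and ext: "extends I" and f: "linear_mod s (add_mult (*) I x) UNIV f"
  shows "\<exists>g. linear_mod s I UNIV g \<and> (\<forall>v. g v - f v \<in> add_mult (*) I x)"
proof -
  let ?I = "add_mult (*) I x"
  have I': "is_ideal ?I" by (rule R.subspace_add_mult[OF I])
  note K = subspace_relations
  define d where "d j = f (b j)" for j
  have fd: "f (dot s n c b) - dot (*) n c d \<in> ?I" for c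
    using linear_mod_sum[OF module_s subspace_UNIV I' f, of n b c] by (simp add: dot_def d_def)
  have f0: "f 0 \<in> ?I" by (rule linear_mod_0[OF module_s subspace_UNIV I' f])
  have "dot (*) n k d \<in> ?I" if "k \<in> relations" for k
  proof -
    have "f 0 - dot (*) n k d \<in> ?I" using fd[of k] that by (simp add: relations_def)
    from R.subspace_diff[OF I' f0 this] show ?thesis by simp
  qed
  then obtain h where h: "linear_mod (scale_fun (*)) I relations h"
    and dh: "\<And>k. k \<in> relations \<Longrightarrow> dot (*) n k d - x * h k \<in> I"
    using linear_mod_divide[OF F.module_axioms K I x linear_mod_dot[OF I, where n = n and c = d]] by blast
  obtain c where c: "\<And>k. k \<in> relations \<Longrightarrow> h k - dot (*) n k c \<in> I"
    using ext h unfolding extends_def by blast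
  define d' where "d' = d - scale_fun (*) x c"
  have dot_d': "dot (*) n a d' = dot (*) n a d - x * dot (*) n a c" for a
    by (simp add: d'_def R.dot_diff_right R.dot_scale_right)
  have d'K: "dot (*) n k d' \<in> I" if k: "k \<in> relations" for k
  proof -
    have "(dot (*) n k d - x * h k) + x * (h k - dot (*) n k c) \<in> I"
      using dh[OF k] c[OF k] by (intro R.subspace_add[OF I] is_ideal_mult_left[OF I])
    then show ?thesis by (simp add: dot_d' algebra_simps)
  qed
  obtain coord where coord: "\<And>v. coord v \<in> tuples n" "\<And>v. dot s n (coord v) b = v"
    using generators by metis
  define g where "g v = dot (*) n (coord v) d'" for v
  have g: "g v - dot (*) n a d' \<in> I" if a: "a \<in> tuples n" "dot s n a b = v" for v a
  proof -
    have "coord v - a \<in> relations"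
      using coord[of v] a tuples_diff by (auto simp: relations_def dot_diff_left)
    from d'K[OF this] show ?thesis by (simp add: g_def R.dot_diff_left)
  qed
  have "linear_mod s I UNIV g"
    unfolding linear_mod_def
  proof (intro conjI ballI allI)
    fix v w :: 'c
    have "g (v + w) - dot (*) n (coord v + coord w) d' \<in> I"
      using coord by (intro g tuples_add) (auto simp: dot_add_left)
    then show "g (v + w) - (g v + g w) \<in> I" by (simp add: g_def R.dot_add_left)
  next
    fix r and v :: 'c
    have "g (s r v) - dot (*) n (scale_fun (*) r (coord v)) d' \<in> I"
      using coord by (intro g tuples_scale) (auto simp: dot_scale_left)
    then show "g (s r v) - r * g v \<in> I" by (simp add: g_def R.dot_scale_left)
  qed
  moreover have "g v - f v \<in> ?I" for v
  proof -
    have 1: "f v - dot (*) n (coord v) d \<in> ?I" using fd[of "coord v"] coord by simp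
    have 2: "x * dot (*) n (coord v) c \<in> ?I" by (rule R.add_mult_memI[OF I])
    have "- (f v - dot (*) n (coord v) d) - x * dot (*) n (coord v) c \<in> ?I"
      by (rule R.subspace_diff[OF I' R.subspace_neg[OF I' 1] 2])
    then show ?thesis by (simp add: g_def dot_d' algebra_simps)
  qed
  ultimately show ?thesis by blast
qed

text \<open>Both claims travel together: \<open>extends\<close> is passed down from the full ideal
  to \<open>I\<close>, and each stage of the lifting uses it.\<close>

lemma lift_regular_seq:
  assumes "is_ideal I" "regular_seq (*) I xs" "set xs \<subseteq> m" "extends (add_mults (*) I xs)"
  shows "extends I \<and> (\<forall>f. linear_mod s (add_mults (*) I xs) UNIV f \<longrightarrow>
    (\<exists>g. linear_mod s I UNIV g \<and> (\<forall>v. g v - f v \<in> add_mults (*) I xs)))"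
  using assms
proof (induction xs arbitrary: I)
  case Nil
  have "\<exists>g. linear_mod s I UNIV g \<and> (\<forall>v. g v - f v \<in> I)" if "linear_mod s I UNIV f" for f
    by (rule exI[of _ f]) (use that R.subspace_0[OF Nil(1)] in simp)
  then show ?case using Nil by simp
next
  case (Cons x xs)
  let ?I = "add_mult (*) I x" and ?J = "add_mults (*) I (x # xs)"
  have I': "is_ideal ?I" by (rule R.subspace_add_mult[OF Cons.prems(1)])
  have x: "x \<in> m" "\<And>z. x * z \<in> I \<Longrightarrow> z \<in> I" using Cons.prems by auto
  have IH: "extends ?I" and lift: "\<And>f. linear_mod s ?J UNIV f \<Longrightarrow>
      \<exists>g. linear_mod s ?I UNIV g \<and> (\<forall>v. g v - f v \<in> ?J)"
    using Cons.IH[OF I'] Cons.prems by auto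
  have ext: "extends I" by (rule extends_step[OF Cons.prems(1) x IH])
  have "\<exists>g. linear_mod s I UNIV g \<and> (\<forall>v. g v - f v \<in> ?J)" if f: "linear_mod s ?J UNIV f" for f
  proof -
    obtain g where g: "linear_mod s ?I UNIV g" "\<And>v. g v - f v \<in> ?J" using lift[OF f] by blast
    obtain h where h: "linear_mod s I UNIV h" "\<And>v. h v - g v \<in> ?I"
      using lift_step[OF Cons.prems(1) x(2) ext g(1)] by blast
    have J: "is_ideal ?J" by (rule R.subspace_add_mults[OF Cons.prems(1)])
    have "h v - f v \<in> ?J" for v
    proof -
      have "h v - g v \<in> ?J" using h(2)[of v] R.add_mults_superset[of ?I xs] by auto
      from R.subspace_add[OF J this g(2)[of v]] show ?thesis by simp
    qed
    then show ?thesis using h(1) by blast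
  qed
  then show ?case using ext by blast
qed

text \<open>
  \<open>compatible I L\<close> expresses that \<open>L = IM\<close> and that \<open>K \<inter> I\<^sup>n = IK\<close>, i.e. \<open>Tor\<^sub>1(M, R/I) = 0\<close>; the
  latter in the form that homomorphisms from \<open>K\<close> into quotients of \<open>R/I\<close> vanish on \<open>K \<inter> I\<^sup>n\<close>.
\<close>

definition compatible :: "'a set \<Rightarrow> 'c set \<Rightarrow> bool"
  where "compatible I L \<longleftrightarrow> (\<forall>c\<in>tuples n. (\<forall>j. c j \<in> I) \<longrightarrow> dot s n c b \<in> L) \<and>
    (\<forall>c\<in>tuples n. dot s n c b \<in> L \<longrightarrow> (\<exists>k\<in>relations. \<forall>j. c j - k j \<in> I)) \<and>
    (\<forall>Q h. is_ideal Q \<longrightarrow> I \<subseteq> Q \<longrightarrow> linear_mod (scale_fun (*)) Q relations h \<longrightarrow>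
       (\<forall>k\<in>relations. (\<forall>j. k j \<in> I) \<longrightarrow> h k \<in> Q))"

text \<open>A relation with entries in \<open>I + xR\<close> is \<open>i + x f\<close> with
  \<open>i\<close> in \<open>I^n\<close>. Then \<open>x\<close> sends the element with coordinates
  \<open>f\<close> into \<open>L\<close>, so regularity puts that element into \<open>L\<close>, and
  \<open>f\<close> is congruent to a relation \<open>k'\<close> modulo \<open>I\<close>. Hence the
  relation is \<open>x k'\<close> up to \<open>I\<close>.\<close>

lemma compatible_step:
  assumes I: "is_ideal I" and L: "subspace L" and comp: "compatible I L"
    and reg: "\<And>v. s x v \<in> L \<Longrightarrow> v \<in> L"
  shows "compatible (add_mult (*) I x) (add_mult s L x)"
proof -
  let ?I = "add_mult (*) I x" and ?L = "add_mult s L x"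
  have c1: "dot s n c b \<in> L" if "c \<in> tuples n" "\<And>j. c j \<in> I" for c
    using comp that unfolding compatible_def by blast
  have c2: "\<exists>k\<in>relations. \<forall>j. c j - k j \<in> I" if "c \<in> tuples n" "dot s n c b \<in> L" for c
    using comp that unfolding compatible_def by blast
  have c3: "h k \<in> Q" if "is_ideal Q" "I \<subseteq> Q" "linear_mod (scale_fun (*)) Q relations h"
    "k \<in> relations" "\<And>j. k j \<in> I" for Q h k
    using comp that unfolding compatible_def by blast
  have split: "\<exists>i f. i \<in> tuples n \<and> f \<in> tuples n \<and> (\<forall>j. i j \<in> I) \<and> c = i + scale_fun (*) x f"
    if c: "c \<in> tuples n" "\<And>j. c j \<in> ?I" for c
  proof -
    have "\<forall>j. \<exists>i f. i \<in> I \<and> c j = i + x * f" using c(2) unfolding add_mult_def by blast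
    then obtain i f where if': "\<And>j. i j \<in> I" "\<And>j. c j = i j + x * f j" by metis
    define i' f' where "i' = (\<lambda>j. if j < n then i j else 0)" and "f' = (\<lambda>j. if j < n then f j else 0)"
    have "c = i' + scale_fun (*) x f'"
      using c(1) if'(2) by (auto simp: fun_eq_iff i'_def f'_def tuples_def)
    moreover have "i' \<in> tuples n" "f' \<in> tuples n" "\<forall>j. i' j \<in> I"
      using if'(1) R.subspace_0[OF I] by (auto simp: i'_def f'_def tuples_def)
    ultimately show ?thesis by blast
  qed
  show ?thesis
    unfolding compatible_def
  proof (intro conjI ballI allI impI)
    fix c :: "nat \<Rightarrow> 'a" assume c: "c \<in> tuples n" "\<forall>j. c j \<in> ?I"
    obtain i f where if': "i \<in> tuples n" "\<forall>j. i j \<in> I" "c = i + scale_fun (*) x f" using split[OF c(1)] c(2) by blast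
    have "dot s n c b = dot s n i b + s x (dot s n f b)"
      unfolding if'(3) by (simp add: dot_add_left dot_scale_left)
    then show "dot s n c b \<in> ?L" using c1[of i] if' unfolding add_mult_def by blast
  next
    fix c :: "nat \<Rightarrow> 'a" assume c: "c \<in> tuples n" "dot s n c b \<in> ?L"
    then obtain l v where lv: "l \<in> L" "dot s n c b = l + s x v" by (auto simp: add_mult_def)
    obtain f where f: "f \<in> tuples n" "v = dot s n f b" using generators by blast
    have "dot s n (c - scale_fun (*) x f) b \<in> L"
      using lv f(2) by (simp add: dot_diff_left dot_scale_left)
    moreover have "c - scale_fun (*) x f \<in> tuples n"
      by (rule tuples_diff[OF c(1) tuples_scale[OF f(1)]])
    ultimately obtain k where k: "k \<in> relations" "\<And>j. (c - scale_fun (*) x f) j - k j \<in> I" using c2 by blast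
    have "c j - k j \<in> ?I" for j
    proof -
      have "c j - k j = ((c - scale_fun (*) x f) j - k j) + x * f j" by simp
      then show ?thesis using k(2)[of j] unfolding add_mult_def by blast
    qed
    then show "\<exists>k\<in>relations. \<forall>j. c j - k j \<in> ?I" using k(1) by blast
  next
    fix Q h k assume Q: "is_ideal Q" "?I \<subseteq> Q" and h: "linear_mod (scale_fun (*)) Q relations h"
      and k: "k \<in> relations" "\<forall>j. k j \<in> ?I"
    have IQ: "I \<subseteq> Q" using Q(2) R.add_mult_superset[of I x] by blast
    have xQ: "x * z \<in> Q" for z using R.add_mult_memI[OF I, of x z] Q(2) by blast
    have kt: "k \<in> tuples n" using k(1) relations_subset by blast
    obtain i f where if': "i \<in> tuples n" "f \<in> tuples n" "\<forall>j. i j \<in> I" "k = i + scale_fun (*) x f"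
      using split[OF kt] k(2) by blast
    have "s x (dot s n f b) = - dot s n i b"
      using k(1) unfolding if'(4) by (simp add: relations_def dot_add_left dot_scale_left add_eq_0_iff)
    also have "\<dots> \<in> L" using c1[of i] if'(1,3) subspace_neg[OF L] by blast
    finally have "dot s n f b \<in> L" by (rule reg)
    then obtain k' where k': "k' \<in> relations" "\<And>j. f j - k' j \<in> I" using c2[OF if'(2)] by blast
    have xk': "scale_fun (*) x k' \<in> relations" by (rule F.subspace_scale[OF subspace_relations k'(1)])
    have "(k - scale_fun (*) x k') j \<in> I" for j
    proof -
      have "i j + x * (f j - k' j) \<in> I"
        using if'(3) k'(2) by (intro R.subspace_add[OF I] is_ideal_mult_left[OF I]) auto
      then show ?thesis by (simp add: if'(4) algebra_simps)
    qed
    then have 1: "h (k - scale_fun (*) x k') \<in> Q"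
      by (intro c3[OF Q(1) IQ h] F.subspace_diff[OF subspace_relations k(1) xk'])
    have 2: "h ((k - scale_fun (*) x k') + scale_fun (*) x k') - (h (k - scale_fun (*) x k') + h (scale_fun (*) x k')) \<in> Q"
      by (intro linear_modD(1)[OF h] xk' F.subspace_diff[OF subspace_relations k(1) xk'])
    have 3: "h (scale_fun (*) x k') - x * h k' \<in> Q" by (rule linear_modD(2)[OF h k'(1)])
    have "(h ((k - scale_fun (*) x k') + scale_fun (*) x k') - (h (k - scale_fun (*) x k') + h (scale_fun (*) x k')))
        + h (k - scale_fun (*) x k') + (h (scale_fun (*) x k') - x * h k') + x * h k' \<in> Q"
      by (intro R.subspace_add[OF Q(1)] 1 2 3 xQ)
    then show "h k \<in> Q" by simp
  qed
qed

lemma compatible_regular_seq: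
  assumes "is_ideal I" "subspace L" "compatible I L" "regular_seq s L xs"
  shows "compatible (add_mults (*) I xs) (add_mults s L xs)"
  using assms
proof (induction xs arbitrary: I L)
  case (Cons x xs)
  then show ?case
    using compatible_step[of I L x] R.subspace_add_mult[of I x] subspace_add_mult[of L x] by simp
qed simp

lemma compatible_0: "compatible {0} {0}"
  unfolding compatible_def
proof (intro conjI ballI allI impI)
  fix c :: "nat \<Rightarrow> 'a" assume "\<forall>j. c j \<in> {0}"
  then show "dot s n c b \<in> {0}" by (simp add: dot_def)
next
  fix c :: "nat \<Rightarrow> 'a" assume "c \<in> tuples n" "dot s n c b \<in> {0}"
  then show "\<exists>k\<in>relations. \<forall>j. c j - k j \<in> {0}" by (intro bexI[of _ c]) (auto simp: relations_def)
next
  fix Q :: "'a set" and h and k :: "nat \<Rightarrow> 'a"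
  assume *: "is_ideal Q" "linear_mod (scale_fun (*)) Q relations h" "\<forall>j. k j \<in> {0}"
  then have "k = 0" by (auto simp: fun_eq_iff)
  then show "h k \<in> Q" using linear_mod_0[OF F.module_axioms subspace_relations *(1,2)] by simp
qed

lemma scale_add_mults:
  assumes "\<And>a v. a \<in> I \<Longrightarrow> s a v \<in> L" "a \<in> add_mults (*) I xs"
  shows "s a v \<in> add_mults s L xs"
  using assms
proof (induction xs arbitrary: I L)
  case (Cons x xs)
  show ?case
    unfolding add_mults.simps
  proof (rule Cons.IH)
    show "a \<in> add_mults (*) (add_mult (*) I x) xs" using Cons.prems(2) by simp
    fix a v assume "a \<in> add_mult (*) I x"
    then obtain i r where ir: "i \<in> I" "a = i + x * r" by (auto simp: add_mult_def)
    then have "s a v = s i v + s x (s r v)" by (simp add: scale_left_distrib)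
    then show "s a v \<in> add_mult s L x" using Cons.prems(1)[OF ir(1)] unfolding add_mult_def by blast
  qed
qed simp

text \<open>By compatibility \<open>h\<close> vanishes modulo \<open>J\<close> on the relations with
  entries in \<open>J\<close>, so it is a map on a submodule of \<open>(R / J)^n\<close>, which
  extends by self-injectivity.\<close>

lemma extends_baer:
  fixes t :: "'a \<Rightarrow> 'b::ab_group_add \<Rightarrow> 'b"
  assumes res: "resolution t J E \<epsilon> \<delta> n'" and baer: "baer t J (range \<epsilon>)" and comp: "compatible J L"
  shows "extends J"
  unfolding extends_def
proof (intro allI impI)
  interpret E: resolution t J E \<epsilon> \<delta> n' by fact
  note J = E.ideal and K = subspace_relations
  fix h assume h: "linear_mod (scale_fun (*)) J relations h"
  obtain q :: nat and v where v: "\<forall>l<q. v l \<in> relations"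
    and gen: "\<forall>r\<in>relations. \<exists>a\<in>tuples q. r = (\<lambda>j. \<Sum>l<q. a l * v l j)"
    using noetherian_tuples_combination[OF noetherian K relations_subset] by (elim exE conjE)
  let ?L = "{z \<in> tuples n. \<forall>j. z j \<in> J}"
  have L: "F.subspace ?L"
    using tuples_0 tuples_add tuples_scale R.subspace_0[OF J] R.subspace_add[OF J]
      is_ideal_mult_left[OF J] by (intro F.subspaceI) auto
  have IL: "scale_fun (*) a z \<in> ?L" if "a \<in> J" "z \<in> tuples n" for a z
    using tuples_scale[OF that(2)] is_ideal_mult_right[OF J that(1)] by simp
  have vt: "v l \<in> tuples n" if "l < q" for l using v that relations_subset by blast
  have rel: "dot t q a (\<lambda>l. \<epsilon> (h (v l))) = 0" if a: "dot (scale_fun (*)) q a v \<in> ?L" for a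
  proof -
    have "dot (scale_fun (*)) q a v \<in> relations" by (rule F.dot_in_subspace[OF K]) (use v in simp)
    then have "h (dot (scale_fun (*)) q a v) \<in> J" using comp J h a unfolding compatible_def by blast
    moreover have "h (dot (scale_fun (*)) q a v) - (\<Sum>l<q. a l * h (v l)) \<in> J"
      unfolding dot_def by (rule linear_mod_sum[OF F.module_axioms K J h]) (use v in blast)
    ultimately have "(\<Sum>l<q. a l * h (v l)) \<in> J" using R.subspace_diff[OF J] by fastforce
    then have "\<epsilon> (dot (*) q a (\<lambda>l. h (v l))) = 0" by (simp add: dot_def E.ker_eps)
    then show ?thesis
      using linear_map_on_dot[OF R.module_axioms E.module_t R.subspace_UNIV E.eps, of q "\<lambda>l. h (v l)" a] by simp
  qed
  obtain H where H: "linear_map_on (scale_fun (*)) t (tuples n) (range \<epsilon>) H"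
    and Hv: "\<And>l. l < q \<Longrightarrow> H (v l) = \<epsilon> (h (v l))"
    by (rule baer_extend_family[where v = v and h = "\<lambda>l. \<epsilon> (h (v l))" and k = q,
          OF F.module_axioms E.module_t subspace_tuples L _ E.range_eps_subspace baer])
      (use IL vt rel in blast)+
  have "\<forall>j\<in>{..<n}. \<exists>c. H (unit_tuple j) = \<epsilon> c"
  proof
    fix j assume "j \<in> {..<n}"
    then have "H (unit_tuple j) \<in> range \<epsilon>" by (intro linear_map_onD(1)[OF H]) (simp add: tuples_def unit_tuple_def)
    then show "\<exists>c. H (unit_tuple j) = \<epsilon> c" by blast
  qed
  then obtain c where c: "\<And>j. j < n \<Longrightarrow> H (unit_tuple j) = \<epsilon> (c j)" by (metis lessThan_iff)
  have "h (v l) - dot (*) n (v l) c \<in> J" if l: "l < q" for l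
  proof -
    have "\<epsilon> (h (v l)) = dot t n (v l) (\<lambda>j. H (unit_tuple j))"
      using Hv[OF l] linear_map_on_tuples[OF E.module_t H vt[OF l]] by simp
    also have "\<dots> = dot t n (v l) (\<lambda>j. \<epsilon> (c j))" using c by (simp add: dot_def)
    also have "\<dots> = \<epsilon> (dot (*) n (v l) c)"
      by (rule linear_map_on_dot[OF R.module_axioms E.module_t R.subspace_UNIV E.eps UNIV_I, symmetric])
    finally show ?thesis unfolding E.eps_eq_iff .
  qed
  then have "h k - dot (*) n k c \<in> J" if "k \<in> relations" for k
    using linear_mod_generators[OF F.module_axioms K J linear_mod_diff[OF J h linear_mod_dot[OF J]]] v
      gen[rule_format, OF that] by (auto simp: sum_scale_fun)
  then show "\<exists>c. \<forall>k\<in>relations. h k - dot (*) n k c \<in> J" by blast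
qed

text \<open>Multipliers taking \<open>y\<close> into \<open>L\<close> lie in \<open>m\<close> and
  hence kill \<open>u\<close> modulo \<open>J\<close>. So \<open>y -> u\<close> is well defined on
  the cyclic module generated by \<open>y\<close> modulo \<open>L\<close>, and self-injectivity
  extends it.\<close>

lemma ex_map_mod:
  fixes t :: "'a \<Rightarrow> 'b::ab_group_add \<Rightarrow> 'b"
  assumes res: "resolution t J E \<epsilon> \<delta> n'" and baer: "baer t J (range \<epsilon>)"
    and L: "subspace L" and JL: "\<And>a v. a \<in> J \<Longrightarrow> s a v \<in> L"
    and u: "\<And>a. a \<in> m \<Longrightarrow> a * u \<in> J" and y: "y \<notin> L"
  shows "\<exists>f. linear_mod s J UNIV f \<and> f y - u \<in> J"
proof -
  interpret E: resolution t J E \<epsilon> \<delta> n' by fact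
  note J = E.ideal
  have colon: "r \<in> m" if "s r y \<in> L" for r
  proof (rule ccontr)
    assume "r \<notin> m"
    then obtain c where "c * r = 1" using unit_if_notin_m by blast
    then have "s c (s r y) = y" by simp
    then show False using subspace_scale[OF L that, of c] y by simp
  qed
  have "t r (\<epsilon> u) = 0" if "s r y \<in> L" for r
    using u[OF colon[OF that]] E.ker_eps by (simp flip: E.eps_mult)
  then obtain H where H: "linear_map_on s t UNIV (range \<epsilon>) H" "H y = \<epsilon> u"
    using baer_extend_cyclic[OF module_s E.module_t L E.range_eps_subspace baer JL rangeI] by blast
  have "\<forall>v. \<exists>z. H v = \<epsilon> z" using linear_map_onD(1)[OF H(1)] by blast
  then obtain g where g: "\<And>v. H v = \<epsilon> (g v)" by metis
  have "linear_mod s J UNIV g"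
    unfolding linear_mod_def
  proof (intro conjI ballI allI)
    fix v w show "g (v + w) - (g v + g w) \<in> J"
      using linear_map_onD(2)[OF H(1), of v w] by (simp add: g flip: E.eps_add E.eps_eq_iff)
    fix r show "g (s r v) - r * g v \<in> J"
      using linear_map_onD(3)[OF H(1), of v r] by (simp add: g flip: E.eps_mult E.eps_eq_iff)
  qed
  moreover have "g y - u \<in> J" using H(2) by (simp add: g E.eps_eq_iff)
  ultimately show ?thesis by blast
qed

theorem ex_separating_map:
  fixes t :: "'a \<Rightarrow> 'b::ab_group_add \<Rightarrow> 'b"
  assumes res: "resolution t {0} E \<epsilon> \<delta> n'"
    and xs: "set xs \<subseteq> m" "regular_seq (*) {0} xs" "regular_seq s {0} xs"
    and u: "u \<notin> add_mults (*) {0} xs" "\<And>a. a \<in> m \<Longrightarrow> a * u \<in> add_mults (*) {0} xs"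
    and y: "y \<notin> add_mults s {0} xs"
  shows "\<exists>\<phi>. module_hom s (*) \<phi> \<and> \<phi> y \<notin> add_mults (*) {0} xs"
proof -
  let ?J = "add_mults (*) {0} xs" and ?L = "add_mults s {0} xs"
  obtain E' \<epsilon>' \<delta>' where res': "resolution t ?J E' \<epsilon>' \<delta>' n'"
    using resolution_add_mults[OF res xs(2)] by blast
  interpret E: resolution t ?J E' \<epsilon>' \<delta>' n' by (rule res')
  interpret E: noetherian_resolution t ?J E' \<epsilon>' \<delta>' n' m by unfold_locales
  have baer: "baer t ?J (range \<epsilon>')" by (rule E.baer_range_eps[OF u])
  have "compatible ?J ?L"
    by (rule compatible_regular_seq[OF R.subspace_single_0 subspace_single_0 compatible_0 xs(3)])
  then have ext: "extends ?J" by (rule extends_baer[OF res' baer])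
  have L: "subspace ?L" by (rule subspace_add_mults) simp
  have "s a v \<in> ?L" if "a \<in> ?J" for a v by (rule scale_add_mults[OF _ that]) simp
  then obtain f where f: "linear_mod s ?J UNIV f" "f y - u \<in> ?J"
    using ex_map_mod[OF res' baer L _ u(2) y] by blast
  obtain \<phi> where phi: "linear_mod s {0} UNIV \<phi>" "\<And>v. \<phi> v - f v \<in> ?J"
    using lift_regular_seq[OF R.subspace_single_0 xs(2,1) ext] f(1) by blast
  have "module_hom s (*) \<phi>"
    using phi(1) by (intro module_hom.intro module_hom_axioms.intro module_s R.module_axioms)
      (simp_all add: linear_mod_def)
  moreover have "\<phi> y \<notin> ?J"
  proof
    assume "\<phi> y \<in> ?J"
    then have "\<phi> y - (\<phi> y - f y) - (f y - u) \<in> ?J"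
      using phi(2)[of y] f(2) R.subspace_diff[OF E.ideal] by blast
    then show False using u(1) by simp
  qed
  ultimately show ?thesis by blast
qed

end

section \<open>Splittings of iterated Frobenius\<close>

locale frobenius_local = noetherian_local m for m :: "'a::comm_ring_1 set" +
  fixes p :: nat
  assumes prime: "prime p" and char: "CHAR('a) = p"
    and F_finite: "F_finite TYPE('a)" and F_pure: "F_pure TYPE('a)"
begin

lemma frob_eq: "frob e r x = r ^ (p ^ e) * x" for r x :: 'a
  by (simp add: frob_def char)

lemma power_p_add: "(x + y) ^ p = x ^ p + y ^ p" for x y :: 'a
  by (rule freshmans_dream) (simp_all add: prime char)

lemma power_p_power_add: "(x + y) ^ (p ^ e) = x ^ (p ^ e) + y ^ (p ^ e)" for x y :: 'a
  by (rule freshmans_dream') (simp_all add: prime char)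

text \<open>The linear maps \<open>F^e_* R -> R\<close>, also known as \<open>p^(-e)\<close>-linear
  maps. Written on the set \<open>R\<close> they can be composed, and the exponents add.\<close>

definition frob_hom :: "nat \<Rightarrow> ('a \<Rightarrow> 'a) \<Rightarrow> bool"
  where "frob_hom e \<phi> \<longleftrightarrow> (\<forall>x y. \<phi> (x + y) = \<phi> x + \<phi> y) \<and> (\<forall>r x. \<phi> (r ^ (p ^ e) * x) = r * \<phi> x)"

lemma module_frob_p: "Modules.module (frob e :: 'a \<Rightarrow> 'a \<Rightarrow> 'a)"
  by (rule module_frob) (simp add: prime char)

lemma p_pos: "p > 0"
  using prime by (rule prime_gt_0_nat)

lemma module_hom_frob_iff: "module_hom (frob e) (*) \<phi> \<longleftrightarrow> frob_hom e \<phi>"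
proof
  assume "module_hom (frob e) (*) \<phi>"
  then interpret module_hom "frob e" "(*)" \<phi> .
  show "frob_hom e \<phi>" using add scale by (simp add: frob_hom_def frob_eq)
next
  assume "frob_hom e \<phi>"
  then show "module_hom (frob e) (*) \<phi>"
    by (intro module_hom.intro module_hom_axioms.intro module_frob_p R.module_axioms)
      (simp_all add: frob_hom_def frob_eq)
qed

lemma frob_hom_add: "frob_hom e \<phi> \<Longrightarrow> \<phi> (x + y) = \<phi> x + \<phi> y"
  and frob_hom_scale: "frob_hom e \<phi> \<Longrightarrow> \<phi> (r ^ (p ^ e) * x) = r * \<phi> x"
  by (simp_all add: frob_hom_def)

lemma frob_hom_0: "frob_hom e \<phi> \<Longrightarrow> \<phi> 0 = 0"
  using frob_hom_add[of e \<phi> 0 0] by simp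

lemma frob_hom_mult_right: "frob_hom e \<phi> \<Longrightarrow> frob_hom e (\<lambda>z. \<phi> (a * z))"
  unfolding frob_hom_def by (simp add: distrib_left mult.left_commute[of a])

lemma frob_hom_mult_left: "frob_hom e \<phi> \<Longrightarrow> frob_hom e (\<lambda>z. a * \<phi> z)"
  unfolding frob_hom_def by (simp add: distrib_left mult.left_commute[of a])

lemma frob_hom_comp: "frob_hom e \<phi> \<Longrightarrow> frob_hom e' \<psi> \<Longrightarrow> frob_hom (e + e') (\<phi> \<circ> \<psi>)"
  unfolding frob_hom_def by (simp add: power_add power_mult)

lemma frob_hom_id: "frob_hom 0 id"
  by (simp add: frob_hom_def)

lemma frob_hom_funpow:
  assumes "frob_hom 1 \<phi>" "\<phi> 1 = 1"
  shows "frob_hom k (\<phi> ^^ k) \<and> (\<phi> ^^ k) 1 = 1"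
proof (induction k)
  case (Suc k)
  then have "frob_hom (1 + k) (\<phi> \<circ> \<phi> ^^ k)" by (intro frob_hom_comp assms(1)) simp
  then show ?case using Suc assms(2) by (simp add: comp_def)
qed (simp add: frob_hom_id[unfolded id_def] id_def)

lemma splits_frob_iff: "splits (*) (frob e) (\<lambda>r. frob e r x) \<longleftrightarrow> (\<exists>\<phi>. frob_hom e \<phi> \<and> \<phi> x = 1)"
proof
  assume "splits (*) (frob e) (\<lambda>r. frob e r x)"
  then obtain \<phi> where phi: "frob_hom e \<phi>" "\<phi> \<circ> (\<lambda>r. frob e r x) = id"
    unfolding splits_def module_hom_frob_iff by blast
  from fun_cong[OF phi(2), of 1] have "\<phi> x = 1" by (simp add: frob_eq)
  then show "\<exists>\<phi>. frob_hom e \<phi> \<and> \<phi> x = 1" using phi(1) by blast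
next
  assume "\<exists>\<phi>. frob_hom e \<phi> \<and> \<phi> x = 1"
  then obtain \<phi> where phi: "frob_hom e \<phi>" "\<phi> x = 1" by blast
  then have "\<phi> \<circ> (\<lambda>r. frob e r x) = id" by (simp add: fun_eq_iff frob_eq frob_hom_scale)
  then show "splits (*) (frob e) (\<lambda>r. frob e r x)"
    unfolding splits_def module_hom_frob_iff using phi(1) by blast
qed

text \<open>A value outside \<open>m\<close> is a unit, and rescaling by its inverse turns the map
  into a splitting.\<close>

lemma splitting_ideal_iff: "(x::'a) \<in> splitting_ideal e \<longleftrightarrow> (\<forall>\<phi>. frob_hom e \<phi> \<longrightarrow> \<phi> x \<in> m)"
proof -
  have "\<exists>\<psi>. frob_hom e \<psi> \<and> \<psi> x = 1" if phi: "frob_hom e \<phi>" "\<phi> x \<notin> m" for \<phi>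
  proof -
    obtain y where "y * \<phi> x = 1" using unit_if_notin_m[OF phi(2)] .
    then show ?thesis using frob_hom_mult_left[OF phi(1), of y] by blast
  qed
  then show ?thesis
    unfolding splitting_ideal_def splits_frob_iff mem_Collect_eq using one_notin_m by metis
qed

text \<open>A splitting of \<open>F^k\<close> is pulled back along \<open>x -> x^(p^(k-1))\<close>
  from \<open>F_* R\<close> to \<open>F^k_* R\<close>, which gives a splitting of \<open>F\<close>;
  its iterates split every \<open>F^e\<close>.\<close>

lemma ex_frob_splitting: "\<exists>\<phi>. frob_hom e \<phi> \<and> \<phi> 1 = 1"
proof -
  obtain k \<psi> where psi: "k \<ge> 1" "frob_hom k \<psi>" "\<psi> 1 = 1"
    using F_pure unfolding F_pure_def splits_frob_iff by blast
  have "p * p ^ (k - 1) = p ^ k" using psi(1) by (cases k) auto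
  then have "(r ^ p) ^ (p ^ (k - 1)) = r ^ (p ^ k)" for r :: 'a by (simp flip: power_mult)
  then have "frob_hom 1 (\<lambda>x. \<psi> (x ^ (p ^ (k - 1))))"
    using psi(2) unfolding frob_hom_def
    by (simp add: power_p_power_add power_mult_distrib)
  then show ?thesis using frob_hom_funpow[of "\<lambda>x. \<psi> (x ^ (p ^ (k - 1)))" e] psi(3) by auto
qed

lemma splitting_ideal_subset: "splitting_ideal e \<subseteq> m"
proof
  fix x :: 'a assume x: "x \<in> splitting_ideal e"
  show "x \<in> m"
  proof (rule ccontr)
    assume "x \<notin> m"
    then obtain y where y: "y * x = 1" using unit_if_notin_m by blast
    obtain \<phi> where phi: "frob_hom e \<phi>" "\<phi> 1 = 1" using ex_frob_splitting by blast
    have "\<phi> (y * x) \<in> m" using x frob_hom_mult_right[OF phi(1), of y] unfolding splitting_ideal_iff by blast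
    then show False using y phi(2) one_notin_m by simp
  qed
qed

lemma splitting_ideal_eq_iff:
  "splitting_ideal e = m \<longleftrightarrow> (\<forall>\<phi> x. frob_hom e \<phi> \<longrightarrow> x \<in> m \<longrightarrow> \<phi> x \<in> m)"
  using splitting_ideal_subset[of e] splitting_ideal_iff[of _ e] by blast

lemma splitting_prime_eq_iff: "splitting_prime = m \<longleftrightarrow> (\<forall>e\<ge>1. splitting_ideal e = m)"
proof
  assume *: "splitting_prime = m"
  have "m \<subseteq> splitting_ideal e" if "e \<ge> 1" for e
    using that by (auto simp: splitting_prime_def simp flip: *)
  then show "\<forall>e\<ge>1. splitting_ideal e = m" using splitting_ideal_subset by blast
qed (auto simp: splitting_prime_def)

text \<open>
  If \<open>\<phi> x = 1\<close> with \<open>x\<close> in \<open>m\<close> then \<open>\<psi> = \<phi>(x \<cdot> _)\<close> splits Frobenius, and \<open>\<psi>\<^sup>e\<^sup>-\<^sup>1 \<circ> \<phi>\<close> sends \<open>x\<close> to \<open>1\<close>.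
\<close>

lemma splitting_ideal_1:
  assumes "e \<ge> 1" "splitting_ideal e = m"
  shows "splitting_ideal 1 = m"
proof (rule ccontr)
  assume "splitting_ideal 1 \<noteq> m"
  then obtain x where x: "x \<in> m" "x \<notin> splitting_ideal 1" using splitting_ideal_subset by blast
  then obtain \<phi> where phi: "frob_hom 1 \<phi>" "\<phi> x = 1"
    unfolding splitting_ideal_def splits_frob_iff by blast
  define \<psi> where "\<psi> = (\<lambda>z. \<phi> (x * z))"
  have "frob_hom 1 \<psi>" unfolding \<psi>_def by (rule frob_hom_mult_right[OF phi(1)])
  then have "frob_hom (e - 1) (\<psi> ^^ (e - 1))" "(\<psi> ^^ (e - 1)) 1 = 1"
    using frob_hom_funpow[of \<psi>] phi(2) by (simp_all add: \<psi>_def)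
  then have "frob_hom e ((\<psi> ^^ (e - 1)) \<circ> \<phi>)" "((\<psi> ^^ (e - 1)) \<circ> \<phi>) x = 1"
    using frob_hom_comp[OF _ phi(1), of "e - 1"] assms(1) phi(2) by auto
  then show False using assms(2) x(1) one_notin_m unfolding splitting_ideal_eq_iff by metis
qed

text \<open>\<open>r^(p^k)\<close> is the \<open>p\<close>-th power of \<open>r^(p^(k-1))\<close>,
  so generators for exponent \<open>k\<close> also serve for exponent 1. If the \<open>c\<close>
  generate \<open>F^e_* R\<close> and the \<open>b\<close> generate \<open>F_* R\<close>, then the
  products \<open>c^p * b\<close> generate for exponent \<open>e + 1\<close>.\<close>

lemma frob_fg: "\<exists>B::'a set. finite B \<and> module.span (frob e) B = UNIV"
proof -
  obtain k and B :: "'a set" where B: "k \<ge> 1" "finite B" "module.span (frob k) B = UNIV"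
    using F_finite unfolding F_finite_def by blast
  have "p ^ (k - 1) * p = p ^ k" using B(1) by (cases k) auto
  then have frob_k: "frob k r x = frob 1 (r ^ (p ^ (k - 1))) x" for r x :: 'a
    by (simp add: frob_eq flip: power_mult)
  have rep: "\<exists>u. x = (\<Sum>b\<in>B. frob 1 (u b) b)" for x
  proof -
    interpret K: Modules.module "frob k :: 'a \<Rightarrow> 'a \<Rightarrow> 'a" by (rule module_frob_p)
    obtain u where "x = (\<Sum>b\<in>B. frob k (u b) b)" using B(3) K.span_finite[OF B(2)] by blast
    then show ?thesis by (auto simp: frob_k)
  qed
  show ?thesis
  proof (induction e)
    case 0
    interpret K: Modules.module "frob 0 :: 'a \<Rightarrow> 'a \<Rightarrow> 'a" by (rule module_frob_p)
    have "x \<in> K.span {1}" for x using K.span_scale[OF K.span_base, of 1 "{1}" x] by (simp add: frob_eq)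
    then show ?case by (intro exI[of _ "{1}"]) auto
  next
    case (Suc e)
    then obtain C :: "'a set" where C: "finite C" "module.span (frob e) C = UNIV" by blast
    interpret K: Modules.module "frob e :: 'a \<Rightarrow> 'a \<Rightarrow> 'a" by (rule module_frob_p)
    interpret K': Modules.module "frob (Suc e) :: 'a \<Rightarrow> 'a \<Rightarrow> 'a" by (rule module_frob_p)
    let ?D = "(\<lambda>(c, b). c ^ p * b) ` (C \<times> B)"
    have "r ^ p * b \<in> K'.span ?D" if b: "b \<in> B" for r b
    proof -
      have "K.span C \<subseteq> {r. r ^ p * b \<in> K'.span ?D}"
      proof (rule K.span_minimal)
        show "C \<subseteq> {r. r ^ p * b \<in> K'.span ?D}" using b by (auto intro!: K'.span_base)
        show "K.subspace {r. r ^ p * b \<in> K'.span ?D}"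
        proof (rule K.subspaceI)
          show "0 \<in> {r. r ^ p * b \<in> K'.span ?D}" using p_pos K'.span_zero by (simp add: zero_power)
          fix r assume r: "r \<in> {r. r ^ p * b \<in> K'.span ?D}"
          have "frob e c r ^ p * b = frob (Suc e) c (r ^ p * b)" for c :: 'a
            by (simp add: frob_eq power_mult_distrib power_mult[symmetric] mult.commute[of _ p] mult.assoc)
          then show "frob e c r \<in> {r. r ^ p * b \<in> K'.span ?D}" for c using r K'.span_scale by simp
          fix s assume s: "s \<in> {r. r ^ p * b \<in> K'.span ?D}"
          then show "r + s \<in> {r. r ^ p * b \<in> K'.span ?D}"
            using r K'.span_add by (simp add: power_p_add distrib_right)
        qed
      qed
      then show ?thesis using C(2) by auto
    qed
    then have "frob 1 r b \<in> K'.span ?D" if "b \<in> B" for r b using that by (simp add: frob_eq)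
    then have "x \<in> K'.span ?D" for x using rep[of x] by (auto intro: K'.span_sum)
    then show ?case using C(1) B(2) by (intro exI[of _ ?D]) auto
  qed
qed

lemma ex_fg_module: "\<exists>n b. fg_module m (frob 1) n b"
proof -
  interpret K: Modules.module "frob 1 :: 'a \<Rightarrow> 'a \<Rightarrow> 'a" by (rule module_frob_p)
  obtain B :: "'a set" where B: "finite B" "K.span B = UNIV" using frob_fg[of 1] by blast
  obtain n :: nat and b where b: "\<forall>x\<in>K.span B. \<exists>a. x = (\<Sum>l<n. frob 1 (a l) (b l))"
    using K.finite_span_tuple[OF B(1)] by (elim exE conjE)
  have "\<exists>c\<in>tuples n. v = dot (frob 1) n c b" for v
  proof -
    obtain a where a: "v = (\<Sum>l<n. frob 1 (a l) (b l))" using b B(2) by blast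
    show ?thesis
      by (rule bexI[of _ "\<lambda>l. if l < n then a l else 0"]) (auto simp: a dot_def tuples_def intro!: sum.cong)
  qed
  then have "fg_module m (frob 1) n b" by unfold_locales
  then show ?thesis by blast
qed

section \<open>Regular sequences and Frobenius powers of ideals\<close>

lemma add_mult_frob: "add_mult (frob 1) L (x::'a) = add_mult (*) L (x ^ p)"
  unfolding add_mult_def frob_eq by simp

lemma add_mults_frob: "add_mults (frob 1) L (xs::'a list) = add_mults (*) L (map (\<lambda>x. x ^ p) xs)"
  by (induction xs arbitrary: L) (simp_all add: add_mult_frob del: One_nat_def)

lemma regular_seq_frob: "regular_seq (frob 1) L (xs::'a list) \<longleftrightarrow> regular_seq (*) L (map (\<lambda>x. x ^ p) xs)"
  by (induction xs arbitrary: L) (simp_all add: add_mult_frob frob_eq del: One_nat_def)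

text \<open>As \<open>\<phi>\<close> takes \<open>x^q v\<close> to \<open>x * \<phi> v\<close>, it
  maps the Frobenius power of the ideal back into the ideal.\<close>

lemma frob_hom_add_mults:
  assumes phi: "frob_hom e \<phi>" and "\<And>z. z \<in> L' \<Longrightarrow> \<phi> z \<in> L"
    and "z \<in> add_mults (*) L' (map (\<lambda>x. x ^ (p ^ e)) xs)"
  shows "\<phi> z \<in> add_mults (*) L xs"
  using assms(2,3)
proof (induction xs arbitrary: L L')
  case (Cons x xs)
  have "\<phi> z \<in> add_mult (*) L x" if "z \<in> add_mult (*) L' (x ^ (p ^ e))" for z
  proof -
    obtain l v where lv: "l \<in> L'" "z = l + x ^ (p ^ e) * v" using \<open>z \<in> _\<close> by (auto simp: add_mult_def)
    then have "\<phi> z = \<phi> l + x * \<phi> v" using frob_hom_add[OF phi] frob_hom_scale[OF phi] by simp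
    then show ?thesis using Cons.prems(1)[OF lv(1)] unfolding add_mult_def by blast
  qed
  then show ?case using Cons.IH[of "add_mult (*) L' (x ^ (p ^ e))"] Cons.prems(2) by simp
qed simp

text \<open>
  Let \<open>J\<close> be generated by a maximal regular sequence and let \<open>u\<close> represent a socle element of \<open>R / J\<close>.
  If \<open>a u\<^sup>p\<close> with \<open>a\<close> in \<open>m\<close> were not in \<open>J\<^sup>[\<^sup>p\<^sup>]\<close>, a separating map \<open>\<phi>\<close> would give \<open>\<phi>(a u\<^sup>p) = u \<phi>(a)\<close> outside \<open>J\<close>,
  contradicting \<open>\<phi>(a) \<in> m\<close>. Hence \<open>u\<^sup>p\<close> is a socle element modulo \<open>J\<^sup>[\<^sup>p\<^sup>]\<close>, and so on for all powers of \<open>p\<close>.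
\<close>

theorem splitting_ideal_all:
  assumes gor: "gorenstein TYPE('b::ab_group_add) TYPE('a)" and I1: "splitting_ideal 1 = m"
  shows "splitting_ideal e = m"
proof -
  obtain t :: "'a \<Rightarrow> 'b \<Rightarrow> 'b" and E \<epsilon> \<delta> n' where res: "resolution t {0} E \<epsilon> \<delta> n'"
    using gorenstein_resolution[OF gor] by blast
  obtain xs u where xs: "set xs \<subseteq> m" "regular_seq (*) {0} xs"
    and u: "u \<notin> add_mults (*) {0} xs" "\<And>a. a \<in> m \<Longrightarrow> a * u \<in> add_mults (*) {0} xs"
    using ex_maximal_regular_seq by blast
  obtain n b where fg: "fg_module m (frob 1) n b" using ex_fg_module by blast
  define J where "J e = add_mults (*) {0} (map (\<lambda>x. x ^ (p ^ e)) xs)" for e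
  have J0: "J 0 = add_mults (*) {0} xs" by (simp add: J_def)
  have phi_J: "\<phi> z \<in> J 0" if "frob_hom e \<phi>" "z \<in> J e" for \<phi> z e
    unfolding J0 by (rule frob_hom_add_mults[OF that(1) _ that(2)[unfolded J_def]])
      (use frob_hom_0[OF that(1)] in auto)
  \<comment> \<open>F-purity: a splitting of \<open>F^e\<close> sends \<open>u^q\<close> to
    \<open>u\<close>, but \<open>J e\<close> into \<open>J 0\<close>.\<close>
  have notin: "u ^ (p ^ e) \<notin> J e" for e
  proof
    assume *: "u ^ (p ^ e) \<in> J e"
    obtain \<phi> where phi: "frob_hom e \<phi>" "\<phi> 1 = 1" using ex_frob_splitting by blast
    have "\<phi> (u ^ (p ^ e) * 1) = u * \<phi> 1" by (rule frob_hom_scale[OF phi(1)])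
    then show False using phi_J[OF phi(1) *] phi(2) u(1) by (simp add: J0)
  qed
  have idJ: "is_ideal (J e)" for e unfolding J_def by (rule R.subspace_add_mults) simp
  have socle: "\<forall>a\<in>m. a * u ^ (p ^ e) \<in> J e" for e
  proof (induction e)
    case 0 then show ?case using u(2) by (simp add: J0)
  next
    case (Suc e)
    let ?ys = "map (\<lambda>x. x ^ (p ^ e)) xs"
    have pow: "map (\<lambda>x. x ^ p) ?ys = map (\<lambda>x. x ^ (p ^ Suc e)) xs"
      by (simp flip: power_mult add: mult.commute)
    interpret M: fg_module m "frob 1 :: 'a \<Rightarrow> 'a \<Rightarrow> 'a" n b by (rule fg)
    show ?case
    proof (rule ballI, rule ccontr)
      fix a assume a: "a \<in> m" and notin': "a * u ^ (p ^ Suc e) \<notin> J (Suc e)"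
      have "\<exists>\<phi>. module_hom (frob 1) (*) \<phi> \<and> \<phi> (a * u ^ (p ^ Suc e)) \<notin> add_mults (*) {0} ?ys"
      proof (rule M.ex_separating_map[OF res])
        show "set ?ys \<subseteq> m"
        proof -
          have "x ^ (p ^ e) \<in> m" if "x \<in> m" for x
          proof -
            have "p ^ e = Suc (p ^ e - 1)" using p_pos by simp
            then have "x ^ (p ^ e) = x * x ^ (p ^ e - 1)" by (metis power_Suc)
            then show ?thesis using is_ideal_mult_right[OF is_ideal_m that] by simp
          qed
          then show ?thesis using xs(1) by auto
        qed
        show "regular_seq (*) {0} ?ys" by (rule regular_seq_powers[OF _ xs(2)]) (simp_all add: p_pos)
        show "regular_seq (frob 1) {0} ?ys"
          unfolding regular_seq_frob pow by (rule regular_seq_powers[OF _ xs(2)]) (simp_all add: p_pos)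
        show "u ^ (p ^ e) \<notin> add_mults (*) {0} ?ys" using notin[of e] by (simp add: J_def)
        show "a * u ^ (p ^ e) \<in> add_mults (*) {0} ?ys" if "a \<in> m" for a using Suc that by (simp add: J_def)
        show "a * u ^ (p ^ Suc e) \<notin> add_mults (frob 1) {0} ?ys"
          unfolding add_mults_frob pow using notin' by (simp add: J_def)
      qed
      then obtain \<phi> where phi: "frob_hom 1 \<phi>" "\<phi> (a * u ^ (p ^ Suc e)) \<notin> J e"
        unfolding module_hom_frob_iff J_def by blast
      have "a * u ^ (p ^ Suc e) = (u ^ (p ^ e)) ^ (p ^ 1) * a"
        by (simp add: mult.commute flip: power_mult)
      then have "\<phi> (a * u ^ (p ^ Suc e)) = \<phi> a * u ^ (p ^ e)"
        using frob_hom_scale[OF phi(1)] by (simp add: mult.commute)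
      moreover have "\<phi> a \<in> m" using I1 phi(1) a unfolding splitting_ideal_eq_iff by blast
      ultimately show False using Suc phi(2) by simp
    qed
  qed
  show ?thesis
  proof (rule ccontr)
    assume "splitting_ideal e \<noteq> m"
    then obtain a where a: "a \<in> m" "a \<notin> splitting_ideal e" using splitting_ideal_subset by blast
    then obtain \<phi> where phi: "frob_hom e \<phi>" "\<phi> a = 1"
      unfolding splitting_ideal_def splits_frob_iff by blast
    have phi_u: "\<phi> (u ^ (p ^ e) * a) = u" using frob_hom_scale[OF phi(1)] phi(2) by simp
    have "u ^ (p ^ e) * a \<in> J e" using socle[of e] a(1) by (simp add: mult.commute)
    from phi_J[OF phi(1) this] show False using u(1) by (simp add: phi_u J0)
  qed
qed

end

section \<open>Splitting numbers\<close>

lemma (in Modules.module) independent_image_family: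
  assumes "finite B" and zero: "\<And>u. (\<Sum>b\<in>B. scale (u b) (f b)) = 0 \<Longrightarrow> \<forall>b\<in>B. u b = 0" and "(1::'a) \<noteq> 0"
  shows "inj_on f B" "independent (f ` B)"
proof -
  show inj: "inj_on f B"
  proof (rule inj_onI, rule ccontr)
    fix b c assume bc: "b \<in> B" "c \<in> B" "f b = f c" "b \<noteq> c"
    let ?u = "\<lambda>x. if x = b then 1 else if x = c then -1 else (0::'a)"
    have "(\<Sum>x\<in>B. scale (?u x) (f x)) = (\<Sum>x\<in>{b, c}. scale (?u x) (f x))"
      using \<open>finite B\<close> bc(1,2) by (intro sum.mono_neutral_right) auto
    also have "\<dots> = 0" using bc(3,4) by simp
    finally have "?u b = 0" using zero[of ?u] bc(1) by blast
    then show False using \<open>(1::'a) \<noteq> 0\<close> by simp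
  qed
  show "independent (f ` B)"
  proof
    assume "dependent (f ` B)"
    then obtain u v where u: "(\<Sum>x\<in>f ` B. scale (u x) x) = 0" "v \<in> f ` B" "u v \<noteq> 0"
      using dependent_finite[of "f ` B"] \<open>finite B\<close> by auto
    have "(\<Sum>b\<in>B. scale (u (f b)) (f b)) = 0" using u(1) by (simp add: sum.reindex[OF inj])
    then show False using zero[of "\<lambda>b. u (f b)"] u(2,3) by auto
  qed
qed

lemma (in Modules.module) independent_familyD:
  assumes "finite B" "inj_on f B" "independent (f ` B)" "(\<Sum>b\<in>B. scale (u b) (f b)) = 0" "b \<in> B"
  shows "u b = 0"
proof -
  let ?v = "\<lambda>y. u (inv_into B f y)"
  have "(\<Sum>y\<in>f ` B. scale (?v y) y) = (\<Sum>b\<in>B. scale (u b) (f b))"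
    using assms(2) by (simp add: sum.reindex inv_into_f_f cong: sum.cong)
  then have "?v (f b) = 0"
    using independentD[OF assms(3) finite_imageI[OF assms(1)] order_refl, of ?v "f b"] assms(4,5) by simp
  then show ?thesis using assms(2,5) by (simp add: inv_into_f_f)
qed

lemma (in vector_space) independent_if_card_le_dim:
  assumes "finite B" "V \<subseteq> span B" "B \<subseteq> V" "card B \<le> dim V"
  shows "independent B"
proof -
  obtain C where C: "C \<subseteq> B" "independent C" "B \<subseteq> span C" using maximal_independent_subset[of B] by blast
  have "V \<subseteq> span C" using assms(2) C(3) span_minimal[OF C(3) subspace_span] by blast
  then have "card C = dim V" using C(1,2) assms(3) by (intro basis_card_eq_dim) auto
  then have "C = B" using assms(1,4) C(1) by (intro card_subset_eq) (auto dest: card_mono)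
  then show ?thesis using C(2) by simp
qed

definition scale_dual :: "'k::field \<Rightarrow> ('i \<Rightarrow> 'k) \<Rightarrow> 'i \<Rightarrow> 'k"
  where "scale_dual c f = (\<lambda>i. c * f i)"

interpretation D: vector_space "scale_dual :: 'k::field \<Rightarrow> ('i \<Rightarrow> 'k) \<Rightarrow> 'i \<Rightarrow> 'k"
  by unfold_locales (simp_all add: scale_dual_def fun_eq_iff algebra_simps)

locale residue_frobenius = frobenius_local m p
  for m :: "'a::comm_ring_1 set" and p +
  fixes \<pi> :: "'a \<Rightarrow> 'k::field" and e :: nat
  assumes residue: "residue_field_map m \<pi>"
begin

lemma pi_add: "\<pi> (x + y) = \<pi> x + \<pi> y" and pi_mult: "\<pi> (x * y) = \<pi> x * \<pi> y" and pi_1: "\<pi> 1 = 1"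
  and pi_surj: "\<exists>x. z = \<pi> x" and pi_eq_0_iff: "\<pi> x = 0 \<longleftrightarrow> x \<in> m"
  using residue unfolding residue_field_map_def surj_def by auto

lemma pi_0: "\<pi> 0 = 0"
  by (metis add_0 add_cancel_right_left pi_add)

lemma pi_sum: "\<pi> (\<Sum>b\<in>B. f b) = (\<Sum>b\<in>B. \<pi> (f b))"
  by (induction B rule: infinite_finite_induct) (simp_all add: pi_0 pi_add)

lemma pi_diff: "\<pi> (x - y) = \<pi> x - \<pi> y"
  using pi_add[of "x - y" y] by simp

lemma pi_power: "\<pi> (x ^ k) = \<pi> x ^ k"
  by (induction k) (simp_all add: pi_1 pi_mult)

interpretation K: Modules.module "frob e :: 'a \<Rightarrow> 'a \<Rightarrow> 'a"
  by (rule module_frob_p)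

lemma one_neq_zero: "(1::'a) \<noteq> 0"
  using one_notin_m R.subspace_0[OF is_ideal_m] by auto

text \<open>
  \<open>\<theta>\<close> evaluates an element of \<open>F\<^sup>e\<^sub>* R\<close> at all linear maps \<open>F\<^sup>e\<^sub>* R \<rightarrow> R \<rightarrow> k\<close>. Its kernel is \<open>I\<^sub>e(R)\<close>, so its
  range is the \<open>k\<close>-vector space \<open>F\<^sup>e\<^sub>* R / I\<^sub>e(R)\<close>.
\<close>

definition \<theta> :: "'a \<Rightarrow> ('a \<Rightarrow> 'a) \<Rightarrow> 'k"
  where "\<theta> x = (\<lambda>\<phi>. if frob_hom e \<phi> then \<pi> (\<phi> x) else 0)"

lemma theta_add: "\<theta> (x + y) = \<theta> x + \<theta> y"
  by (auto simp: \<theta>_def fun_eq_iff frob_hom_add pi_add)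

lemma theta_frob: "\<theta> (frob e r x) = scale_dual (\<pi> r) (\<theta> x)"
  by (auto simp: \<theta>_def fun_eq_iff frob_eq frob_hom_scale pi_mult scale_dual_def)

lemma theta_eq_0_iff: "\<theta> x = 0 \<longleftrightarrow> x \<in> splitting_ideal e"
  unfolding splitting_ideal_iff by (auto simp: \<theta>_def fun_eq_iff pi_eq_0_iff)

lemma theta_0: "\<theta> 0 = 0"
  using theta_add[of 0 0] by simp

lemma theta_diff: "\<theta> (x - y) = \<theta> x - \<theta> y"
  using theta_add[of "x - y" y] by simp

lemma theta_sum: "\<theta> (\<Sum>b\<in>B. frob e (r b) b) = (\<Sum>b\<in>B. scale_dual (\<pi> (r b)) (\<theta> b))"
  by (induction B rule: infinite_finite_induct) (simp_all add: theta_0 theta_add theta_frob)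

lemma theta_span: "finite B \<Longrightarrow> x \<in> K.span B \<Longrightarrow> \<theta> x \<in> D.span (\<theta> ` B)"
proof -
  assume "finite B" "x \<in> K.span B"
  then obtain u where "x = (\<Sum>b\<in>B. frob e (u b) b)" using K.span_finite by blast
  then show ?thesis by (simp add: theta_sum D.span_sum D.span_scale D.span_base)
qed

lemma ex_pi_family: "\<exists>r. \<forall>b. u b = \<pi> (r b)"
  by (intro choice allI pi_surj)

definition decomposition :: "nat \<Rightarrow> 'a set \<Rightarrow> 'a set \<Rightarrow> bool"
  where "decomposition a N M \<longleftrightarrow> direct_sum_decomp (frob e) UNIV N M \<and> free_of_rank (frob e) N a"

text \<open>Projection onto \<open>N\<close> along \<open>M\<close> followed by a coordinate is a
  linear map \<open>F^e_* R -> R\<close>. As \<open>\<theta>\<close> records its values modulo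
  \<open>m\<close>, a relation between the \<open>\<theta> b\<close> has all coefficients
  zero.\<close>

lemma decomposition_independent:
  assumes "decomposition a N M"
  obtains B where "finite B" "card B = a" "K.independent B" "K.span B = N"
    "inj_on \<theta> B" "D.independent (\<theta> ` B)"
proof -
  have N: "K.subspace N" and M: "K.subspace M" and NM: "N \<inter> M = {0}"
    and sum: "\<And>x. \<exists>n k. n \<in> N \<and> k \<in> M \<and> x = n + k"
    using assms unfolding decomposition_def direct_sum_decomp_def by blast+
  obtain B where B: "finite B" "card B = a" "K.independent B" "K.span B = N"
    using assms unfolding decomposition_def free_of_rank_def by blast
  define P where "P x = (SOME n. n \<in> N \<and> x - n \<in> M)" for x
  have P: "P x = n" if "n \<in> N" "x - n \<in> M" for x n
  proof -
    have "P x \<in> N \<and> x - P x \<in> M" unfolding P_def by (rule someI[of _ n]) (use that in simp)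
    then have "n - P x \<in> N" "(x - P x) - (x - n) \<in> M" using that K.subspace_diff[OF N] K.subspace_diff[OF M] by blast+
    then have "n - P x \<in> N \<inter> M" by simp
    then show ?thesis unfolding NM by simp
  qed
  have PN: "P x \<in> N \<and> x - P x \<in> M" for x
  proof -
    obtain n k where "n \<in> N" "k \<in> M" "x = n + k" using sum by blast
    then show ?thesis using P[of n x] by simp
  qed
  have P_add: "P (x + y) = P x + P y" for x y
  proof (rule P)
    show "P x + P y \<in> N" using PN K.subspace_add[OF N] by blast
    have "(x - P x) + (y - P y) \<in> M" using PN K.subspace_add[OF M] by blast
    then show "x + y - (P x + P y) \<in> M" by (simp add: algebra_simps)
  qed
  have P_scale: "P (frob e r x) = frob e r (P x)" for r x
  proof (rule P)
    show "frob e r (P x) \<in> N" using PN K.subspace_scale[OF N] by blast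
    have "frob e r (x - P x) \<in> M" using PN K.subspace_scale[OF M] by blast
    then show "frob e r x - frob e r (P x) \<in> M" by (simp only: K.scale_right_diff_distrib)
  qed
  have PB: "P (\<Sum>c\<in>B. frob e (r c) c) = (\<Sum>c\<in>B. frob e (r c) c)" for r
  proof (rule P)
    show "(\<Sum>c\<in>B. frob e (r c) c) \<in> N"
      unfolding B(4)[symmetric] by (intro K.span_sum K.span_scale K.span_base)
  qed (use K.subspace_0[OF M] in simp)
  define coord where "coord b x = K.representation B (P x) b" for b x
  have PNB: "P x \<in> K.span B" for x using PN B(4) by blast
  have hom: "frob_hom e (coord b)" for b
    unfolding frob_hom_def
  proof (intro conjI allI)
    show "coord b (x + y) = coord b x + coord b y" for x y
      unfolding coord_def P_add K.representation_add[OF B(3) PNB PNB] by simp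
    show "coord b (r ^ (p ^ e) * x) = r * coord b x" for r x
      using P_scale[of r x] K.representation_scale[OF B(3) PNB, of r x] by (simp add: coord_def frob_eq)
  qed
  have coordB: "coord b (\<Sum>c\<in>B. frob e (r c) c) = r b" if b: "b \<in> B" for b r
  proof -
    have "K.representation B (\<Sum>c\<in>B. frob e (r c) c) b = (\<Sum>c\<in>B. K.representation B (frob e (r c) c) b)"
      using K.representation_sum[OF B(3), of B "\<lambda>c. frob e (r c) c"] K.span_scale K.span_base
      by (simp add: fun_eq_iff)
    also have "\<dots> = (\<Sum>c\<in>B. r c * (if c = b then 1 else 0))"
      by (intro sum.cong refl) (simp add: K.representation_scale[OF B(3)] K.span_base K.representation_basis[OF B(3)])
    also have "\<dots> = r b" using b B(1) by (simp add: if_distrib cong: if_cong)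
    finally show ?thesis by (simp add: coord_def PB)
  qed
  have "\<forall>b\<in>B. u b = 0" if u: "(\<Sum>b\<in>B. scale_dual (u b) (\<theta> b)) = 0" for u
  proof
    fix b assume b: "b \<in> B"
    obtain r where r: "\<And>b. u b = \<pi> (r b)" using ex_pi_family[of u] by blast
    have "\<theta> (\<Sum>b\<in>B. frob e (r b) b) = 0" using u unfolding theta_sum r .
    then have "coord b (\<Sum>c\<in>B. frob e (r c) c) \<in> m"
      using hom[of b] unfolding theta_eq_0_iff splitting_ideal_iff by blast
    then show "u b = 0" using coordB[OF b] r pi_eq_0_iff by simp
  qed
  from D.independent_image_family[where f = \<theta>, OF B(1) this] that[OF B] show ?thesis by simp
qed

text \<open>\<open>\<phi>\<close> splits the inclusion of the span of \<open>y\<close>, with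
  complement the kernel of \<open>\<phi>\<close> on \<open>M\<close>.\<close>

lemma free_summandI:
  assumes M: "K.subspace M" and y: "y \<in> M" and phi: "frob_hom e \<phi>" "\<phi> y = 1"
  shows "has_free_summand (frob e) M"
proof -
  have phi_r: "\<phi> (frob e r y) = r" for r using frob_hom_scale[OF phi(1)] phi(2) by (simp add: frob_eq)
  have phi_s: "\<phi> (frob e r x) = r * \<phi> x" for r x using frob_hom_scale[OF phi(1)] by (simp add: frob_eq)
  have phi_d: "\<phi> (x - z) = \<phi> x - \<phi> z" for x z
    using frob_hom_add[OF phi(1), of "x - z" z] by simp
  let ?N = "K.span {y}" and ?N' = "{z \<in> M. \<phi> z = 0}"
  have "direct_sum_decomp (frob e) M ?N ?N'"
    unfolding direct_sum_decomp_def
  proof (intro conjI)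
    show "K.subspace ?N" by simp
    show N': "K.subspace ?N'"
      by (rule K.subspaceI) (use K.subspace_0[OF M] K.subspace_add[OF M] K.subspace_scale[OF M]
        frob_hom_0[OF phi(1)] frob_hom_add[OF phi(1)] phi_s in auto)
    show "?N \<inter> ?N' = {0}"
    proof (intro equalityI subsetI)
      fix z assume "z \<in> ?N \<inter> ?N'"
      then obtain r where "z = frob e r y" "\<phi> z = 0" by (auto simp: K.span_singleton)
      then show "z \<in> {0}" using phi_r by simp
    qed (use K.span_zero K.subspace_0[OF N'] in auto)
    show "M = {x + z | x z. x \<in> ?N \<and> z \<in> ?N'}"
    proof (intro equalityI subsetI)
      fix z assume z: "z \<in> M"
      have "frob e (\<phi> z) y \<in> ?N" by (auto simp: K.span_singleton)
      moreover have "z - frob e (\<phi> z) y \<in> ?N'"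
        using z y K.subspace_diff[OF M] K.subspace_scale[OF M] phi_d phi_r by simp
      moreover have "z = frob e (\<phi> z) y + (z - frob e (\<phi> z) y)" by simp
      ultimately show "z \<in> {x + z | x z. x \<in> ?N \<and> z \<in> ?N'}" by blast
    next
      fix z assume "z \<in> {x + z | x z. x \<in> ?N \<and> z \<in> ?N'}"
      then show "z \<in> M" using y K.subspace_add[OF M] K.subspace_scale[OF M] by (auto simp: K.span_singleton)
    qed
  qed
  moreover have "free_of_rank (frob e) ?N 1"
    unfolding free_of_rank_def
  proof (intro exI[of _ "{y}"] conjI)
    show "\<not> K.dependent {y}"
    proof
      assume "K.dependent {y}"
      then obtain u where "u y \<noteq> 0" "frob e (u y) y = 0" by (auto simp: K.dependent_finite)
      then show False using phi_r[of "u y"] frob_hom_0[OF phi(1)] by simp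
    qed
  qed auto
  ultimately show ?thesis unfolding has_free_summand_def by blast
qed

text \<open>Without a free summand \<open>M\<close> lies in the splitting ideal, so
  \<open>\<theta>\<close> kills it and the basis of \<open>N\<close> accounts for the whole
  range.\<close>

lemma maximal_decomposition_basis:
  assumes dec: "decomposition a N M" and max: "\<not> has_free_summand (frob e) M"
  obtains B where "finite B" "card B = a" "inj_on \<theta> B" "D.independent (\<theta> ` B)" "range \<theta> \<subseteq> D.span (\<theta> ` B)"
proof -
  obtain B where B: "finite B" "card B = a" "K.independent B" "K.span B = N"
    "inj_on \<theta> B" "D.independent (\<theta> ` B)" by (rule decomposition_independent[OF dec])
  have M: "K.subspace M" and sum: "\<And>x. \<exists>n k. n \<in> N \<and> k \<in> M \<and> x = n + k"
    using dec unfolding decomposition_def direct_sum_decomp_def by blast+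
  have "k \<in> splitting_ideal e" if "k \<in> M" for k
    unfolding splitting_ideal_def splits_frob_iff using free_summandI[OF M that] max by blast
  then have theta_M: "\<theta> k = 0" if "k \<in> M" for k using that theta_eq_0_iff by blast
  have "\<theta> x \<in> D.span (\<theta> ` B)" for x
  proof -
    obtain n k where nk: "n \<in> N" "k \<in> M" "x = n + k" using sum by blast
    then show ?thesis using theta_span[OF B(1), of n] B(4) by (simp add: theta_add theta_M)
  qed
  then show ?thesis using that[of B] B by blast
qed

lemma decomposition_Suc:
  assumes dec: "decomposition a N M" and "has_free_summand (frob e) M"
  shows "\<exists>N M. decomposition (Suc a) N M"
proof -
  have N: "K.subspace N" and M: "K.subspace M" and NM: "N \<inter> M = {0}"
    and sum: "\<And>x. \<exists>n k. n \<in> N \<and> k \<in> M \<and> x = n + k"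
    using dec unfolding decomposition_def direct_sum_decomp_def by blast+
  obtain B where B: "finite B" "card B = a" "K.independent B" "K.span B = N"
    using dec unfolding decomposition_def free_of_rank_def by blast
  obtain N1 N2 where dec1: "direct_sum_decomp (frob e) M N1 N2" and "free_of_rank (frob e) N1 1"
    using assms(2) unfolding has_free_summand_def by blast
  then obtain C where "card C = 1" "K.independent C" "K.span C = N1" unfolding free_of_rank_def by blast
  then obtain y where y: "K.independent {y}" "K.span {y} = N1" by (metis card_1_singletonE)
  have N1: "K.subspace N1" and N2: "K.subspace N2" and N12: "N1 \<inter> N2 = {0}"
    and M_eq: "M = {x + z | x z. x \<in> N1 \<and> z \<in> N2}"
    using dec1 unfolding direct_sum_decomp_def by blast+
  have N1M: "N1 \<subseteq> M"
  proof
    fix x assume "x \<in> N1"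
    then have "x + 0 \<in> M" unfolding M_eq using K.subspace_0[OF N2] by blast
    then show "x \<in> M" by simp
  qed
  have N2M: "N2 \<subseteq> M"
  proof
    fix x assume "x \<in> N2"
    then have "0 + x \<in> M" unfolding M_eq using K.subspace_0[OF N1] by blast
    then show "x \<in> M" by simp
  qed
  have yN1: "y \<in> N1" using y(2) K.span_base by auto
  have y0: "y \<noteq> 0"
  proof
    assume "y = 0"
    then have "K.dependent {y}" unfolding K.dependent_finite[OF finite.insertI[OF finite.emptyI]]
      using one_neq_zero by (intro exI[of _ "\<lambda>_. 1"]) simp
    then show False using y(1) by simp
  qed
  have yB: "y \<notin> B"
  proof
    assume "y \<in> B"
    then have "y \<in> N \<inter> M" using B(4) K.span_base yN1 N1M by blast
    then show False using NM y0 by simp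
  qed
  have ind: "K.independent (insert y B)"
  proof
    assume "K.dependent (insert y B)"
    then obtain u v where u: "(\<Sum>x\<in>insert y B. frob e (u x) x) = 0" "v \<in> insert y B" "u v \<noteq> 0"
      using K.dependent_finite[of "insert y B"] B(1) by auto
    have S: "(\<Sum>x\<in>B. frob e (u x) x) \<in> N" unfolding B(4)[symmetric] by (intro K.span_sum K.span_scale K.span_base)
    have eq: "frob e (u y) y = - (\<Sum>x\<in>B. frob e (u x) x)"
      using u(1) B(1) yB by (simp add: add_eq_0_iff2)
    then have "frob e (u y) y \<in> N" using K.subspace_neg[OF N S] by simp
    moreover have "frob e (u y) y \<in> M" using yN1 N1M K.subspace_scale[OF M] by blast
    ultimately have uy: "frob e (u y) y = 0" using NM by blast
    then have uB: "(\<Sum>x\<in>B. frob e (u x) x) = 0" using eq by simp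
    have "u y = 0" by (rule K.independentD[OF y(1), of "{y}" u y]) (simp_all add: uy)
    moreover have "u x = 0" if "x \<in> B" for x
      by (rule K.independentD[OF B(3,1) order_refl uB that])
    ultimately show False using u(2,3) by blast
  qed
  let ?N = "K.span (insert y B)"
  have span: "?N = {x + z | x z. x \<in> N1 \<and> z \<in> N}"
    using K.span_Un[of "{y}" B] B(4) y(2) by simp
  have "decomposition (Suc a) ?N N2"
    unfolding decomposition_def direct_sum_decomp_def
  proof (intro conjI)
    show "free_of_rank (frob e) ?N (Suc a)"
      unfolding free_of_rank_def using ind B(1,2) yB by (intro exI[of _ "insert y B"]) auto
    show "K.subspace ?N" by simp
    show "K.subspace N2" by (rule N2)
    show "?N \<inter> N2 = {0}"
    proof (intro equalityI subsetI)
      fix x assume x: "x \<in> ?N \<inter> N2"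
      then obtain n1 n where n: "n1 \<in> N1" "n \<in> N" "x = n1 + n" unfolding span by blast
      then have "n = x - n1" by simp
      then have "n \<in> M" using x N2M N1M n(1) K.subspace_diff[OF M] by blast
      then have "n = 0" using n(2) NM by blast
      then have "x \<in> N1 \<inter> N2" using n x by simp
      then show "x \<in> {0}" using N12 by simp
    qed (use K.span_zero K.subspace_0[OF N2] in auto)
    show "UNIV = {x + z | x z. x \<in> ?N \<and> z \<in> N2}"
    proof (intro equalityI subsetI)
      fix x :: 'a
      obtain n k where nk: "n \<in> N" "k \<in> M" "x = n + k" using sum by blast
      obtain n1 n2 where n12: "n1 \<in> N1" "n2 \<in> N2" "k = n1 + n2" using nk(2) unfolding M_eq by blast
      have "n1 + n \<in> ?N" unfolding span using nk(1) n12(1) by blast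
      moreover have "x = (n1 + n) + n2" using nk(3) n12(3) by simp
      ultimately show "x \<in> {x + z | x z. x \<in> ?N \<and> z \<in> N2}" using n12(2) by blast
    qed simp
  qed
  then show ?thesis by blast
qed

text \<open>Independence after \<open>\<theta>\<close> bounds the rank by the number of generators
  of \<open>F^e_* R\<close>. In a decomposition of greatest rank, \<open>M\<close> has no free
  summand that could be moved to \<open>N\<close>.\<close>

lemma ex_maximal_decomposition: "\<exists>a N M. decomposition a N M \<and> \<not> has_free_summand (frob e) M"
proof -
  obtain G :: "'a set" where G: "finite G" "K.span G = UNIV" using frob_fg[of e] by blast
  have bound: "a \<le> card (\<theta> ` G)" if dec: "decomposition a N M" for a N M
  proof -
    obtain B where B: "finite B" "card B = a" "inj_on \<theta> B" "D.independent (\<theta> ` B)"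
      using decomposition_independent[OF dec] by metis
    have "\<theta> ` B \<subseteq> D.span (\<theta> ` G)" using theta_span[OF G(1)] G(2) by auto
    then have "card (\<theta> ` B) \<le> card (\<theta> ` G)"
      using D.independent_span_bound[OF finite_imageI[OF G(1)] B(4)] by simp
    then show ?thesis using B(2,3) by (simp add: card_image)
  qed
  have "decomposition 0 {0} UNIV"
    unfolding decomposition_def direct_sum_decomp_def free_of_rank_def
    using K.independent_empty by (auto intro!: exI[of _ "{}"] simp: K.span_empty)
  then have ex: "\<exists>a. \<exists>N M. decomposition a N M" by blast
  define a where "a = (GREATEST a. \<exists>N M. decomposition a N M)"
  have le: "a' \<le> a" if "\<exists>N M. decomposition a' N M" for a'
    unfolding a_def by (rule Greatest_le_nat[where b = "card (\<theta> ` G)"]) (use that bound in blast)+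
  have "\<exists>N M. decomposition a N M"
    unfolding a_def by (rule GreatestI_ex_nat[where b = "card (\<theta> ` G)", OF ex]) (use bound in blast)
  then obtain N M where dec: "decomposition a N M" by blast
  have "\<not> has_free_summand (frob e) M"
    using decomposition_Suc[OF dec] le[of "Suc a"] by auto
  then show ?thesis using dec by blast
qed

lemma splitting_number_basis:
  obtains B where "finite B" "card B = splitting_number TYPE('a) e" "inj_on \<theta> B"
    "D.independent (\<theta> ` B)" "range \<theta> \<subseteq> D.span (\<theta> ` B)"
proof -
  have dim: "a = D.dim (range \<theta>)" if max: "decomposition a N M" "\<not> has_free_summand (frob e) M" for a N M
  proof -
    obtain B where B: "finite B" "card B = a" "inj_on \<theta> B" "D.independent (\<theta> ` B)" "range \<theta> \<subseteq> D.span (\<theta> ` B)"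
      by (rule maximal_decomposition_basis[OF max])
    have "card (\<theta> ` B) = D.dim (range \<theta>)" using B by (intro D.basis_card_eq_dim) auto
    then show ?thesis using B(2,3) by (simp add: card_image)
  qed
  obtain a N M where max: "decomposition a N M" "\<not> has_free_summand (frob e) M"
    using ex_maximal_decomposition by blast
  have "splitting_number TYPE('a) e = a"
    unfolding splitting_number_def
  proof (rule the_equality)
    show "\<exists>N M :: 'a set. direct_sum_decomp (frob e) UNIV N M \<and> free_of_rank (frob e) N a \<and> \<not> has_free_summand (frob e) M"
      using max unfolding decomposition_def by blast
    fix a' assume "\<exists>N M :: 'a set. direct_sum_decomp (frob e) UNIV N M \<and> free_of_rank (frob e) N a' \<and> \<not> has_free_summand (frob e) M"
    then obtain N' M' where "decomposition a' N' M'" "\<not> has_free_summand (frob e) M'"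
      unfolding decomposition_def by blast
    then show "a' = a" using dim max by metis
  qed
  then show ?thesis using maximal_decomposition_basis[OF max] that by metis
qed

section \<open>The degree of \<open>k^(1/q)\<close> and its comparison with the splitting
  number\<close>

definition scale_root :: "'k \<Rightarrow> 'k \<Rightarrow> 'k"
  where "scale_root c y = c ^ (p ^ e) * y"

lemma power_add_k: "(x + y) ^ (p ^ e) = x ^ (p ^ e) + y ^ (p ^ e)" for x y :: 'k
proof -
  obtain a b where ab: "x = \<pi> a" "y = \<pi> b" using pi_surj by metis
  show ?thesis unfolding ab using arg_cong[OF power_p_power_add[of a b e], of \<pi>] by (simp add: pi_power pi_add)
qed

lemma vector_space_scale_root: "vector_space scale_root"
  by unfold_locales (simp_all add: scale_root_def power_add_k algebra_simps power_mult_distrib)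

interpretation S: vector_space scale_root
  by (rule vector_space_scale_root)

lemma char_k: "CHAR('k) = p"
proof -
  have "of_nat k = \<pi> (of_nat k)" for k by (induction k) (simp_all add: pi_0 pi_1 pi_add)
  then have "of_nat p = (0::'k)" using pi_0 char by (metis of_nat_CHAR)
  then have "CHAR('k) dvd p" by (simp add: of_nat_eq_0_iff_char_dvd)
  then show ?thesis using prime CHAR_not_1' by (auto simp: prime_nat_iff)
qed

text \<open>In characteristic \<open>p\<close>, raising to the power \<open>q\<close> is additive
  and injective on the algebraic closure. So taking \<open>q\<close>-th roots is an isomorphism onto
  \<open>k^(1/q)\<close> from \<open>F^e_* k\<close>, which is what \<open>scale_root\<close>
  describes.\<close>

lemma root_degree_eq_dim: "root_degree TYPE('k) (p ^ e) = S.dim UNIV"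
proof -
  have q: "p ^ e > 0" using p_pos by simp
  have prime_ac: "prime CHAR('k alg_closure)" using prime by (simp add: char_k)
  have add: "(z + w) ^ (p ^ e) = z ^ (p ^ e) + w ^ (p ^ e)" for z w :: "'k alg_closure"
    by (rule freshmans_dream'[OF prime_ac]) (simp add: char_k)
  have inj: "z = w" if "z ^ (p ^ e) = w ^ (p ^ e)" for z w :: "'k alg_closure"
  proof -
    have "(z - w) ^ (p ^ e) = 0" using add[of "z - w" w] that by simp
    then show ?thesis by simp
  qed
  define t where "t c z = to_ac c * z" for c :: 'k and z
  interpret T: vector_space t by unfold_locales (simp_all add: t_def algebra_simps)
  have "\<exists>z. z ^ (p ^ e) = to_ac y" for y :: 'k using nth_root_exists[OF q, of "to_ac y"] by blast
  then obtain f where f: "\<And>y :: 'k. f y ^ (p ^ e) = to_ac y" by metis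
  interpret f: module_hom scale_root t f
  proof unfold_locales
    show "f (x + y) = f x + f y" for x y by (rule inj) (simp add: f add)
    show "f (scale_root c y) = t c (f y)" for c y
      by (rule inj) (simp add: f scale_root_def t_def power_mult_distrib)
  qed
  have "inj f" by (rule injI) (metis f to_ac_eq_iff)
  have range: "range f = root_field (p ^ e)"
    unfolding root_field_def using f inj by (auto, metis rangeI)
  obtain B where B: "S.independent B" "UNIV \<subseteq> S.span B" "card B = S.dim UNIV"
    using S.basis_exists[of UNIV] by metis
  have "T.independent (f ` B)"
    by (rule f.independent_injective_image[OF B(1)]) (use \<open>inj f\<close> in \<open>rule inj_on_subset[OF _ subset_UNIV]\<close>)
  moreover have "root_field (p ^ e) \<subseteq> T.span (f ` B)" unfolding range[symmetric] using f.spans_image[OF B(2)] by simp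
  ultimately have "card (f ` B) = T.dim (root_field (p ^ e))"
    by (intro T.basis_card_eq_dim) (auto simp flip: range)
  then have "T.dim (root_field (p ^ e)) = S.dim UNIV"
    using B(3) card_image[OF inj_on_subset[OF \<open>inj f\<close> subset_UNIV]] by simp
  then show ?thesis by (simp add: root_degree_def t_def[abs_def])
qed

text \<open>\<open>B\<close> lifts a basis of \<open>F^e_* R / I_e(R)\<close>. As
  \<open>I_e(R)\<close> lies in \<open>m\<close>, the image of \<open>B\<close> under
  \<open>\<pi>\<close> spans \<open>F^e_* k\<close>, so \<open>a_e(R)\<close> is at least the
  degree; equality says that \<open>\<pi>\<close> keeps \<open>B\<close> independent, which means
  \<open>I_e(R) = m\<close>.\<close>

lemma splitting_number_eq_iff:
  "splitting_number TYPE('a) e = root_degree TYPE('k) (p ^ e) \<longleftrightarrow> splitting_ideal e = m"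
proof -
  obtain B where B: "finite B" "card B = splitting_number TYPE('a) e" "inj_on \<theta> B"
    "D.independent (\<theta> ` B)" "range \<theta> \<subseteq> D.span (\<theta> ` B)" by (rule splitting_number_basis)
  have pi_frob: "\<pi> (\<Sum>b\<in>B. frob e (r b) b) = (\<Sum>b\<in>B. scale_root (\<pi> (r b)) (\<pi> b))" for r
    by (simp add: pi_sum frob_eq scale_root_def pi_mult pi_power)
  have rep: "\<exists>r. x - (\<Sum>b\<in>B. frob e (r b) b) \<in> splitting_ideal e" for x
  proof -
    have "\<theta> x \<in> D.span (\<theta> ` B)" using B(5) by blast
    then obtain u where "\<theta> x = (\<Sum>v\<in>\<theta> ` B. scale_dual (u v) v)"
      using D.span_finite[OF finite_imageI[OF B(1)]] by blast
    then have u: "\<theta> x = (\<Sum>b\<in>B. scale_dual (u (\<theta> b)) (\<theta> b))" by (simp add: sum.reindex[OF B(3)])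
    obtain r where r: "\<And>b. u (\<theta> b) = \<pi> (r b)" using ex_pi_family[of "\<lambda>b. u (\<theta> b)"] by blast
    have "\<theta> (x - (\<Sum>b\<in>B. frob e (r b) b)) = 0" by (simp add: theta_diff theta_sum u r)
    then show ?thesis using theta_eq_0_iff by blast
  qed
  have rep_pi: "\<pi> x = (\<Sum>b\<in>B. scale_root (\<pi> (r b)) (\<pi> b))"
    if "x - (\<Sum>b\<in>B. frob e (r b) b) \<in> splitting_ideal e" for x r
  proof -
    have "\<pi> (x - (\<Sum>b\<in>B. frob e (r b) b)) = 0" using that splitting_ideal_subset pi_eq_0_iff by blast
    then show ?thesis by (simp add: pi_diff pi_frob)
  qed
  have span: "UNIV \<subseteq> S.span (\<pi> ` B)"
  proof
    fix y :: 'k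
    obtain x where x: "y = \<pi> x" using pi_surj by blast
    obtain r where "x - (\<Sum>b\<in>B. frob e (r b) b) \<in> splitting_ideal e" using rep by blast
    from rep_pi[OF this] show "y \<in> S.span (\<pi> ` B)"
      unfolding x by (simp add: S.span_sum S.span_scale S.span_base)
  qed
  show ?thesis
    unfolding root_degree_eq_dim
  proof
    assume I: "splitting_ideal e = m"
    have "\<forall>b\<in>B. u b = 0" if u: "(\<Sum>b\<in>B. scale_root (u b) (\<pi> b)) = 0" for u
    proof
      fix b assume b: "b \<in> B"
      obtain r where r: "\<And>b. u b = \<pi> (r b)" using ex_pi_family[of u] by blast
      have "\<pi> (\<Sum>b\<in>B. frob e (r b) b) = 0" using u by (simp add: pi_frob r)
      then have "\<theta> (\<Sum>b\<in>B. frob e (r b) b) = 0" using I by (simp add: theta_eq_0_iff pi_eq_0_iff)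
      then have "(\<Sum>b\<in>B. scale_dual (\<pi> (r b)) (\<theta> b)) = 0" unfolding theta_sum .
      from D.independent_familyD[OF B(1,3,4) this b] show "u b = 0" by (simp add: r)
    qed
    from S.independent_image_family[where f = \<pi>, OF B(1) this] have "inj_on \<pi> B" "S.independent (\<pi> ` B)" by simp_all
    moreover from this(2) have "card (\<pi> ` B) = S.dim UNIV" using span by (intro S.basis_card_eq_dim) auto
    ultimately show "splitting_number TYPE('a) e = S.dim UNIV" using B(2) by (simp add: card_image)
  next
    assume eq: "splitting_number TYPE('a) e = S.dim UNIV"
    have "card (\<pi> ` B) \<le> card B" using B(1) by (rule card_image_le)
    then have ind: "S.independent (\<pi> ` B)"
      using S.independent_if_card_le_dim[OF finite_imageI[OF B(1)] span subset_UNIV] B(2) eq by simp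
    then have "card (\<pi> ` B) = S.dim UNIV" using span by (intro S.basis_card_eq_dim) auto
    then have inj: "inj_on \<pi> B" using B(1,2) eq by (intro eq_card_imp_inj_on) auto
    \<comment> \<open>The coordinates of \<open>x\<close> modulo \<open>I_e(R)\<close> form a
      relation between the \<open>\<pi> b\<close>, because \<open>\<pi> x = 0\<close>; hence they
      vanish in \<open>k\<close>.\<close>
    have "x \<in> splitting_ideal e" if x: "x \<in> m" for x
    proof -
      obtain r where r: "x - (\<Sum>b\<in>B. frob e (r b) b) \<in> splitting_ideal e" using rep by blast
      have "(\<Sum>b\<in>B. scale_root (\<pi> (r b)) (\<pi> b)) = 0" using rep_pi[OF r] x pi_eq_0_iff[of x] by (simp only:)
      then have "\<pi> (r b) = 0" if "b \<in> B" for b using S.independent_familyD[OF B(1) inj ind _ that, of "\<lambda>b. \<pi> (r b)"] by simp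
      then have "\<theta> (\<Sum>b\<in>B. frob e (r b) b) = 0" by (simp add: theta_sum)
      then have "\<theta> x = 0" using r by (simp add: theta_diff flip: theta_eq_0_iff)
      then show ?thesis using theta_eq_0_iff by blast
    qed
    then show "splitting_ideal e = m" using splitting_ideal_subset by blast
  qed
qed

end

theorem theorem3:
  fixes m :: "'a::comm_ring_1 set"
    and \<pi> :: "'a \<Rightarrow> 'k::field"
    and p d :: nat
  assumes "noetherian TYPE('a)"
    and "local_ring m"
    and "residue_field_map m \<pi>"
    and "krull_dim TYPE('a) = enat d"
    and "prime p" and "CHAR('a) = p"
    and "F_finite TYPE('a)"
    and "F_pure TYPE('a)"
    and "gorenstein TYPE('b::ab_group_add) TYPE('a)"
  shows "(splitting_number TYPE('a) 1 = root_degree TYPE('k) p \<longleftrightarrow>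
            (\<exists>e\<ge>1. splitting_number TYPE('a) e = root_degree TYPE('k) (p ^ e)))
       \<and> ((\<exists>e\<ge>1. splitting_number TYPE('a) e = root_degree TYPE('k) (p ^ e)) \<longleftrightarrow>
            (\<forall>e\<ge>1. splitting_number TYPE('a) e = root_degree TYPE('k) (p ^ e)))
       \<and> ((\<forall>e\<ge>1. splitting_number TYPE('a) e = root_degree TYPE('k) (p ^ e)) \<longleftrightarrow>
            splitting_ideal 1 = m)
       \<and> (splitting_ideal 1 = m \<longleftrightarrow> (\<exists>e\<ge>1. splitting_ideal e = m))
       \<and> ((\<exists>e\<ge>1. splitting_ideal e = m) \<longleftrightarrow> (\<forall>e\<ge>1. splitting_ideal e = m))
       \<and> ((\<forall>e\<ge>1. splitting_ideal e = m) \<longleftrightarrow> splitting_prime = m)"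
proof -
  interpret frobenius_local m p
    by unfold_locales (rule assms)+
  have residue: "residue_frobenius m p \<pi>"
    by unfold_locales (rule assms)
  have number: "splitting_number TYPE('a) e = root_degree TYPE('k) (p ^ e) \<longleftrightarrow> splitting_ideal e = m" for e
    by (rule residue_frobenius.splitting_number_eq_iff[OF residue])
  have number_1: "splitting_number TYPE('a) 1 = root_degree TYPE('k) p \<longleftrightarrow> splitting_ideal 1 = m"
    using number[of 1] by simp
  \<comment> \<open>Any single exponent \<open>k\<close> yields exponent 1, and exponent 1 yields
    all exponents by the Gorenstein property.\<close>
  have "splitting_ideal e = m" if "splitting_ideal k = m" "k \<ge> 1" for e k
    using splitting_ideal_all[OF assms(9)] splitting_ideal_1 that by blast
  then show ?thesis
    unfolding number number_1 splitting_prime_eq_iff by (metis order_refl)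
qed

end
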